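(* Let $\mathcal D$ be a bounded subset of $\mathbb R$ that contains an open interval, and let $Y(s)=X(s)\beta+W(s)$ for $s\in\mathcal D$. Let $(X,W)$ be a non-degenerate stationary bivariate Gaussian random field such that $X$ and $W$ marginally have power exponential covariances with exponent parameters $\delta_X\in(0,2)$ and $\delta_W\in(0,2)$ respectively, and the cross-covariance satisfies condition $\mathrm A(L,c_{12},\alpha_{12})$ (defined in the context) for some $\alpha_{12}>\delta_X$. Then: (a) If $\delta_X<\delta_W+1$, then $\beta$ is consistently estimable. A consistent estimator of $\beta$ is the OLS estimator between the first order differences of $Y$ and those of $X$ on a one-dimensional regular lattice. (b) If $\delta_X>\delta_W+1$, then $\beta$ is not consistently estimable.
   Context: Power exponential covariance with exponent $\delta$: $K(t)=\sigma^2\exp(-\phi|t|^\delta)$, $\sigma^2,\phi>0$, $0<\delta<2$. Condition $\mathrm A(L,c,\alpha)$ (for some $L>0$): the function $K$ on $\mathbb R$ can be written $K(t)=A(t)+B(t)$, where $A$ is even and analytic and $B$ is even and continuous on $[-L,L]$; the $k$-th derivative $B^{(k)}$ on $(0,L]$ ($k\ge0$, $B^{(0)}=B$) satisfies, as $t\downarrow0$, $B^{(k)}(t)=(\alpha)_k\,c\,t^{\alpha-k}+o(t^{\alpha-k})$, where $c$ is a constant (allowed to be zero for a cross-covariance), $\alpha>0$ is not an even integer and $(\alpha)_k=\Gamma(\alpha+1)/\Gamma(\alpha+1-k)$. The OLS estimator of first differences on a regular lattice $\{s_0+jh:0\le j\le n\}$, $h\to0$, filling a fixed interval in $\mathcal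 D$ is $\sum_j\{X(s_{j+1})-X(s_j)\}\{Y(s_{j+1})-Y(s_j)\}/\sum_j\{X(s_{j+1})-X(s_j)\}^2$. $W$ is unobserved. With $\delta_X,\delta_W$ fixed, the model consists of all $\beta\in\mathbb R$ and all laws of $(X,W)$ satisfying the hypotheses (independence of $X$ and $W$ included). $\beta$ is consistently estimable if there is a sequence of measurable functions of $\{(X(s),Y(s)):s\in\mathcal D\}$ converging in probability to $\beta$ under every member of the model, and not consistently estimable otherwise. *)

theory Defs
  imports "HOL-Probability.Probability" "HOL-Library.Landau_Symbols"
begin

section \<open>Covariance functions\<close>

definition power_exponential :: "real \<Rightarrow> real \<Rightarrow> real \<Rightarrow> real \<Rightarrow> real" where
  "power_exponential \<sigma>2 \<phi> \<delta> t = \<sigma>2 * exp (- \<phi> * \<bar>t\<bar> powr \<delta>)"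

definition real_analytic :: "(real \<Rightarrow> real) \<Rightarrow> bool" where
  "real_analytic f \<longleftrightarrow>
     (\<forall>x. \<exists>r>0. \<exists>a. \<forall>y. \<bar>y - x\<bar> < r \<longrightarrow> (\<lambda>n. a n * (y - x) ^ n) sums f y)"

text \<open>If \<open>\<alpha>\<close> is an odd integer, then \<open>\<alpha> + 1 - k\<close> is a pole of the Gamma function for \<open>k > \<alpha>\<close>.
  There the library has \<open>Gamma = 0\<close> and division by zero yields zero, so the quotient is
  zero, in agreement with the falling factorial \<open>\<alpha> (\<alpha> - 1) \<dots> (\<alpha> - k + 1)\<close>.\<close>

definition falling_gamma :: "real \<Rightarrow> nat \<Rightarrow> real" where
  "falling_gamma \<alpha> k = Gamma (\<alpha> + 1) / Gamma (\<alpha> + 1 - real k)"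

text \<open>The function \<open>D k\<close> is the \<open>k\<close>-th derivative of \<open>B\<close> on \<open>(0, L]\<close>, one-sided at \<open>L\<close>.\<close>

definition condition_A :: "(real \<Rightarrow> real) \<Rightarrow> real \<Rightarrow> real \<Rightarrow> real \<Rightarrow> bool" where
  "condition_A K L c \<alpha> \<longleftrightarrow>
     L > 0 \<and> \<alpha> > 0 \<and> (\<nexists>m::nat. \<alpha> = 2 * real m) \<and>
     (\<exists>A B. (\<forall>t. K t = A t + B t) \<and>
        (\<forall>t. A (- t) = A t) \<and> real_analytic A \<and>
        (\<forall>t\<in>{-L..L}. B (- t) = B t) \<and> continuous_on {-L..L} B \<and>
        (\<exists>D. (\<forall>t\<in>{0<..L}. D 0 t = B t) \<and>
             (\<forall>k. \<forall>t\<in>{0<..L}.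
                (D k has_real_derivative D (Suc k) t) (at t within {0<..L})) \<and>
             (\<forall>k. (\<lambda>t. D k t - falling_gamma \<alpha> k * c * t powr (\<alpha> - real k))
                \<in> o[at_right 0](\<lambda>t. t powr (\<alpha> - real k)))))"

section \<open>Stationary bivariate Gaussian random fields\<close>

text \<open>A bivariate field \<open>(X, W)\<close> on the real line is given by its law, a probability measure on
  the product space of all functions \<open>\<omega> :: real \<Rightarrow> real \<times> real\<close>; the fields themselves
  are the coordinate processes.\<close>

definition fieldX :: "real \<Rightarrow> (real \<Rightarrow> real \<times> real) \<Rightarrow> real" where
  "fieldX s \<omega> = fst (\<omega> s)"

definition fieldW :: "real \<Rightarrow> (real \<Rightarrow> real \<times> real) \<Rightarrow> real" where
  "fieldW s \<omega> = snd (\<omega> s)"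

definition bivariate_law :: "(real \<Rightarrow> real \<times> real) measure \<Rightarrow> bool" where
  "bivariate_law P \<longleftrightarrow> prob_space P \<and> sets P = sets (\<Pi>\<^sub>M s\<in>UNIV. borel)"

definition mean :: "'a measure \<Rightarrow> ('a \<Rightarrow> real) \<Rightarrow> real" where
  "mean P U = (\<integral>\<omega>. U \<omega> \<partial>P)"

definition covar :: "'a measure \<Rightarrow> ('a \<Rightarrow> real) \<Rightarrow> ('a \<Rightarrow> real) \<Rightarrow> real" where
  "covar P U V = (\<integral>\<omega>. (U \<omega> - mean P U) * (V \<omega> - mean P V) \<partial>P)"

text \<open>One-dimensional Gaussian variables may be degenerate (\<open>\<sigma> = 0\<close>).\<close>

definition gaussian_rv :: "'a measure \<Rightarrow> ('a \<Rightarrow> real) \<Rightarrow> bool" where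
  "gaussian_rv P U \<longleftrightarrow> U \<in> borel_measurable P \<and>
     (\<exists>\<mu> \<sigma>. \<sigma> \<ge> 0 \<and>
        distr P borel U = distr std_normal_distribution borel (\<lambda>x. \<mu> + \<sigma> * x))"

definition lin_comb ::
  "real set \<Rightarrow> (real \<Rightarrow> real) \<Rightarrow> (real \<Rightarrow> real) \<Rightarrow> (real \<Rightarrow> real \<times> real) \<Rightarrow> real" where
  "lin_comb S a b \<omega> = (\<Sum>s\<in>S. a s * fieldX s \<omega> + b s * fieldW s \<omega>)"

definition gaussian_field :: "(real \<Rightarrow> real \<times> real) measure \<Rightarrow> bool" where
  "gaussian_field P \<longleftrightarrow> (\<forall>S a b. finite S \<longrightarrow> gaussian_rv P (lin_comb S a b))"

text \<open>All finite-dimensional covariance matrices are positive definite.\<close>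

definition nondegenerate_field :: "(real \<Rightarrow> real \<times> real) measure \<Rightarrow> bool" where
  "nondegenerate_field P \<longleftrightarrow>
     (\<forall>S a b. finite S \<and> (\<exists>s\<in>S. a s \<noteq> 0 \<or> b s \<noteq> 0)
        \<longrightarrow> covar P (lin_comb S a b) (lin_comb S a b) > 0)"

text \<open>Second-order stationarity, which for Gaussian fields is the same as translation invariance
  of the law. The constant means are not required to vanish.\<close>

definition stationary_field :: "(real \<Rightarrow> real \<times> real) measure \<Rightarrow> bool" where
  "stationary_field P \<longleftrightarrow>
     (\<forall>s t. mean P (fieldX s) = mean P (fieldX t)) \<and>
     (\<forall>s t. mean P (fieldW s) = mean P (fieldW t)) \<and>
     (\<forall>s t h. covar P (fieldX (s + h)) (fieldX (t + h)) = covar P (fieldX s) (fieldX t)) \<and>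
     (\<forall>s t h. covar P (fieldW (s + h)) (fieldW (t + h)) = covar P (fieldW s) (fieldW t)) \<and>
     (\<forall>s t h. covar P (fieldX (s + h)) (fieldW (t + h)) = covar P (fieldX s) (fieldW t))"

definition model_laws :: "real \<Rightarrow> real \<Rightarrow> (real \<Rightarrow> real \<times> real) measure set" where
  "model_laws \<delta>X \<delta>W = {P.
     bivariate_law P \<and> gaussian_field P \<and> nondegenerate_field P \<and> stationary_field P \<and>
     (\<exists>\<sigma>2>0. \<exists>\<phi>>0. \<forall>s t.
        covar P (fieldX s) (fieldX t) = power_exponential \<sigma>2 \<phi> \<delta>X (s - t)) \<and>
     (\<exists>\<sigma>2>0. \<exists>\<phi>>0. \<forall>s t.
        covar P (fieldW s) (fieldW t) = power_exponential \<sigma>2 \<phi> \<delta>W (s - t)) \<and>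
     (\<exists>K L c \<alpha>. (\<forall>s t. covar P (fieldX s) (fieldW t) = K (s - t)) \<and>
        condition_A K L c \<alpha> \<and> \<alpha> > \<delta>X)}"

section \<open>Estimation\<close>

text \<open>The data \<open>(X(s), Y(s))\<close>, \<open>s \<in> D\<close>, with \<open>Y = X \<beta> + W\<close>.\<close>

definition observed ::
  "real set \<Rightarrow> real \<Rightarrow> (real \<Rightarrow> real \<times> real) \<Rightarrow> (real \<Rightarrow> real \<times> real)" where
  "observed D \<beta> \<omega> = (\<lambda>s\<in>D. (fieldX s \<omega>, fieldX s \<omega> * \<beta> + fieldW s \<omega>))"

definition consistent_estimator ::
  "real set \<Rightarrow> real \<Rightarrow> real \<Rightarrow> (nat \<Rightarrow> (real \<Rightarrow> real \<times> real) \<Rightarrow> real) \<Rightarrow> bool" where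
  "consistent_estimator D \<delta>X \<delta>W T \<longleftrightarrow>
     (\<forall>m. T m \<in> borel_measurable (\<Pi>\<^sub>M s\<in>D. borel)) \<and>
     (\<forall>\<beta>. \<forall>P\<in>model_laws \<delta>X \<delta>W. \<forall>\<epsilon>>0.
        (\<lambda>m. measure P {\<omega> \<in> space P. \<bar>T m (observed D \<beta> \<omega>) - \<beta>\<bar> > \<epsilon>}) \<longlonglongrightarrow> 0)"

definition consistently_estimable :: "real set \<Rightarrow> real \<Rightarrow> real \<Rightarrow> bool" where
  "consistently_estimable D \<delta>X \<delta>W \<longleftrightarrow> (\<exists>T. consistent_estimator D \<delta>X \<delta>W T)"

definition ols_diff :: "real \<Rightarrow> real \<Rightarrow> nat \<Rightarrow> (real \<Rightarrow> real \<times> real) \<Rightarrow> real" where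
  "ols_diff s0 h n z =
     (let x = (\<lambda>j. fst (z (s0 + real j * h)));
          y = (\<lambda>j. snd (z (s0 + real j * h)))
      in (\<Sum>j<n. (x (Suc j) - x j) * (y (Suc j) - y j)) / (\<Sum>j<n. (x (Suc j) - x j)\<^sup>2))"

end

theory Submission
  imports Defs
begin

text \<open>(a) The residual of the estimator is the ratio of \<open>\<Sum>\<^sub>j \<Delta>\<^sub>jX \<Delta>\<^sub>jW\<close> to \<open>\<Sum>\<^sub>j (\<Delta>\<^sub>jX)\<^sup>2\<close>. The
  expectation of the denominator is of order \<open>n h powr \<delta>X\<close>. Away from the origin all three
  covariances are twice differentiable with \<open>K'' t = O(t powr (p - 2))\<close>, where \<open>p\<close> is \<open>\<delta>X\<close>, \<open>\<delta>W\<close> or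
  an exponent in \<open>(\<delta>X, 2)\<close>; so the covariance of two increments at lag \<open>d\<close> is
  \<open>O(h powr p * (1 + d) powr (p - 2))\<close>. By Isserlis' formula the standard deviations of both sums
  are \<open>o(n h powr \<delta>X)\<close>, the decisive term in the variances being
  \<open>n * h powr (\<delta>X + \<delta>W) * (\<Sum>\<^sub>d (1 + d) powr (\<delta>X + \<delta>W - 4))\<close>, and Chebyshev's inequality applies.

  (b) Take \<open>X\<close> and \<open>W\<close> independent with unit parameters. Expand both in the features \<open>e\<^sub>k\<close> and
  \<open>w\<^sub>i\<close> that the Gram--Schmidt process yields from their covariance kernels:
  \<open>X = \<Sum>\<^sub>k \<eta>\<^sub>k e\<^sub>k\<close> and \<open>W = \<Sum>\<^sub>i \<xi>\<^sub>i w\<^sub>i\<close>. As \<open>\<delta>W < 1\<close>, the covariance of \<open>W\<close> is convex, hence a mixture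
  of triangles, and the norm of a function in its reproducing kernel space is bounded by a Sobolev
  norm of order \<open>(1 + \<delta>W) / 2\<close>. For the localized features \<open>e\<^sub>k\<close> the squares of this norm have a
  finite sum if \<open>\<delta>X > \<delta>W + 1\<close>, so on a bounded set \<open>X\<close> almost surely equals \<open>\<Sum>\<^sub>i m\<^sub>i w\<^sub>i\<close> with
  \<open>m = m(\<eta>)\<close> in \<open>\<ell>\<^sup>2\<close>. The data for \<open>\<beta> = 1\<close> are those for \<open>\<beta> = 0\<close> with \<open>\<xi>\<close> replaced by \<open>\<xi> + m(\<eta>)\<close>,
  and by the Cameron--Martin shift inequality this cannot turn events of vanishing probability
  into events of probability close to 1.\<close>

section \<open>Centred Gaussian variables\<close>

text \<open>Both halves meet at the same exponent. In (a) the decisive variance divided by the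
  squared mean is of order h^(1 + \<delta>W - \<delta>X), up to the lag sum. In (b) the mean squared
  increment of X over r is of order r^\<delta>X and the Sobolev weight is r^(-2 - \<delta>W), so the
  expected norm is finite when \<delta>X - 2 - \<delta>W > -1.

  For (b) a law in the model has to be built, so the power exponential kernel is shown to be
  positive semidefinite (a limit of exponentials of Gaussian mixtures) and, for non-degeneracy,
  strictly so. The norm of a random path is never taken: each deterministic feature is expanded on
  its own, and summability of the squared norms makes the Gaussian series for \<open>m\<close>
  converge.

  \<open>D\<close> may be uncountable, so null sets that depend on the site cannot be united. It is
  enough that the shifted data and the data for \<beta> = 1 agree almost surely at each site, since
  their laws on the product space then coincide. Given the noise of X, the shift of the noise of W
  is deterministic; its norm is unbounded, and Markov's inequality bounds it outside a small
  probability.\<close>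

definition centred_gaussian :: "'a measure \<Rightarrow> ('a \<Rightarrow> real) \<Rightarrow> real \<Rightarrow> bool" where
  "centred_gaussian P U v \<longleftrightarrow> U \<in> borel_measurable P \<and> v \<ge> 0 \<and>
     distr P borel U = distr std_normal_distribution borel (\<lambda>x. sqrt v * x)"

lemma
  assumes "centred_gaussian P U v"
  shows centred_gaussian_integrable_power: "integrable P (\<lambda>\<omega>. U \<omega> ^ k)"
    and centred_gaussian_moment:
      "(\<integral>\<omega>. U \<omega> ^ k \<partial>P) = sqrt v ^ k * (\<integral>x. x ^ k \<partial>std_normal_distribution)"
proof -
  have U[measurable]: "U \<in> borel_measurable P"
    and d: "distr P borel U = distr std_normal_distribution borel (\<lambda>x. sqrt v * x)"
    using assms by (auto simp: centred_gaussian_def)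
  have "integrable std_normal_distribution (\<lambda>x. (sqrt v * x) ^ k)"
    by (simp add: power_mult_distrib integrable_std_normal_distribution_moment)
  then have "integrable (distr P borel U) (\<lambda>x. x ^ k)"
    unfolding d by (subst integrable_distr_eq) auto
  then show "integrable P (\<lambda>\<omega>. U \<omega> ^ k)"
    by (subst (asm) integrable_distr_eq) auto
  have "(\<integral>\<omega>. U \<omega> ^ k \<partial>P) = (\<integral>x. x ^ k \<partial>distr P borel U)"
    by (subst integral_distr) auto
  also have "\<dots> = (\<integral>x. (sqrt v * x) ^ k \<partial>std_normal_distribution)"
    unfolding d by (subst integral_distr) auto
  finally show "(\<integral>\<omega>. U \<omega> ^ k \<partial>P) = sqrt v ^ k * (\<integral>x. x ^ k \<partial>std_normal_distribution)"
    by (simp add: power_mult_distrib)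
qed

lemma
  assumes "centred_gaussian P U v"
  shows centred_gaussian_integrable: "integrable P U"
    and centred_gaussian_mean: "(\<integral>\<omega>. U \<omega> \<partial>P) = 0"
    and centred_gaussian_second: "(\<integral>\<omega>. (U \<omega>)\<^sup>2 \<partial>P) = v"
    and centred_gaussian_fourth: "(\<integral>\<omega>. U \<omega> ^ 4 \<partial>P) = 3 * v\<^sup>2"
proof -
  have v: "v \<ge> 0" using assms by (simp add: centred_gaussian_def)
  show "integrable P U" using centred_gaussian_integrable_power[OF assms, of 1] by simp
  show "(\<integral>\<omega>. U \<omega> \<partial>P) = 0"
    using centred_gaussian_moment[OF assms, of 1]
      integral_std_normal_distribution_moment_odd[of 1] by simp
  show "(\<integral>\<omega>. (U \<omega>)\<^sup>2 \<partial>P) = v"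
    using centred_gaussian_moment[OF assms, of 2] std_normal_distribution_even_moments(1)[of 1] v
    by simp
  have "sqrt v ^ 4 = v\<^sup>2" using v by (simp add: power4_eq_xxxx power2_eq_square)
  then show "(\<integral>\<omega>. U \<omega> ^ 4 \<partial>P) = 3 * v\<^sup>2"
    using centred_gaussian_moment[OF assms, of 4] std_normal_distribution_even_moments(1)[of 2] v
    by (simp add: fact_numeral)
qed

lemma gaussian_rv_centred:
  assumes "gaussian_rv P U" "prob_space P"
  shows "centred_gaussian P (\<lambda>\<omega>. U \<omega> - mean P U) (covar P U U)" "integrable P U"
proof -
  interpret prob_space P by fact
  obtain \<mu> \<sigma> where U[measurable]: "U \<in> borel_measurable P" and \<sigma>: "\<sigma> \<ge> 0"
    and d: "distr P borel U = distr std_normal_distribution borel (\<lambda>x. \<mu> + \<sigma> * x)"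
    using assms(1) by (auto simp: gaussian_rv_def)
  have cg: "centred_gaussian P (\<lambda>\<omega>. U \<omega> - \<mu>) (\<sigma>\<^sup>2)"
    unfolding centred_gaussian_def
  proof (intro conjI)
    have "distr P borel (\<lambda>\<omega>. U \<omega> - \<mu>) = distr (distr P borel U) borel (\<lambda>x. x - \<mu>)"
      by (subst distr_distr) (auto simp: comp_def)
    also have "\<dots> = distr std_normal_distribution borel (\<lambda>x. sqrt (\<sigma>\<^sup>2) * x)"
      unfolding d using \<sigma> by (subst distr_distr) (auto simp: comp_def)
    finally show "distr P borel (\<lambda>\<omega>. U \<omega> - \<mu>) = distr std_normal_distribution borel (\<lambda>x. sqrt (\<sigma>\<^sup>2) * x)" .
  qed auto
  have "integrable P (\<lambda>\<omega>. (U \<omega> - \<mu>) + \<mu>)"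
    using centred_gaussian_integrable[OF cg] by (intro Bochner_Integration.integrable_add) auto
  then show i: "integrable P U" by simp
  have m: "mean P U = \<mu>"
    using centred_gaussian_mean[OF cg] i by (simp add: mean_def prob_space)
  have "covar P U U = \<sigma>\<^sup>2"
    using centred_gaussian_second[OF cg] by (simp add: covar_def m power2_eq_square)
  then show "centred_gaussian P (\<lambda>\<omega>. U \<omega> - mean P U) (covar P U U)"
    using cg m by simp
qed

text \<open>Joint Gaussianity is used through linear combinations only: the identity (x + y)^4 + (x
  - y)^4 = 2 x^4 + 12 x^2 y^2 + 2 y^4 reduces the mixed moment to fourth moments of single Gaussian
  variables, and each of these is three times the squared variance.\<close>

lemma
  fixes S T :: "'a \<Rightarrow> real"
  assumes g: "\<And>a b. \<exists>v. centred_gaussian P (\<lambda>\<omega>. a * S \<omega> + b * T \<omega>) v"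
  shows centred_gaussian_integrable_mult: "integrable P (\<lambda>\<omega>. S \<omega> * T \<omega>)"
    and centred_gaussian_integrable_squares: "integrable P (\<lambda>\<omega>. (S \<omega>)\<^sup>2 * (T \<omega>)\<^sup>2)"
    and centred_gaussian_squares: "(\<integral>\<omega>. (S \<omega>)\<^sup>2 * (T \<omega>)\<^sup>2 \<partial>P) =
      (\<integral>\<omega>. (S \<omega>)\<^sup>2 \<partial>P) * (\<integral>\<omega>. (T \<omega>)\<^sup>2 \<partial>P) + 2 * (\<integral>\<omega>. S \<omega> * T \<omega> \<partial>P)\<^sup>2"
proof -
  define L where "L a b \<omega> = a * S \<omega> + b * T \<omega>" for a b \<omega>
  have g': "\<exists>v. centred_gaussian P (L a b) v" for a b using g unfolding L_def .
  have i: "integrable P (\<lambda>\<omega>. L a b \<omega> ^ k)" for a b k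
    using g'[of a b] centred_gaussian_integrable_power by blast
  have iS: "integrable P (\<lambda>\<omega>. (S \<omega>)\<^sup>2)" and iT: "integrable P (\<lambda>\<omega>. (T \<omega>)\<^sup>2)"
    using i[of 1 0 2] i[of 0 1 2] by (auto simp: L_def)
  have e1: "S \<omega> * T \<omega> = (L 1 1 \<omega> ^ 2 - L 1 (-1) \<omega> ^ 2) / 4" for \<omega>
    unfolding L_def by (simp add: power2_eq_square algebra_simps)
  show iST: "integrable P (\<lambda>\<omega>. S \<omega> * T \<omega>)" unfolding e1 using i by auto
  have e2: "(S \<omega>)\<^sup>2 * (T \<omega>)\<^sup>2 =
      (L 1 1 \<omega> ^ 4 + L 1 (-1) \<omega> ^ 4 - 2 * L 1 0 \<omega> ^ 4 - 2 * L 0 1 \<omega> ^ 4) / 12" for \<omega>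
    unfolding L_def by (simp add: power2_eq_square power4_eq_xxxx algebra_simps)
  show "integrable P (\<lambda>\<omega>. (S \<omega>)\<^sup>2 * (T \<omega>)\<^sup>2)" unfolding e2 using i by auto
  define V where "V a b = a\<^sup>2 * (\<integral>\<omega>. (S \<omega>)\<^sup>2 \<partial>P) + b\<^sup>2 * (\<integral>\<omega>. (T \<omega>)\<^sup>2 \<partial>P)
      + 2 * (a * b) * (\<integral>\<omega>. S \<omega> * T \<omega> \<partial>P)" for a b
  have V: "(\<integral>\<omega>. L a b \<omega> ^ 2 \<partial>P) = V a b" for a b
  proof -
    have "(\<lambda>\<omega>. L a b \<omega> ^ 2) = (\<lambda>\<omega>. a\<^sup>2 * (S \<omega>)\<^sup>2 + b\<^sup>2 * (T \<omega>)\<^sup>2 + 2 * (a * b) * (S \<omega> * T \<omega>))"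
      by (auto simp: L_def power2_eq_square algebra_simps)
    then show ?thesis using iS iT iST by (simp add: V_def)
  qed
  have F: "(\<integral>\<omega>. L a b \<omega> ^ 4 \<partial>P) = 3 * (V a b)\<^sup>2" for a b
    using g'[of a b] centred_gaussian_second centred_gaussian_fourth V[of a b] by metis
  show "(\<integral>\<omega>. (S \<omega>)\<^sup>2 * (T \<omega>)\<^sup>2 \<partial>P) =
      (\<integral>\<omega>. (S \<omega>)\<^sup>2 \<partial>P) * (\<integral>\<omega>. (T \<omega>)\<^sup>2 \<partial>P) + 2 * (\<integral>\<omega>. S \<omega> * T \<omega> \<partial>P)\<^sup>2"
    unfolding e2 using i by (simp add: F V_def power2_eq_square algebra_simps)
qed

text \<open>Polarization: each of \<open>A * B\<close> and \<open>C * D\<close> is a difference of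
  two squares, so the product is a combination of four squares of \<open>S\<close> times squares of
  \<open>T\<close>, which the preceding lemma evaluates. The variables may coincide, so the later
  case \<open>j = k\<close> is included.\<close>

lemma
  fixes A B C D :: "'a \<Rightarrow> real"
  assumes g: "\<And>a b c d. \<exists>v. centred_gaussian P (\<lambda>\<omega>. a * A \<omega> + b * B \<omega> + c * C \<omega> + d * D \<omega>) v"
  shows isserlis_integrable: "integrable P (\<lambda>\<omega>. (A \<omega> * B \<omega>) * (C \<omega> * D \<omega>))" (is ?I)
    and isserlis: "(\<integral>\<omega>. (A \<omega> * B \<omega>) * (C \<omega> * D \<omega>) \<partial>P) =
      (\<integral>\<omega>. A \<omega> * B \<omega> \<partial>P) * (\<integral>\<omega>. C \<omega> * D \<omega> \<partial>P) + (\<integral>\<omega>. A \<omega> * C \<omega> \<partial>P) * (\<integral>\<omega>. B \<omega> * D \<omega> \<partial>P)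
      + (\<integral>\<omega>. A \<omega> * D \<omega> \<partial>P) * (\<integral>\<omega>. B \<omega> * C \<omega> \<partial>P)" (is ?E)
proof -
  define S where "S s \<omega> = A \<omega> + s * B \<omega>" for s \<omega>
  define T where "T t \<omega> = C \<omega> + t * D \<omega>" for t \<omega>
  have ST: "\<exists>v. centred_gaussian P (\<lambda>\<omega>. a * S s \<omega> + b * T t \<omega>) v" for a b s t
    using g[of a "a * s" b "b * t"] by (simp add: S_def T_def algebra_simps)
  have gAB: "\<exists>v. centred_gaussian P (\<lambda>\<omega>. a * A \<omega> + b * B \<omega>) v" for a b using g[of a b 0 0] by simp
  have gAC: "\<exists>v. centred_gaussian P (\<lambda>\<omega>. a * A \<omega> + b * C \<omega>) v" for a b using g[of a 0 b 0] by simp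
  have gAD: "\<exists>v. centred_gaussian P (\<lambda>\<omega>. a * A \<omega> + b * D \<omega>) v" for a b using g[of a 0 0 b] by simp
  have gBC: "\<exists>v. centred_gaussian P (\<lambda>\<omega>. a * B \<omega> + b * C \<omega>) v" for a b using g[of 0 a b 0] by simp
  have gBD: "\<exists>v. centred_gaussian P (\<lambda>\<omega>. a * B \<omega> + b * D \<omega>) v" for a b using g[of 0 a 0 b] by simp
  have gCD: "\<exists>v. centred_gaussian P (\<lambda>\<omega>. a * C \<omega> + b * D \<omega>) v" for a b using g[of 0 0 a b] by simp
  note ints = gAB[THEN centred_gaussian_integrable_mult] gAC[THEN centred_gaussian_integrable_mult]
    gAD[THEN centred_gaussian_integrable_mult] gBC[THEN centred_gaussian_integrable_mult]
    gBD[THEN centred_gaussian_integrable_mult] gCD[THEN centred_gaussian_integrable_mult]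
  have "integrable P (\<lambda>\<omega>. (1 * A \<omega> + 0 * B \<omega>) ^ 2)" "integrable P (\<lambda>\<omega>. (0 * A \<omega> + 1 * B \<omega>) ^ 2)"
     "integrable P (\<lambda>\<omega>. (1 * C \<omega> + 0 * D \<omega>) ^ 2)" "integrable P (\<lambda>\<omega>. (0 * C \<omega> + 1 * D \<omega>) ^ 2)"
    using gAB gCD centred_gaussian_integrable_power by blast+
  then have sq: "integrable P (\<lambda>\<omega>. (A \<omega>)\<^sup>2)" "integrable P (\<lambda>\<omega>. (B \<omega>)\<^sup>2)"
    "integrable P (\<lambda>\<omega>. (C \<omega>)\<^sup>2)" "integrable P (\<lambda>\<omega>. (D \<omega>)\<^sup>2)" by simp_all
  have "(S s \<omega>)\<^sup>2 = (A \<omega>)\<^sup>2 + s\<^sup>2 * (B \<omega>)\<^sup>2 + 2 * s * (A \<omega> * B \<omega>)" for s \<omega>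
    by (simp add: S_def power2_eq_square algebra_simps)
  then have SS: "(\<integral>\<omega>. (S s \<omega>)\<^sup>2 \<partial>P) = (\<integral>\<omega>. (A \<omega>)\<^sup>2 \<partial>P) + s\<^sup>2 * (\<integral>\<omega>. (B \<omega>)\<^sup>2 \<partial>P)
      + 2 * s * (\<integral>\<omega>. A \<omega> * B \<omega> \<partial>P)" for s using ints sq by simp
  have "(T s \<omega>)\<^sup>2 = (C \<omega>)\<^sup>2 + s\<^sup>2 * (D \<omega>)\<^sup>2 + 2 * s * (C \<omega> * D \<omega>)" for s \<omega>
    by (simp add: T_def power2_eq_square algebra_simps)
  then have TT: "(\<integral>\<omega>. (T s \<omega>)\<^sup>2 \<partial>P) = (\<integral>\<omega>. (C \<omega>)\<^sup>2 \<partial>P) + s\<^sup>2 * (\<integral>\<omega>. (D \<omega>)\<^sup>2 \<partial>P)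
      + 2 * s * (\<integral>\<omega>. C \<omega> * D \<omega> \<partial>P)" for s using ints sq by simp
  have "S s \<omega> * T t \<omega> = A \<omega> * C \<omega> + s * (B \<omega> * C \<omega>) + t * (A \<omega> * D \<omega>) + s * t * (B \<omega> * D \<omega>)" for s t \<omega>
    by (simp add: S_def T_def algebra_simps)
  then have STi: "(\<integral>\<omega>. S s \<omega> * T t \<omega> \<partial>P) = (\<integral>\<omega>. A \<omega> * C \<omega> \<partial>P) + s * (\<integral>\<omega>. B \<omega> * C \<omega> \<partial>P)
      + t * (\<integral>\<omega>. A \<omega> * D \<omega> \<partial>P) + s * t * (\<integral>\<omega>. B \<omega> * D \<omega> \<partial>P)" for s t using ints sq by simp
  note i = centred_gaussian_integrable_squares[OF ST]
  note E = centred_gaussian_squares[OF ST]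
  have e: "(A \<omega> * B \<omega>) * (C \<omega> * D \<omega>) = ((S 1 \<omega>)\<^sup>2 * (T 1 \<omega>)\<^sup>2 - (S 1 \<omega>)\<^sup>2 * (T (-1) \<omega>)\<^sup>2
      - (S (-1) \<omega>)\<^sup>2 * (T 1 \<omega>)\<^sup>2 + (S (-1) \<omega>)\<^sup>2 * (T (-1) \<omega>)\<^sup>2) / 16" for \<omega>
  proof -
    have "A \<omega> * B \<omega> = ((S 1 \<omega>)\<^sup>2 - (S (-1) \<omega>)\<^sup>2) / 4" "C \<omega> * D \<omega> = ((T 1 \<omega>)\<^sup>2 - (T (-1) \<omega>)\<^sup>2) / 4"
      by (simp_all add: S_def T_def power2_eq_square algebra_simps)
    then have "(A \<omega> * B \<omega>) * (C \<omega> * D \<omega>) =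
        (((S 1 \<omega>)\<^sup>2 - (S (-1) \<omega>)\<^sup>2) / 4) * (((T 1 \<omega>)\<^sup>2 - (T (-1) \<omega>)\<^sup>2) / 4)" by (simp only:)
    then show ?thesis by (simp add: field_simps)
  qed
  show ?I unfolding e using i by auto
  show ?E unfolding e using i by (simp add: E SS TT STi) (simp add: power2_eq_square algebra_simps)
qed

section \<open>Smoothness of the covariances away from the origin\<close>

text \<open>The interface between the covariances and the estimates. It is local, as condition A
  speaks only of [-L, L]. The exponent stays below 2 so that a smooth even part, which behaves like
  t^2 at the origin, can be absorbed into t^p.\<close>

definition regular_kernel :: "(real \<Rightarrow> real) \<Rightarrow> real \<Rightarrow> real \<Rightarrow> real \<Rightarrow> bool" where
  "regular_kernel K p L C \<longleftrightarrow> 0 < L \<and> 0 < p \<and> p < 2 \<and> 0 \<le> C \<and>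
     (\<forall>t\<in>{-L..L}. K (- t) = K t) \<and> (\<forall>t\<in>{0<..<L}. \<bar>K 0 - K t\<bar> \<le> C * t powr p) \<and>
     (\<exists>K' K''. \<forall>t\<in>{0<..<L}. (K has_real_derivative K' t) (at t) \<and>
        (K' has_real_derivative K'' t) (at t) \<and> \<bar>K'' t\<bar> \<le> C * t powr (p - 2))"

text \<open>Two applications of the mean value theorem: first to the symmetrized function of the
  step, whose derivative is a difference of values of \<open>K'\<close>, then to \<open>K'\<close>
  on an interval of length at most 2 h, whence the factor 2.\<close>

lemma second_difference_mvt:
  fixes K :: "real \<Rightarrow> real"
  assumes "h > 0" and d: "\<And>t. x - h \<le> t \<Longrightarrow> t \<le> x + h \<Longrightarrow>
      (K has_real_derivative K' t) (at t) \<and> (K' has_real_derivative K'' t) (at t) \<and> \<bar>K'' t\<bar> \<le> M"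
  shows "\<bar>2 * K x - K (x + h) - K (x - h)\<bar> \<le> 2 * M * h\<^sup>2"
proof -
  define g where "g s = K (x + s) + K (x - s) - 2 * K x" for s
  have "(g has_real_derivative K' (x + s) - K' (x - s)) (at s)" if "0 \<le> s" "s \<le> h" for s
  proof -
    have 1: "((\<lambda>s. K (x + s)) has_real_derivative K' (x + s)) (at s)"
      using d[of "x + s"] that by (auto simp: DERIV_shift[symmetric] add.commute)
    have 2: "((\<lambda>s. K (x - s)) has_real_derivative - K' (x - s)) (at s)"
    proof -
      have *: "((\<lambda>s. x - s) has_real_derivative -1) (at s)" by (auto intro!: derivative_eq_intros)
      have "(K has_real_derivative K' (x - s)) (at (x - s))" using d[of "x - s"] that by auto
      from DERIV_chain2[OF this *] show ?thesis by simp
    qed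
    show ?thesis unfolding g_def using 1 2 by (auto intro!: derivative_eq_intros)
  qed
  then obtain \<theta> where \<theta>: "0 < \<theta>" "\<theta> < h" "g h - g 0 = (h - 0) * (K' (x + \<theta>) - K' (x - \<theta>))"
    using MVT2[of 0 h g "\<lambda>s. K' (x + s) - K' (x - s)"] \<open>h > 0\<close> by auto
  obtain \<xi> where \<xi>: "x - \<theta> < \<xi>" "\<xi> < x + \<theta>"
     "K' (x + \<theta>) - K' (x - \<theta>) = ((x + \<theta>) - (x - \<theta>)) * K'' \<xi>"
    using MVT2[of "x - \<theta>" "x + \<theta>" K' K''] d \<theta> by auto
  have M: "\<bar>K'' \<xi>\<bar> \<le> M" using d[of \<xi>] \<xi> \<theta> by auto
  have "\<bar>g h\<bar> = 2 * h * \<theta> * \<bar>K'' \<xi>\<bar>"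
    using \<theta> \<xi>(3) \<open>h > 0\<close> by (simp add: g_def abs_mult)
  also have "\<dots> \<le> 2 * h * h * M"
    using \<theta> M \<open>h > 0\<close> by (intro mult_mono) auto
  finally show ?thesis by (simp add: g_def power2_eq_square mult_ac)
qed

text \<open>The left side is the covariance of two increments at lag \<open>d\<close>. For d = 0 and
  d = 1 the points reach the origin, where \<open>K''\<close> may blow up, and the bound on
  \<open>K 0 - K t\<close> is used. For d >= 2 the interval starts at (d - 1) h >= (d + 1) h / 3 and
  the mean value estimate applies. The constant 24 = 6 * 4 comes from d = 1, where (1 + d)^(p - 2) =
  2^p / 4; the last case yields at most 2 * 9.\<close>

lemma regular_kernel_second_difference:
  assumes "regular_kernel K p L C" "h > 0" "(real d + 1) * h < L"
  shows "\<bar>2 * K (real d * h) - K ((real d + 1) * h) - K ((real d - 1) * h)\<bar>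
           \<le> 24 * C * h powr p * (1 + real d) powr (p - 2)"
proof -
  obtain K' K'' where r: "0 < L" "0 < p" "p < 2" "0 \<le> C" "\<And>t. t\<in>{-L..L} \<Longrightarrow> K (- t) = K t"
     "\<And>t. t\<in>{0<..<L} \<Longrightarrow> \<bar>K 0 - K t\<bar> \<le> C * t powr p" and
     d: "\<And>t. t\<in>{0<..<L} \<Longrightarrow> (K has_real_derivative K' t) (at t) \<and>
        (K' has_real_derivative K'' t) (at t) \<and> \<bar>K'' t\<bar> \<le> C * t powr (p - 2)"
    using assms(1) unfolding regular_kernel_def by blast
  have two: "2 powr p \<le> (4::real)"
    using powr_mono[of p 2 "2::real"] r by simp
  consider "d = 0" | "d = 1" | "d \<ge> 2" by linarith
  then show ?thesis
  proof cases
    case 1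
    then have "\<bar>2 * K (real d * h) - K ((real d + 1) * h) - K ((real d - 1) * h)\<bar> = 2 * \<bar>K 0 - K h\<bar>"
      using r(5)[of h] assms(2,3) by (simp add: abs_if)
    also have "\<dots> \<le> 24 * C * h powr p"
      using r(6)[of h] assms(2,3) 1 r(4) by (simp add: zero_le_mult_iff)
    finally show ?thesis using 1 by simp
  next
    case 2
    then have h: "2 * h < L" using assms by simp
    have "\<bar>2 * K (real d * h) - K ((real d + 1) * h) - K ((real d - 1) * h)\<bar>
        \<le> \<bar>K 0 - K (2 * h)\<bar> + 2 * \<bar>K 0 - K h\<bar>"
      using 2 by (simp add: abs_if)
    also have "\<dots> \<le> C * (2 * h) powr p + 2 * (C * h powr p)"
      using r(6)[of h] r(6)[of "2 * h"] assms(2) h by (intro add_mono mult_left_mono) auto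
    also have "\<dots> = (2 powr p + 2) * (C * h powr p)"
      using assms by (simp add: powr_mult algebra_simps)
    also have "\<dots> \<le> 6 * (C * h powr p)"
      using two r by (intro mult_right_mono) auto
    also have "\<dots> \<le> 6 * (C * h powr p) * (2 powr p)"
      using r powr_mono[of 0 p "2::real"] by (simp add: mult_le_cancel_left1 zero_le_mult_iff not_less)
    also have "\<dots> = 24 * C * h powr p * (1 + real d) powr (p - 2)"
      using 2 by (simp add: powr_diff)
    finally show ?thesis .
  next
    case 3
    define y where "y = (real d - 1) * h"
    have y: "0 < y" "(1 + real d) * h / 3 \<le> y" using 3 assms by (auto simp: y_def field_simps)
    have "\<bar>2 * K (real d * h) - K (real d * h + h) - K (real d * h - h)\<bar>
        \<le> 2 * (C * y powr (p - 2)) * h\<^sup>2"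
    proof (rule second_difference_mvt[OF assms(2)])
      fix t assume t: "real d * h - h \<le> t" "t \<le> real d * h + h"
      then have t': "y \<le> t" "t < L" using assms by (auto simp: y_def algebra_simps)
      then have "t powr (p - 2) \<le> y powr (p - 2)" using y r by (intro powr_mono2') auto
      then show "(K has_real_derivative K' t) (at t) \<and> (K' has_real_derivative K'' t) (at t) \<and>
         \<bar>K'' t\<bar> \<le> C * y powr (p - 2)"
        using d[of t] t' y r mult_left_mono[of "t powr (p - 2)" "y powr (p - 2)" C] by auto
    qed
    also have "\<dots> \<le> 2 * (C * ((1 + real d) * h / 3) powr (p - 2)) * h\<^sup>2"
      using y r assms by (intro mult_mono powr_mono2') auto
    also have "\<dots> = 2 * C * 3 powr (2 - p) * h powr p * (1 + real d) powr (p - 2)"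
    proof -
      have "((1 + real d) * h / 3) powr (p - 2) = (1 + real d) powr (p - 2) * h powr (p - 2) / 3 powr (p - 2)"
        using assms(2) by (subst powr_divide) (auto simp: powr_mult)
      moreover have "h powr (p - 2) * h\<^sup>2 = h powr p" using assms(2) by (simp add: powr_diff)
      moreover have "1 / 3 powr (p - 2) = (3::real) powr (2 - p)" by (simp add: powr_diff)
      ultimately show ?thesis by (simp only: flip: \<open>_ = h powr p\<close> \<open>_ = 3 powr (2 - p)\<close>) simp
    qed
    also have "\<dots> \<le> 24 * C * h powr p * (1 + real d) powr (p - 2)"
    proof -
      have "3 powr (2 - p) \<le> (9::real)"
        using powr_mono[of "2 - p" 2 "3::real"] r by simp
      then have "3 powr (2 - p) * (2 * C * h powr p * (1 + real d) powr (p - 2))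
         \<le> 12 * (2 * C * h powr p * (1 + real d) powr (p - 2))"
        using r by (intro mult_right_mono) auto
      then show ?thesis by (simp add: mult_ac)
    qed
    finally show ?thesis by (simp add: algebra_simps)
  qed
qed

section \<open>Regularity of power exponential covariances\<close>

definition pe_deriv1 :: "real \<Rightarrow> real \<Rightarrow> real \<Rightarrow> real \<Rightarrow> real" where
  "pe_deriv1 \<sigma>2 \<phi> \<delta> t = - (\<sigma>2 * \<phi> * \<delta>) * (t powr (\<delta> - 1) * exp (- \<phi> * t powr \<delta>))"

definition pe_deriv2 :: "real \<Rightarrow> real \<Rightarrow> real \<Rightarrow> real \<Rightarrow> real" where
  "pe_deriv2 \<sigma>2 \<phi> \<delta> t = \<sigma>2 * (exp (- \<phi> * t powr \<delta>) * (\<phi>\<^sup>2 * \<delta>\<^sup>2 * t powr (2 * \<delta> - 2)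
       - \<phi> * \<delta> * (\<delta> - 1) * t powr (\<delta> - 2)))"

lemma power_exponential_DERIV:
  assumes t: "t > 0"
  shows "(power_exponential \<sigma>2 \<phi> \<delta> has_real_derivative pe_deriv1 \<sigma>2 \<phi> \<delta> t) (at t)"
    and "(pe_deriv1 \<sigma>2 \<phi> \<delta> has_real_derivative pe_deriv2 \<sigma>2 \<phi> \<delta> t) (at t)"
proof -
  have "\<forall>\<^sub>F s in nhds t. s \<in> {0<..}" using t by (intro eventually_nhds_in_open) auto
  then have ev: "\<forall>\<^sub>F s in nhds t. power_exponential \<sigma>2 \<phi> \<delta> s = \<sigma>2 * exp (- \<phi> * s powr \<delta>)"
    by (rule eventually_mono) (auto simp: power_exponential_def)
  have dE: "((\<lambda>t. exp (- \<phi> * t powr \<delta>)) has_real_derivative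
      exp (- \<phi> * t powr \<delta>) * (- \<phi> * (\<delta> * t powr (\<delta> - 1)))) (at t)"
    using t by (intro DERIV_fun_exp DERIV_cmult has_real_derivative_powr) auto
  from DERIV_cmult[OF this, of \<sigma>2] show "(power_exponential \<sigma>2 \<phi> \<delta> has_real_derivative pe_deriv1 \<sigma>2 \<phi> \<delta> t) (at t)"
    by (subst DERIV_cong_ev[OF refl ev refl]) (simp add: pe_deriv1_def mult_ac)
  have e: "t powr (2 * \<delta> - 2) = t powr (\<delta> - 1) * t powr (\<delta> - 1)"
    using t by (simp flip: powr_add)
  have "((\<lambda>t. t powr (\<delta> - 1)) has_real_derivative (\<delta> - 1) * t powr (\<delta> - 1 - 1)) (at t)"
    using t by (intro has_real_derivative_powr) auto
  with dE have "(pe_deriv1 \<sigma>2 \<phi> \<delta> has_real_derivative - (\<sigma>2 * \<phi> * \<delta>) *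
      ((\<delta> - 1) * t powr (\<delta> - 1 - 1) * exp (- \<phi> * t powr \<delta>)
        + exp (- \<phi> * t powr \<delta>) * (- \<phi> * (\<delta> * t powr (\<delta> - 1))) * t powr (\<delta> - 1))) (at t)"
    unfolding pe_deriv1_def by (intro DERIV_cmult DERIV_mult)
  moreover have "- (\<sigma>2 * \<phi> * \<delta>) *
      ((\<delta> - 1) * t powr (\<delta> - 1 - 1) * exp (- \<phi> * t powr \<delta>)
        + exp (- \<phi> * t powr \<delta>) * (- \<phi> * (\<delta> * t powr (\<delta> - 1))) * t powr (\<delta> - 1)) = pe_deriv2 \<sigma>2 \<phi> \<delta> t"
    unfolding pe_deriv2_def e by (simp add: algebra_simps power2_eq_square)
  ultimately show "(pe_deriv1 \<sigma>2 \<phi> \<delta> has_real_derivative pe_deriv2 \<sigma>2 \<phi> \<delta> t) (at t)" by simp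
qed

lemma power_exponential_even: "power_exponential \<sigma>2 \<phi> \<delta> (- t) = power_exponential \<sigma>2 \<phi> \<delta> t"
  by (simp add: power_exponential_def)

lemma one_minus_exp_le: "1 - exp (- u) \<le> (u :: real)"
  using exp_ge_add_one_self[of "- u"] by simp

lemma one_minus_exp_ge:
  assumes "0 \<le> u" "u \<le> (1::real)"
  shows "u / 2 \<le> 1 - exp (- u)"
proof -
  have "exp (- u) \<le> 1 / (1 + u)"
    using exp_ge_add_one_self[of u] assms le_imp_inverse_le[of "1 + u" "exp u"]
    by (simp add: exp_minus inverse_eq_divide)
  also have "\<dots> \<le> 1 - u / 2" using assms mult_left_mono[of u 1 u] by (simp add: field_simps)
  finally show ?thesis by simp
qed

text \<open>The radius is 1 because for t < 1 the milder singularity t^(2 \<delta> - 2) of the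
  second derivative is bounded by t^(\<delta> - 2). The summand \<phi> of \<open>C\<close> serves
  the bound at the origin, the other two the second derivative.\<close>

lemma power_exponential_regular:
  assumes "\<sigma>2 > 0" "\<phi> > 0" "0 < \<delta>" "\<delta> < 2"
  shows "\<exists>C. regular_kernel (power_exponential \<sigma>2 \<phi> \<delta>) \<delta> 1 C"
proof -
  define C where "C = \<sigma>2 * (\<phi>\<^sup>2 * \<delta>\<^sup>2 + \<phi> * \<delta> * \<bar>\<delta> - 1\<bar> + \<phi>)"
  let ?K = "power_exponential \<sigma>2 \<phi> \<delta>"
  have K0: "\<bar>?K 0 - ?K t\<bar> \<le> C * t powr \<delta>" if t: "t \<in> {0<..<1}" for t
  proof -
    have "?K 0 - ?K t = \<sigma>2 * (1 - exp (- (\<phi> * t powr \<delta>)))"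
      using t assms by (simp add: power_exponential_def right_diff_distrib)
    then have "\<bar>?K 0 - ?K t\<bar> = \<sigma>2 * (1 - exp (- (\<phi> * t powr \<delta>)))"
      using assms by simp
    also have "\<dots> \<le> \<sigma>2 * (\<phi> * t powr \<delta>)"
      using assms by (intro mult_left_mono one_minus_exp_le) auto
    also have "\<dots> \<le> C * t powr \<delta>" using assms by (auto simp: C_def algebra_simps)
    finally show ?thesis .
  qed
  have K2: "\<bar>pe_deriv2 \<sigma>2 \<phi> \<delta> t\<bar> \<le> C * t powr (\<delta> - 2)" if t: "t \<in> {0<..<1}" for t
  proof -
    have l: "t powr (2 * \<delta> - 2) \<le> t powr (\<delta> - 2)" using t assms by (intro powr_mono') auto
    have "\<bar>pe_deriv2 \<sigma>2 \<phi> \<delta> t\<bar> \<le> \<sigma>2 * (1 * (\<phi>\<^sup>2 * \<delta>\<^sup>2 * t powr (2 * \<delta> - 2) + \<phi> * \<delta> * \<bar>\<delta> - 1\<bar> * t powr (\<delta> - 2)))"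
      unfolding pe_deriv2_def abs_mult using assms
      by (intro mult_mono order.trans[OF abs_triangle_ineq4] add_mono) (auto simp: abs_mult)
    also have "\<dots> \<le> \<sigma>2 * (1 * (\<phi>\<^sup>2 * \<delta>\<^sup>2 * t powr (\<delta> - 2) + \<phi> * \<delta> * \<bar>\<delta> - 1\<bar> * t powr (\<delta> - 2)))"
      using assms l by (intro mult_left_mono add_right_mono) auto
    also have "\<dots> \<le> C * t powr (\<delta> - 2)" using assms by (auto simp: C_def algebra_simps)
    finally show ?thesis .
  qed
  have "\<exists>K' K''. \<forall>t\<in>{0<..<1}. (?K has_real_derivative K' t) (at t) \<and>
      (K' has_real_derivative K'' t) (at t) \<and> \<bar>K'' t\<bar> \<le> C * t powr (\<delta> - 2)"
    using K2 power_exponential_DERIV[of _ \<sigma>2 \<phi> \<delta>]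
    by (intro exI[of _ "pe_deriv1 \<sigma>2 \<phi> \<delta>"] exI[of _ "pe_deriv2 \<sigma>2 \<phi> \<delta>"]) auto
  moreover have "0 \<le> C" using assms by (auto simp: C_def)
  ultimately have "regular_kernel ?K \<delta> 1 C"
    unfolding regular_kernel_def using assms K0 by (auto simp: power_exponential_even)
  then show ?thesis by blast
qed

text \<open>Evenness forces the first derivative to vanish at 0, which improves the deviation of
  \<open>A\<close> from linear to quadratic. A linear bound would not suffice, as exponents between
  1 and 2 occur.\<close>

lemma even_real_analytic_at_0:
  assumes "real_analytic A" "\<And>t. A (- t) = A t"
  shows "\<exists>r M A' A''. r > 0 \<and> M \<ge> 0 \<and>
    (\<forall>t. \<bar>t\<bar> \<le> r \<longrightarrow> (A has_real_derivative A' t) (at t) \<and> (A' has_real_derivative A'' t) (at t)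
        \<and> \<bar>A'' t\<bar> \<le> M \<and> \<bar>A 0 - A t\<bar> \<le> M * t\<^sup>2)"
proof -
  have "\<exists>r>0. \<exists>a. \<forall>y. \<bar>y - 0\<bar> < r \<longrightarrow> (\<lambda>n. a n * (y - 0) ^ n) sums A y"
    using spec[OF assms(1)[unfolded real_analytic_def], of 0] .
  then obtain R a where R: "R > 0" and s: "\<And>y. \<bar>y\<bar> < R \<Longrightarrow> (\<lambda>n. a n * y ^ n) sums A y"
    by auto
  have sum: "summable (\<lambda>n. a n * y ^ n)" if "norm y < R" for y
    using s[of y] that by (auto simp: sums_iff)
  have sum1: "summable (\<lambda>n. diffs a n * y ^ n)" if "norm y < R" for y
    using termdiff_converges[of y R a] sum that by auto
  define A' where "A' t = (\<Sum>n. diffs a n * t ^ n)" for t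
  define A'' where "A'' t = (\<Sum>n. diffs (diffs a) n * t ^ n)" for t
  have d1: "(A has_real_derivative A' t) (at t)" if "\<bar>t\<bar> < R" for t
  proof -
    have "((\<lambda>t. \<Sum>n. a n * t ^ n) has_real_derivative A' t) (at t)"
      unfolding A'_def using termdiffs_strong'[of R a t] sum that by auto
    moreover have "\<forall>\<^sub>F y in nhds t. A y = (\<Sum>n. a n * y ^ n)"
      using eventually_nhds_in_open[of "{-R<..<R}" t] that s
      by (auto elim!: eventually_mono simp: sums_iff abs_less_iff)
    ultimately show ?thesis by (subst DERIV_cong_ev[OF refl _ refl]) auto
  qed
  have d2: "(A' has_real_derivative A'' t) (at t)" if "\<bar>t\<bar> < R" for t
    unfolding A'_def A''_def using termdiffs_strong'[of R "diffs a" t] sum1 that by auto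
  have sum2: "summable (\<lambda>n. diffs (diffs a) n * y ^ n)" if "norm y < R" for y
    using termdiff_converges[of y R "diffs a"] sum1 that by auto
  have "(A'' has_real_derivative (\<Sum>n. diffs (diffs (diffs a)) n * t ^ n)) (at t)" if "\<bar>t\<bar> < R" for t
    unfolding A''_def using termdiffs_strong'[of R "diffs (diffs a)" t] sum2 that by auto
  then have "isCont A'' t" if "\<bar>t\<bar> < R" for t using that DERIV_isCont by blast
  then have "continuous_on {-R/2..R/2} A''"
    using R by (intro continuous_at_imp_continuous_on) auto
  then have "compact (A'' ` {-R/2..R/2})" by (intro compact_continuous_image) auto
  then obtain M where "\<forall>x\<in>A'' ` {-R/2..R/2}. \<bar>x\<bar> \<le> M"
    using compact_imp_bounded[of "A'' ` {-R/2..R/2}"] unfolding bounded_iff real_norm_def by blast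
  moreover have "t \<in> {-R/2..R/2}" if "\<bar>t\<bar> \<le> R/2" for t using that by auto
  ultimately have M: "\<bar>A'' t\<bar> \<le> M" if "\<bar>t\<bar> \<le> R/2" for t
    using that by blast
  have M0: "M \<ge> 0" using M[of 0] R by auto
  have "(uminus has_real_derivative -1) (at (0::real))" by (auto intro!: derivative_eq_intros)
  moreover have "(A has_real_derivative A' 0) (at (- 0))" using d1[of 0] R by simp
  ultimately have "((\<lambda>t. A (- t)) has_real_derivative A' 0 * -1) (at 0)"
    using DERIV_chain2[of A "A' 0" uminus 0 "-1" UNIV] by blast
  then have "(A has_real_derivative - A' 0) (at 0)" by (simp add: assms(2))
  then have A'0: "A' 0 = 0"
    using DERIV_unique[of A "- A' 0" 0 "A' 0"] d1[of 0] R by simp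
  have pos: "\<bar>A 0 - A t\<bar> \<le> M * t\<^sup>2" if t: "0 < t" "t \<le> R/2" for t
  proof -
    obtain z where z: "0 < z" "z < t" "A t - A 0 = (t - 0) * A' z"
      using MVT2[of 0 t A A'] d1 t R by auto
    obtain y where y: "0 < y" "y < z" "A' z - A' 0 = (z - 0) * A'' y"
      using MVT2[of 0 z A' A''] d2 t R z by auto
    have e: "A t - A 0 = t * (z * A'' y)" using z(3) y(3) A'0 by simp
    have "\<bar>A 0 - A t\<bar> = t * (z * \<bar>A'' y\<bar>)"
      unfolding abs_minus_commute[of "A 0"] e using z y t by (simp add: abs_mult)
    also have "\<dots> \<le> t * (t * M)" using z y t M[of y] by (intro mult_mono) auto
    finally show ?thesis by (simp add: power2_eq_square mult_ac)
  qed
  have "\<bar>A 0 - A t\<bar> \<le> M * t\<^sup>2" if t: "\<bar>t\<bar> \<le> R/2" for t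
    using pos[of t] pos[of "- t"] assms(2)[of t] t by (cases t "0::real" rule: linorder_cases) auto
  then show ?thesis using d1 d2 M M0 R
    by - (rule exI[of _ "R/2"], rule exI[of _ M], rule exI[of _ A'], rule exI[of _ A''], simp)
qed

lemma at_right_bound:
  assumes "(\<lambda>t. f t - b * t powr e) \<in> o[at_right 0](\<lambda>t. t powr e)"
  obtains r where "r > (0::real)" "\<And>t. 0 < t \<Longrightarrow> t < r \<Longrightarrow> \<bar>f t\<bar> \<le> (\<bar>b\<bar> + 1) * t powr e"
proof -
  have "\<forall>\<^sub>F t in at_right 0. norm (f t - b * t powr e) \<le> 1 * norm (t powr e)"
    using landau_o.smallD[OF assms, of 1] by simp
  then obtain r where r: "r > 0" "\<And>t. 0 < t \<Longrightarrow> t < r \<Longrightarrow> norm (f t - b * t powr e) \<le> t powr e"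
    unfolding eventually_at_right_field by auto
  show ?thesis
  proof (rule that[OF r(1)])
    fix t :: real assume t: "0 < t" "t < r"
    have "\<bar>f t\<bar> \<le> \<bar>f t - b * t powr e\<bar> + \<bar>b * t powr e\<bar>" by simp
    also have "\<dots> \<le> t powr e + \<bar>b\<bar> * t powr e" using r(2)[OF t] by (simp add: abs_mult)
    finally show "\<bar>f t\<bar> \<le> (\<bar>b\<bar> + 1) * t powr e" by (simp add: algebra_simps)
  qed
qed

text \<open>For t < 1 the power t^\<alpha> from \<open>B\<close> and the t^2 from \<open>A\<close>
  are both dominated by t^p, as p <= \<alpha> and p < 2. The cases k = 0 and k = 2 of the expansion
  supply the bounds near the origin, and the radius is shrunk to where they hold.\<close>

lemma condition_A_regular:
  assumes cA: "condition_A K L c \<alpha>" and p: "0 < p" "p < 2" "p \<le> \<alpha>"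
  shows "\<exists>L' C. regular_kernel K p L' C"
proof -
  note cA' = cA[unfolded condition_A_def]
  have L: "L > 0" and \<alpha>: "\<alpha> > 0" using cA' by auto
  obtain A B where K: "\<forall>t. K t = A t + B t" and A1: "\<forall>t. A (- t) = A t" and A2: "real_analytic A"
    and B: "\<forall>t\<in>{-L..L}. B (- t) = B t" and cB: "continuous_on {-L..L} B"
    and ex: "\<exists>D. (\<forall>t\<in>{0<..L}. D 0 t = B t) \<and>
             (\<forall>k. \<forall>t\<in>{0<..L}.
                (D k has_real_derivative D (Suc k) t) (at t within {0<..L})) \<and>
             (\<forall>k. (\<lambda>t. D k t - falling_gamma \<alpha> k * c * t powr (\<alpha> - real k))
                \<in> o[at_right 0](\<lambda>t. t powr (\<alpha> - real k)))"
    using cA' by - (elim conjE, erule exE, erule exE, elim conjE, rule that, assumption+)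
  from ex obtain D where D0: "\<forall>t\<in>{0<..L}. D 0 t = B t"
    and Dd: "\<forall>k. \<forall>t\<in>{0<..L}. (D k has_real_derivative D (Suc k) t) (at t within {0<..L})"
    and Do: "\<forall>k. (\<lambda>t. D k t - falling_gamma \<alpha> k * c * t powr (\<alpha> - real k))
                \<in> o[at_right 0](\<lambda>t. t powr (\<alpha> - real k))"
    by - (elim exE conjE, rule that, assumption+)
  note K = K[rule_format] and A = A1[rule_format] A2 and B = B[rule_format] and D0 = D0[rule_format]
    and Dd = Dd[rule_format] and Do = Do[rule_format]
  from even_real_analytic_at_0[OF A(2,1)] show ?thesis
  proof (elim exE conjE)
  fix r M A' A'' assume r: "r > 0" "M \<ge> 0" and A2:
    "\<forall>t. \<bar>t\<bar> \<le> r \<longrightarrow> (A has_real_derivative A' t) (at t) \<and> (A' has_real_derivative A'' t) (at t)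
        \<and> \<bar>A'' t\<bar> \<le> M \<and> \<bar>A 0 - A t\<bar> \<le> M * t\<^sup>2"
  note A'' = A2[rule_format]
  obtain r0 where r0: "r0 > 0" "\<And>t. 0 < t \<Longrightarrow> t < r0 \<Longrightarrow> \<bar>D 0 t\<bar> \<le> (\<bar>falling_gamma \<alpha> 0 * c\<bar> + 1) * t powr \<alpha>"
    using at_right_bound[OF Do[of 0]] by (metis diff_zero of_nat_0)
  obtain r2 where r2: "r2 > 0" "\<And>t. 0 < t \<Longrightarrow> t < r2 \<Longrightarrow> \<bar>D 2 t\<bar> \<le> (\<bar>falling_gamma \<alpha> 2 * c\<bar> + 1) * t powr (\<alpha> - 2)"
    using at_right_bound[OF Do[of 2]] by (metis of_nat_numeral)
  define L' where "L' = min (min L 1) (min r (min r0 r2))"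
  define C where "C = M + (\<bar>falling_gamma \<alpha> 0 * c\<bar> + 1) + (\<bar>falling_gamma \<alpha> 2 * c\<bar> + 1)"
  have L': "0 < L'" "L' \<le> L" "L' \<le> 1" "L' \<le> r" "L' \<le> r0" "L' \<le> r2"
    using L r r0 r2 by (auto simp: L'_def)
  \<comment> \<open>The expansion for k = 0 has no constant term, so \<open>B\<close> tends to 0 at
    the origin, and continuity transfers this to the value there.\<close>
  have B0: "B 0 = 0"
  proof -
    have "(B \<longlongrightarrow> B 0) (at 0 within {-L..L})" using cB L by (auto simp: continuous_on_def)
    then have "(B \<longlongrightarrow> B 0) (at 0 within {0..L})"
      by (rule tendsto_within_subset) (use L in auto)
    then have *: "(B \<longlongrightarrow> B 0) (at_right 0)"
      using L by (simp add: at_within_Icc_at_right)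
    have "((\<lambda>t. (\<bar>falling_gamma \<alpha> 0 * c\<bar> + 1) * t powr \<alpha>) \<longlongrightarrow> (\<bar>falling_gamma \<alpha> 0 * c\<bar> + 1) * 0 powr \<alpha>) (at_right 0)"
      using \<alpha> by (intro tendsto_intros tendsto_powr2) (auto simp: eventually_at_right_less eventually_mono[OF eventually_at_right_less])
    then have z: "((\<lambda>t. (\<bar>falling_gamma \<alpha> 0 * c\<bar> + 1) * t powr \<alpha>) \<longlongrightarrow> 0) (at_right 0)" by simp
    have "\<forall>\<^sub>F t in at_right 0. norm (B t) \<le> (\<bar>falling_gamma \<alpha> 0 * c\<bar> + 1) * t powr \<alpha>"
      using r0 D0 L' unfolding eventually_at_right_field by (intro exI[of _ L']) force
    then have "(B \<longlongrightarrow> 0) (at_right 0)" by (rule Lim_null_comparison) (rule z)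
    then show ?thesis using * tendsto_unique trivial_limit_at_right_real by blast
  qed
  have "regular_kernel K p L' C"
    unfolding regular_kernel_def
  proof (intro conjI ballI)
    show "0 \<le> C" using r by (auto simp: C_def)
    show "K (- t) = K t" if "t \<in> {- L'..L'}" for t using A B[of t] L' that by (auto simp: K)
    fix t assume t: "t \<in> {0<..<L'}"
    have tL: "t \<in> {0<..L}" using t L' by auto
    have \<alpha>p: "t powr \<alpha> \<le> t powr p" "t powr (\<alpha> - 2) \<le> t powr (p - 2)"
      using t L' p by (auto intro!: powr_mono')
    have tp: "t\<^sup>2 \<le> t powr p" "1 \<le> t powr (p - 2)"
      using t L' p powr_mono'[of p 2 t] powr_mono'[of "p - 2" 0 t] by auto
    have "\<bar>K 0 - K t\<bar> \<le> \<bar>A 0 - A t\<bar> + \<bar>D 0 t\<bar>" using B0 D0[OF tL] by (simp add: K)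
    also have "\<dots> \<le> M * t\<^sup>2 + (\<bar>falling_gamma \<alpha> 0 * c\<bar> + 1) * t powr \<alpha>"
      using A''[of t] r0(2)[of t] t L' by (intro add_mono) auto
    also have "\<dots> \<le> M * t powr p + (\<bar>falling_gamma \<alpha> 0 * c\<bar> + 1) * t powr p"
      using \<alpha>p tp r by (intro add_mono mult_left_mono) auto
    also have "\<dots> \<le> C * t powr p" by (simp add: C_def algebra_simps)
    finally show "\<bar>K 0 - K t\<bar> \<le> C * t powr p" .
  next
    show "\<exists>K' K''. \<forall>t\<in>{0<..<L'}. (K has_real_derivative K' t) (at t) \<and>
        (K' has_real_derivative K'' t) (at t) \<and> \<bar>K'' t\<bar> \<le> C * t powr (p - 2)"
    proof (rule exI[of _ "\<lambda>t. A' t + D 1 t"], rule exI[of _ "\<lambda>t. A'' t + D 2 t"], intro ballI conjI)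
    fix t assume t: "t \<in> {0<..<L'}"
    have tL: "t \<in> {0<..L}" using t L' by auto
    have \<alpha>p: "t powr \<alpha> \<le> t powr p" "t powr (\<alpha> - 2) \<le> t powr (p - 2)"
      using t L' p by (auto intro!: powr_mono')
    have tp: "1 \<le> t powr (p - 2)"
      using t L' p powr_mono'[of "p - 2" 0 t] by auto
    \<comment> \<open>Condition A gives derivatives along \<open>{0<..L}\<close>; since t < L, they
      are ordinary two-sided ones.\<close>
    have at: "at t within {0<..L} = at t"
    proof -
      have "at t within {0<..<L} = at t within {0<..L}"
        using t L' by (intro at_within_nhd[of t "{0<..<L}"]) auto
      then show ?thesis using t L' by (simp add: at_within_open[of t "{0<..<L}"])
    qed
    have ev: "\<forall>\<^sub>F s in nhds t. K s = A s + D 0 s"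
      using eventually_nhds_in_open[of "{0<..<L'}" t] t D0 L' by (auto elim!: eventually_mono simp: K)
    show "(K has_real_derivative A' t + D 1 t) (at t)"
      by (subst DERIV_cong_ev[OF refl ev refl])
        (use A''[of t] Dd[OF tL, of 0] t L' at in \<open>auto intro!: derivative_intros\<close>)
    show "((\<lambda>t. A' t + D 1 t) has_real_derivative A'' t + D 2 t) (at t)"
      using A''[of t] Dd[OF tL, of 1] t L' at by (auto intro!: derivative_intros simp: numeral_2_eq_2)
    have "\<bar>A'' t + D 2 t\<bar> \<le> M * 1 + (\<bar>falling_gamma \<alpha> 2 * c\<bar> + 1) * t powr (\<alpha> - 2)"
      using A''[of t] r2(2)[of t] t L' by (intro order.trans[OF abs_triangle_ineq] add_mono) auto
    also have "\<dots> \<le> M * t powr (p - 2) + (\<bar>falling_gamma \<alpha> 2 * c\<bar> + 1) * t powr (p - 2)"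
      using \<alpha>p tp r by (intro add_mono mult_left_mono) auto
    also have "\<dots> \<le> C * t powr (p - 2)" by (simp add: C_def algebra_simps)
    finally show "\<bar>A'' t + D 2 t\<bar> \<le> C * t powr (p - 2)" .
    qed
  qed (use L' p in auto)
  then show ?thesis by blast
  qed
qed

text \<open>The sum over \<open>d\<close> may diverge with the number of terms. As
  \<open>h * d\<close> is bounded, a part h^e' of the factor h^e can be traded for (1 + d)^(-e').
  The exponent \<open>e'\<close> is the midpoint of max 0 (1 - q) and \<open>e\<close>, so the
  traded series converges and a positive power of \<open>h\<close> is left.\<close>

lemma powr_sum_tendsto_0:
  fixes h :: "nat \<Rightarrow> real" and N :: "nat \<Rightarrow> nat"
  assumes h: "\<And>m. h m > 0" "h \<longlonglongrightarrow> 0" and N: "\<And>m. real (N m) * h m \<le> L"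
    and e: "e > 0" "q \<ge> 0" "e + q > 1"
  shows "(\<lambda>m. h m powr e * (\<Sum>d<N m. (1 + real d) powr (- q))) \<longlonglongrightarrow> 0"
proof -
  define e' where "e' = (max 0 (1 - q) + e) / 2"
  have e': "e' < e" "e' > 0" "e' + q > 1" using e by (auto simp: e'_def max_def field_simps)
  have L: "L \<ge> 0" using N[of 0] h(1)[of 0] by (smt (verit) mult_nonneg_nonneg of_nat_0_le_iff)
  define S where "S = (\<Sum>d. (1 + real d) powr (- (q + e')))"
  have "summable (\<lambda>d. real d powr (- (q + e')))" using e' by (subst summable_real_powr_iff) auto
  then have sm: "summable (\<lambda>d. (1 + real d) powr (- (q + e')))"
    by (subst (asm) summable_Suc_iff[symmetric]) (simp add: add.commute)
  have bound: "h m powr e * (\<Sum>d<N m. (1 + real d) powr (- q)) \<le> h m powr (e - e') * ((1 + L) powr e' * S)"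
    if hm: "h m < 1" for m
  proof -
    have "h m powr e * (\<Sum>d<N m. (1 + real d) powr (- q))
        = h m powr (e - e') * (\<Sum>d<N m. h m powr e' * (1 + real d) powr (- q))"
      using h(1)[of m] by (simp add: sum_distrib_left powr_diff mult.assoc)
    also have "\<dots> \<le> h m powr (e - e') * (\<Sum>d<N m. (1 + L) powr e' * (1 + real d) powr (- (q + e')))"
    proof (intro mult_left_mono sum_mono)
      fix d assume "d \<in> {..<N m}"
      then have "real d * h m \<le> real (N m) * h m"
        using h(1)[of m] by (intro mult_right_mono) auto
      then have "real d * h m \<le> L" using N[of m] by simp
      then have "h m \<le> (1 + L) / (1 + real d)"
        using hm by (simp add: field_simps)
      then have "h m powr e' \<le> ((1 + L) / (1 + real d)) powr e'"
        using h(1)[of m] e' by (intro powr_mono2) auto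
      also have "\<dots> = (1 + L) powr e' * (1 + real d) powr (- e')"
        using L by (simp add: powr_divide powr_minus divide_simps)
      finally have "h m powr e' * (1 + real d) powr (- q) \<le> (1 + L) powr e' * (1 + real d) powr (- e') * (1 + real d) powr (- q)"
        by (intro mult_right_mono) auto
      then show "h m powr e' * (1 + real d) powr (- q) \<le> (1 + L) powr e' * (1 + real d) powr (- (q + e'))"
        by (simp add: powr_add[symmetric] mult.assoc add.commute)
    qed auto
    also have "\<dots> \<le> h m powr (e - e') * ((1 + L) powr e' * S)"
      unfolding sum_distrib_left[symmetric] S_def using sm
      by (intro mult_left_mono sum_le_suminf) auto
    finally show ?thesis .
  qed
  have "(\<lambda>m. h m powr (e - e') * ((1 + L) powr e' * S)) \<longlonglongrightarrow> 0 powr (e - e') * ((1 + L) powr e' * S)"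
    using h e' by (intro tendsto_mult tendsto_powr2 tendsto_const h(2)) (auto intro!: always_eventually less_imp_le)
  then have lim: "(\<lambda>m. h m powr (e - e') * ((1 + L) powr e' * S)) \<longlonglongrightarrow> 0" by simp
  show ?thesis
  proof (rule tendsto_sandwich[OF _ _ tendsto_const lim])
    show "\<forall>\<^sub>F m in sequentially. 0 \<le> h m powr e * (\<Sum>d<N m. (1 + real d) powr (- q))"
      by (auto intro!: always_eventually mult_nonneg_nonneg sum_nonneg)
    have "\<forall>\<^sub>F m in sequentially. h m < 1" using h(2) by (rule order_tendstoD) auto
    then show "\<forall>\<^sub>F m in sequentially. h m powr e * (\<Sum>d<N m. (1 + real d) powr (- q)) \<le> h m powr (e - e') * ((1 + L) powr e' * S)"
      by (rule eventually_mono) (rule bound)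
  qed
qed

section \<open>Consistency of the least squares estimator\<close>

definition nat_dist :: "nat \<Rightarrow> nat \<Rightarrow> nat" where
  "nat_dist j k = (if j \<le> k then k - j else j - k)"

text \<open>For fixed \<open>j\<close>, at most the two indices j + d and j - d lie at distance
  \<open>d\<close>.\<close>

lemma sum_nat_dist_le:
  fixes b :: "nat \<Rightarrow> real"
  assumes "\<And>d. b d \<ge> 0"
  shows "(\<Sum>k\<in>{k\<in>{..<n}. nat_dist j k < m}. b (nat_dist j k)) \<le> 2 * (\<Sum>d<m. b d)"
proof -
  let ?A = "{k\<in>{..<n}. nat_dist j k < m}"
  have "(\<Sum>k\<in>?A. b (nat_dist j k)) = (\<Sum>d<m. \<Sum>k\<in>{k\<in>?A. nat_dist j k = d}. b (nat_dist j k))"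
    by (rule sum.group[symmetric]) auto
  also have "\<dots> \<le> (\<Sum>d<m. 2 * b d)"
  proof (rule sum_mono)
    fix d
    have "{k\<in>?A. nat_dist j k = d} \<subseteq> {j + d, j - d}"
      by (auto simp: nat_dist_def split: if_splits)
    then have "card {k\<in>?A. nat_dist j k = d} \<le> card {j + d, j - d}"
      by (intro card_mono) auto
    also have "\<dots> \<le> 2" by (simp add: card_insert_if)
    finally have c: "real (card {k\<in>?A. nat_dist j k = d}) \<le> 2" by linarith
    have "(\<Sum>k\<in>{k\<in>?A. nat_dist j k = d}. b (nat_dist j k)) = real (card {k\<in>?A. nat_dist j k = d}) * b d"
      by (subst sum.cong[OF refl, of _ _ "\<lambda>_. b d"]) auto
    also have "\<dots> \<le> 2 * b d" using c assms by (intro mult_right_mono) auto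
    finally show "(\<Sum>k\<in>{k\<in>?A. nat_dist j k = d}. b (nat_dist j k)) \<le> 2 * b d" .
  qed
  finally show ?thesis by (simp add: sum_distrib_left)
qed

text \<open>Only lags below the block length \<open>m\<close> are controlled, because condition A says nothing about
  the cross-covariance beyond \<open>L\<close>; hence the sum is split into \<open>M\<close> blocks of length \<open>m\<close>, at the
  cost of a factor \<open>M\<close>.\<close>

lemma product_sum_chebyshev:
  fixes U V :: "nat \<Rightarrow> 'a \<Rightarrow> real" and b :: "nat \<Rightarrow> real"
  assumes P: "prob_space P"
    and g: "\<And>j k a b c d. \<exists>v. centred_gaussian P (\<lambda>\<omega>. a * U j \<omega> + b * V j \<omega> + c * U k \<omega> + d * V k \<omega>) v"
    and b: "\<And>d. b d \<ge> 0"
    and cov: "\<And>j k. nat_dist j k < m \<Longrightarrow>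
      \<bar>(\<integral>\<omega>. U j \<omega> * U k \<omega> \<partial>P) * (\<integral>\<omega>. V j \<omega> * V k \<omega> \<partial>P)\<bar>
      + \<bar>(\<integral>\<omega>. U j \<omega> * V k \<omega> \<partial>P) * (\<integral>\<omega>. V j \<omega> * U k \<omega> \<partial>P)\<bar> \<le> b (nat_dist j k)"
    and n: "n \<le> M * m" and t: "t > 0"
  shows "measure P {\<omega>\<in>space P. \<bar>(\<Sum>j<n. U j \<omega> * V j \<omega>) - (\<Sum>j<n. \<integral>\<omega>. U j \<omega> * V j \<omega> \<partial>P)\<bar> \<ge> t}
    \<le> 2 * real M * real n * (\<Sum>d<m. b d) / t\<^sup>2"
proof -
  interpret prob_space P by fact
  define q where "q j \<omega> = U j \<omega> * V j \<omega> - (\<integral>\<omega>. U j \<omega> * V j \<omega> \<partial>P)" for j \<omega>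
  have iUV: "integrable P (\<lambda>\<omega>. U j \<omega> * V j \<omega>)" for j
  proof (rule centred_gaussian_integrable_mult)
    show "\<exists>v. centred_gaussian P (\<lambda>\<omega>. a * U j \<omega> + b * V j \<omega>) v" for a b using g[of a j b 0 j 0] by simp
  qed
  note is4 = isserlis_integrable[OF g] and E = isserlis[OF g]
  have qq: "q j \<omega> * q k \<omega> = (U j \<omega> * V j \<omega>) * (U k \<omega> * V k \<omega>)
      - (\<integral>\<omega>. U k \<omega> * V k \<omega> \<partial>P) * (U j \<omega> * V j \<omega>) - (\<integral>\<omega>. U j \<omega> * V j \<omega> \<partial>P) * (U k \<omega> * V k \<omega>)
      + (\<integral>\<omega>. U j \<omega> * V j \<omega> \<partial>P) * (\<integral>\<omega>. U k \<omega> * V k \<omega> \<partial>P)" for j k \<omega>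
    by (simp add: q_def algebra_simps)
  have iq: "integrable P (\<lambda>\<omega>. q j \<omega> * q k \<omega>)" for j k
    unfolding qq using is4 iUV by auto
  have Eq: "(\<integral>\<omega>. q j \<omega> * q k \<omega> \<partial>P) = (\<integral>\<omega>. U j \<omega> * U k \<omega> \<partial>P) * (\<integral>\<omega>. V j \<omega> * V k \<omega> \<partial>P)
      + (\<integral>\<omega>. U j \<omega> * V k \<omega> \<partial>P) * (\<integral>\<omega>. V j \<omega> * U k \<omega> \<partial>P)" for j k
    unfolding qq using is4[of j k] iUV[of j] iUV[of k] by (simp add: E prob_space)
  define S where "S \<omega> = (\<Sum>j<n. q j \<omega>)" for \<omega>
  have Sq: "(S \<omega>)\<^sup>2 = (\<Sum>j<n. \<Sum>k<n. q j \<omega> * q k \<omega>)" for \<omega>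
    by (simp add: S_def power2_eq_square sum_product)
  have iS: "integrable P (\<lambda>\<omega>. (S \<omega>)\<^sup>2)" unfolding Sq using iq by auto
  define Bl where "Bl i = {j\<in>{..<n}. j div m = i}" for i
  have nm: "j div m < M" if "j < n" for j
    using that n by (simp add: less_mult_imp_div_less)
  have grp: "S \<omega> = (\<Sum>i<M. \<Sum>j\<in>Bl i. q j \<omega>)" for \<omega>
    unfolding S_def Bl_def using nm by (intro sum.group[symmetric]) auto
  \<comment> \<open>The Cauchy-Schwarz inequality over the \<open>M\<close> block sums; afterwards
    only pairs of indices in the same block remain.\<close>
  have S2: "(S \<omega>)\<^sup>2 \<le> real M * (\<Sum>i<M. \<Sum>j\<in>Bl i. \<Sum>k\<in>Bl i. q j \<omega> * q k \<omega>)" for \<omega>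
    unfolding grp using sum_squared_le_sum_of_squares[of "\<lambda>i. \<Sum>j\<in>Bl i. q j \<omega>" "{..<M}"]
    by (simp add: power2_eq_square sum_product mult.commute)
  have "(\<integral>\<omega>. (S \<omega>)\<^sup>2 \<partial>P) \<le> (\<integral>\<omega>. real M * (\<Sum>i<M. \<Sum>j\<in>Bl i. \<Sum>k\<in>Bl i. q j \<omega> * q k \<omega>) \<partial>P)"
    using S2 iS iq by (intro integral_mono) auto
  also have "\<dots> = real M * (\<Sum>i<M. \<Sum>j\<in>Bl i. \<Sum>k\<in>Bl i. (\<integral>\<omega>. q j \<omega> * q k \<omega> \<partial>P))"
    using iq by simp
  also have "\<dots> \<le> real M * (\<Sum>i<M. \<Sum>j\<in>Bl i. 2 * (\<Sum>d<m. b d))"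
  proof (intro mult_left_mono sum_mono)
    fix i j assume j: "j \<in> Bl i"
    \<comment> \<open>Indices in one block have the same quotient by \<open>m\<close>, so they
      differ by less than \<open>m\<close>. The block length is positive because \<open>n\<close>
      is.\<close>
    have dm: "nat_dist j k < m" if "k \<in> Bl i" for k
    proof -
      have e: "j div m = k div m" "m > 0" using that j n by (auto simp: Bl_def intro!: gr0I)
      have "j = m * (k div m) + j mod m" using e(1) by (metis mult_div_mod_eq)
      moreover have "k = m * (k div m) + k mod m" by simp
      moreover have "j mod m < m" "k mod m < m" using e by auto
      ultimately obtain x a c where "j = x + a" "k = x + c" "a < m" "c < m" by blast
      then show ?thesis by (auto simp: nat_dist_def)
    qed
    have "(\<Sum>k\<in>Bl i. (\<integral>\<omega>. q j \<omega> * q k \<omega> \<partial>P)) \<le> (\<Sum>k\<in>Bl i. b (nat_dist j k))"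
    proof (rule sum_mono)
      fix k assume "k \<in> Bl i"
      then show "(\<integral>\<omega>. q j \<omega> * q k \<omega> \<partial>P) \<le> b (nat_dist j k)"
        unfolding Eq using cov[OF dm, of k] by linarith
    qed
    also have "\<dots> \<le> (\<Sum>k\<in>{k\<in>{..<n}. nat_dist j k < m}. b (nat_dist j k))"
      using dm b by (intro sum_mono2) (auto simp: Bl_def)
    also have "\<dots> \<le> 2 * (\<Sum>d<m. b d)" by (rule sum_nat_dist_le[OF b])
    finally show "(\<Sum>k\<in>Bl i. (\<integral>\<omega>. q j \<omega> * q k \<omega> \<partial>P)) \<le> 2 * (\<Sum>d<m. b d)" .
  qed auto
  also have "(\<Sum>i<M. \<Sum>j\<in>Bl i. 2 * (\<Sum>d<m. b d)) = (\<Sum>j<n. 2 * (\<Sum>d<m. b d))"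
    unfolding Bl_def using nm by (intro sum.group) auto
  finally have var: "(\<integral>\<omega>. (S \<omega>)\<^sup>2 \<partial>P) \<le> 2 * real M * real n * (\<Sum>d<m. b d)"
    by (simp add: mult_ac)
  have "measure P {\<omega>\<in>space P. (S \<omega>)\<^sup>2 \<ge> t\<^sup>2} \<le> (\<integral>\<omega>. (S \<omega>)\<^sup>2 \<partial>P) / t\<^sup>2"
    using t iS by (intro integral_Markov_inequality_measure[where A="{}"]) auto
  also have "\<dots> \<le> 2 * real M * real n * (\<Sum>d<m. b d) / t\<^sup>2"
    using var by (intro divide_right_mono) auto
  also have "{\<omega>\<in>space P. (S \<omega>)\<^sup>2 \<ge> t\<^sup>2} = {\<omega>\<in>space P. \<bar>S \<omega>\<bar> \<ge> t}"
    using t by (auto simp: abs_le_square_iff[symmetric])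
  finally show ?thesis by (simp add: S_def q_def sum_subtractf)
qed

text \<open>Covariance of the \<open>j\<close>-th increment of one field with the
  \<open>k\<close>-th increment of another, when \<open>K\<close> is their stationary
  cross-covariance. It keeps the sign of j - k, since a cross-covariance is even only near the
  origin.\<close>

definition increment_cov :: "(real \<Rightarrow> real) \<Rightarrow> real \<Rightarrow> nat \<Rightarrow> nat \<Rightarrow> real" where
  "increment_cov K h j k = 2 * K ((real j - real k) * h)
     - K ((real j - real k + 1) * h) - K ((real j - real k - 1) * h)"

text \<open>The condition on the lag places all three arguments of \<open>K\<close> inside [-L, L],
  where \<open>K\<close> is even, so the sign of j - k may be dropped.\<close>

lemma increment_cov_bound:
  assumes r: "regular_kernel K p L C" and h: "h > 0" "(real (nat_dist j k) + 1) * h < L"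
  shows "\<bar>increment_cov K h j k\<bar> \<le> 24 * C * h powr p * (1 + real (nat_dist j k)) powr (p - 2)"
proof -
  have ev: "\<And>t. t\<in>{-L..L} \<Longrightarrow> K (- t) = K t" and L: "L > 0" using r by (auto simp: regular_kernel_def)
  define d where "d = nat_dist j k"
  define u where "u = real d * h"
  have hd: "0 \<le> u" "(real d + 1) * h = u + h" "(real d - 1) * h = u - h" "real d * h = u"
     "u + h < L" using h by (simp_all add: u_def d_def algebra_simps)
  have "increment_cov K h j k = 2 * K (real d * h) - K ((real d + 1) * h) - K ((real d - 1) * h)"
  proof (cases "j \<le> k")
    case True
    then have d: "real j - real k = - real d" by (simp add: d_def nat_dist_def)
    have "K (- u) = K u" "K (- (u + h)) = K (u + h)" "K (- (u - h)) = K (u - h)"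
      using hd(1,5) h(1) L by (intro ev; simp)+
    moreover have "(- real d) * h = - u" "(- real d + 1) * h = - (u - h)" "(- real d - 1) * h = - (u + h)"
      by (simp_all add: u_def algebra_simps)
    ultimately show ?thesis unfolding increment_cov_def d hd by simp
  next
    case False
    then have d: "real j - real k = real d" by (simp add: d_def nat_dist_def)
    then show ?thesis unfolding increment_cov_def d by simp
  qed
  then show ?thesis using regular_kernel_second_difference[OF r h(1), of d] h by (simp add: d_def)
qed

definition centred :: "'a measure \<Rightarrow> ('a \<Rightarrow> real) \<Rightarrow> 'a \<Rightarrow> real" where
  "centred P U \<omega> = U \<omega> - mean P U"

lemma gaussian_field_combination:
  assumes P: "prob_space P" and g: "gaussian_field P"
  shows "\<exists>v. centred_gaussian P (\<lambda>\<omega>.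
      a1 * centred P (fieldX p) \<omega> + a2 * centred P (fieldX q) \<omega> + a3 * centred P (fieldX r) \<omega> + a4 * centred P (fieldX s) \<omega> +
      (b1 * centred P (fieldW p) \<omega> + b2 * centred P (fieldW q) \<omega> + b3 * centred P (fieldW r) \<omega> + b4 * centred P (fieldW s) \<omega>)) v"
proof -
  interpret prob_space P by fact
  define S where "S = {p, q, r, s}"
  define i where "i x y = (if y = x then 1 else 0::real)" for x y :: real
  \<comment> \<open>The four points may coincide; \<open>\<alpha>\<close> and \<open>\<beta>\<close>
    add up the coefficients that fall on the same point.\<close>
  define \<alpha> where "\<alpha> x = a1 * i p x + a2 * i q x + a3 * i r x + a4 * i s x" for x
  define \<beta> where "\<beta> x = b1 * i p x + b2 * i q x + b3 * i r x + b4 * i s x" for x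
  have "finite S" by (simp add: S_def)
  have mem: "p \<in> S" "q \<in> S" "r \<in> S" "s \<in> S" by (auto simp: S_def)
  have one: "(\<Sum>y\<in>S. c * i x y * f y) = c * f x" if "x \<in> S" for x c and f :: "real \<Rightarrow> real"
    using that \<open>finite S\<close> by (simp add: i_def if_distrib if_distribR cong: if_cong)
  have eX: "(\<Sum>x\<in>S. \<alpha> x * f x) = a1 * f p + a2 * f q + a3 * f r + a4 * f s" for f
    by (simp add: \<alpha>_def distrib_right sum.distrib one mem)
  have eW: "(\<Sum>x\<in>S. \<beta> x * f x) = b1 * f p + b2 * f q + b3 * f r + b4 * f s" for f
    by (simp add: \<beta>_def distrib_right sum.distrib one mem)
  have l: "lin_comb S \<alpha> \<beta> \<omega> = (\<Sum>x\<in>S. \<alpha> x * fieldX x \<omega>) + (\<Sum>x\<in>S. \<beta> x * fieldW x \<omega>)" for \<omega>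
    by (simp add: lin_comb_def sum.distrib)
  have iX: "integrable P (fieldX x)" for x
  proof -
    have "gaussian_rv P (lin_comb {x} (\<lambda>_. 1) (\<lambda>_. 0))" using g by (simp add: gaussian_field_def)
    moreover have "lin_comb {x} (\<lambda>_. 1) (\<lambda>_. 0) = fieldX x" by (auto simp: lin_comb_def)
    ultimately show ?thesis using gaussian_rv_centred(2)[OF _ P] by metis
  qed
  have iW: "integrable P (fieldW x)" for x
  proof -
    have "gaussian_rv P (lin_comb {x} (\<lambda>_. 0) (\<lambda>_. 1))" using g by (simp add: gaussian_field_def)
    moreover have "lin_comb {x} (\<lambda>_. 0) (\<lambda>_. 1) = fieldW x" by (auto simp: lin_comb_def)
    ultimately show ?thesis using gaussian_rv_centred(2)[OF _ P] by metis
  qed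
  have m: "mean P (lin_comb S \<alpha> \<beta>) = (\<Sum>x\<in>S. \<alpha> x * mean P (fieldX x)) + (\<Sum>x\<in>S. \<beta> x * mean P (fieldW x))"
    unfolding mean_def l using iX iW by simp
  have d: "(\<Sum>x\<in>S. c x * centred P (U x) \<omega>) = (\<Sum>x\<in>S. c x * U x \<omega>) - (\<Sum>x\<in>S. c x * mean P (U x))" for c U \<omega>
    by (simp add: centred_def right_diff_distrib sum_subtractf)
  have "lin_comb S \<alpha> \<beta> \<omega> - mean P (lin_comb S \<alpha> \<beta>) =
     (\<Sum>x\<in>S. \<alpha> x * centred P (fieldX x) \<omega>) + (\<Sum>x\<in>S. \<beta> x * centred P (fieldW x) \<omega>)" for \<omega>
    unfolding m l d by simp
  note E = this[unfolded eX eW]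
  have "gaussian_rv P (lin_comb S \<alpha> \<beta>)"
    using g \<open>finite S\<close> by (simp add: gaussian_field_def)
  from gaussian_rv_centred(1)[OF this P] show ?thesis unfolding E by blast
qed

text \<open>Stationarity makes the means constant, so they cancel in increments. The fields
  themselves need not be centred.\<close>

lemma gaussian_field_increments:
  assumes P: "prob_space P" and g: "gaussian_field P" and st: "stationary_field P"
  shows "\<exists>v. centred_gaussian P (\<lambda>\<omega>. a * (fieldX q \<omega> - fieldX p \<omega>) + b * (fieldW q \<omega> - fieldW p \<omega>)
      + c * (fieldX s \<omega> - fieldX r \<omega>) + d * (fieldW s \<omega> - fieldW r \<omega>)) v"
proof -
  have m: "mean P (fieldX x) = mean P (fieldX y)" "mean P (fieldW x) = mean P (fieldW y)" for x y
    using st unfolding stationary_field_def by blast+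
  have X: "fieldX y \<omega> - fieldX x \<omega> = centred P (fieldX y) \<omega> - centred P (fieldX x) \<omega>" for x y \<omega>
    using m(1)[of x y] by (simp add: centred_def)
  have W: "fieldW y \<omega> - fieldW x \<omega> = centred P (fieldW y) \<omega> - centred P (fieldW x) \<omega>" for x y \<omega>
    using m(2)[of x y] by (simp add: centred_def)
  show ?thesis unfolding X W
    using gaussian_field_combination[OF P g, of "-a" p a q "-c" r c s "-b" b "-d" d]
    by (simp add: algebra_simps)
qed

text \<open>\<open>U\<close> and \<open>V\<close> range over the two fields, so that one statement
  covers the covariances of X, of W and between them.\<close>

lemma gaussian_field_increment_cov:
  assumes P: "prob_space P" and g: "gaussian_field P" and st: "stationary_field P"
    and U: "U = fieldX \<or> U = fieldW" and V: "V = fieldX \<or> V = fieldW"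
  shows "(\<integral>\<omega>. (U q \<omega> - U p \<omega>) * (V s \<omega> - V r \<omega>) \<partial>P) =
     covar P (U q) (V s) - covar P (U q) (V r) - covar P (U p) (V s) + covar P (U p) (V r)"
proof -
  have m: "mean P (fieldX x) = mean P (fieldX y)" "mean P (fieldW x) = mean P (fieldW y)" for x y
    using st unfolding stationary_field_def by blast+
  have Ui: "U q \<omega> - U p \<omega> = centred P (U q) \<omega> - centred P (U p) \<omega>" for \<omega>
    using m[of p q] U by (auto simp: centred_def)
  have Vi: "V s \<omega> - V r \<omega> = centred P (V s) \<omega> - centred P (V r) \<omega>" for \<omega>
    using m[of s r] V by (auto simp: centred_def)
  have i: "integrable P (\<lambda>\<omega>. centred P (U x) \<omega> * centred P (V y) \<omega>)" for x y
  proof (rule centred_gaussian_integrable_mult)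
    fix a b
    show "\<exists>v. centred_gaussian P (\<lambda>\<omega>. a * centred P (U x) \<omega> + b * centred P (V y) \<omega>) v"
      using U V
        gaussian_field_combination[OF P g, of a x b y 0 x 0 x 0 0 0 0]
        gaussian_field_combination[OF P g, of 0 x 0 y 0 x 0 x a b 0 0]
        gaussian_field_combination[OF P g, of a x 0 y 0 x 0 x 0 b 0 0]
        gaussian_field_combination[OF P g, of 0 x b y 0 x 0 x a 0 0 0]
      by (auto simp: add.commute)
  qed
  have c: "covar P (U x) (V y) = (\<integral>\<omega>. centred P (U x) \<omega> * centred P (V y) \<omega> \<partial>P)" for x y
    by (simp add: covar_def centred_def)
  have "(centred P (U q) \<omega> - centred P (U p) \<omega>) * (centred P (V s) \<omega> - centred P (V r) \<omega>) =
      centred P (U q) \<omega> * centred P (V s) \<omega> - centred P (U q) \<omega> * centred P (V r) \<omega>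
      - centred P (U p) \<omega> * centred P (V s) \<omega> + centred P (U p) \<omega> * centred P (V r) \<omega>" for \<omega>
    by (simp add: algebra_simps)
  then show ?thesis unfolding Ui Vi c using i by simp
qed

text \<open>Since n h is bounded below, n / (n h^\<delta>)^2 is at most a constant times h^(1 - 2
  \<delta>), and the whole ratio is at most a constant times h^(1 + s - 2 \<delta>) times the lag
  sum. With s = \<delta>X + \<delta>W and \<delta> = \<delta>X, the positivity of this exponent is
  exactly \<delta>X < \<delta>W + 1.\<close>

lemma block_bound_tendsto_0:
  fixes h :: "nat \<Rightarrow> real" and n m :: "nat \<Rightarrow> nat"
  assumes h: "\<And>i. h i > 0" "h \<longlonglongrightarrow> 0" and m: "\<And>i. real (m i) * h i \<le> L"
    and n: "\<forall>\<^sub>F i in sequentially. c \<le> real (n i) * h i" "c > 0"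
    and \<tau>: "\<tau> > 0"
    and s: "1 + s - 2 * \<delta> > 0" "q \<ge> 0" "1 + s - 2 * \<delta> + q > 1"
  shows "(\<lambda>i. 2 * M * real (n i) * (\<Sum>d<m i. k * h i powr s * (1 + real d) powr (- q)) / (\<tau> * real (n i) * h i powr \<delta>)\<^sup>2) \<longlonglongrightarrow> 0"
proof -
  let ?T = "\<lambda>i. h i powr (1 + s - 2 * \<delta>) * (\<Sum>d<m i. (1 + real d) powr (- q))"
  have T: "?T \<longlonglongrightarrow> 0" by (rule powr_sum_tendsto_0[OF h m s])
  have "(\<lambda>i. \<bar>2 * M * k / \<tau>\<^sup>2 / c\<bar> * ?T i) \<longlonglongrightarrow> \<bar>2 * M * k / \<tau>\<^sup>2 / c\<bar> * 0"
    by (intro tendsto_intros T)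
  then have lim: "(\<lambda>i. \<bar>2 * M * k / \<tau>\<^sup>2 / c\<bar> * ?T i) \<longlonglongrightarrow> 0" by simp
  show ?thesis
  proof (rule Lim_null_comparison[OF _ lim], rule eventually_mono[OF n(1)])
    fix i assume ci: "c \<le> real (n i) * h i"
    have hi: "h i > 0" by (rule h)
    have ni: "real (n i) > 0" using ci n(2) by (cases "n i") auto
    define A where "A = (\<Sum>d<m i. (1 + real d) powr (- q))"
    have A: "A \<ge> 0" by (auto simp: A_def intro!: sum_nonneg)
    define H where "H = h i powr \<delta>"
    have H: "H > 0" using hi by (simp add: H_def)
    have "2 * M * real (n i) * (\<Sum>d<m i. k * h i powr s * (1 + real d) powr (- q)) / (\<tau> * real (n i) * H)\<^sup>2
       = 2 * M * real (n i) * (k * h i powr s * A) / (\<tau> * real (n i) * H)\<^sup>2"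
      by (simp add: A_def sum_distrib_left)
    also have "\<dots> = (2 * M * k / \<tau>\<^sup>2) * (h i powr s * h i / H\<^sup>2 * A) / (real (n i) * h i)"
      using hi ni \<tau> H by (simp add: power2_eq_square field_simps)
    also have "h i powr s * h i / H\<^sup>2 = h i powr (1 + s - 2 * \<delta>)"
      using hi powr_mult_base[of "h i" s]
      by (simp add: H_def powr_diff power2_eq_square mult.commute flip: powr_add)
    finally have e: "2 * M * real (n i) * (\<Sum>d<m i. k * h i powr s * (1 + real d) powr (- q)) / (\<tau> * real (n i) * h i powr \<delta>)\<^sup>2
       = (2 * M * k / \<tau>\<^sup>2) * (h i powr (1 + s - 2 * \<delta>) * A) / (real (n i) * h i)" unfolding H_def .
    have "\<bar>(2 * M * k / \<tau>\<^sup>2) * (h i powr (1 + s - 2 * \<delta>) * A) / (real (n i) * h i)\<bar>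
        = \<bar>2 * M * k / \<tau>\<^sup>2\<bar> * (h i powr (1 + s - 2 * \<delta>) * A) / (real (n i) * h i)"
      using A hi ni by (simp add: abs_mult)
    also have "\<dots> \<le> \<bar>2 * M * k / \<tau>\<^sup>2\<bar> * (h i powr (1 + s - 2 * \<delta>) * A) / c"
      using A hi ni ci n(2) by (intro divide_left_mono) auto
    also have "\<dots> = \<bar>2 * M * k / \<tau>\<^sup>2 / c\<bar> * (h i powr (1 + s - 2 * \<delta>) * A)"
      using n(2) by simp
    finally show "norm (2 * M * real (n i) * (\<Sum>d<m i. k * h i powr s * (1 + real d) powr (- q)) / (\<tau> * real (n i) * h i powr \<delta>)\<^sup>2)
       \<le> \<bar>2 * M * k / \<tau>\<^sup>2 / c\<bar> * ?T i" unfolding e A_def real_norm_def .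
  qed
qed

lemma lattice_increment_cov:
  assumes P: "prob_space P" and g: "gaussian_field P" and st: "stationary_field P"
    and U: "U = fieldX \<or> U = fieldW" and V: "V = fieldX \<or> V = fieldW"
    and c: "\<And>s t. covar P (U s) (V t) = K (s - t)"
  shows "(\<integral>\<omega>. (U (a + real (Suc j) * h) \<omega> - U (a + real j * h) \<omega>)
      * (V (a + real (Suc k) * h) \<omega> - V (a + real k * h) \<omega>) \<partial>P) = increment_cov K h j k"
proof -
  have *: "a + real (Suc j) * h - (a + real (Suc k) * h) = (real j - real k) * h"
    "a + real (Suc j) * h - (a + real k * h) = (real j - real k + 1) * h"
    "a + real j * h - (a + real (Suc k) * h) = (real j - real k - 1) * h"
    "a + real j * h - (a + real k * h) = (real j - real k) * h"
    by (simp_all add: algebra_simps)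
  show ?thesis
    unfolding gaussian_field_increment_cov[OF P g st U V] c * increment_cov_def by simp
qed

lemma borel_measurable_fst_snd:
  "fst \<in> borel_measurable (borel :: (real \<times> real) measure)"
  "snd \<in> borel_measurable (borel :: (real \<times> real) measure)"
  using measurable_fst[of "borel :: real measure" "borel :: real measure"]
    measurable_snd[of "borel :: real measure" "borel :: real measure"] unfolding borel_prod .

lemma ols_diff_measurable:
  assumes "\<And>j. j \<le> n \<Longrightarrow> a + real j * h \<in> D"
  shows "ols_diff a h n \<in> borel_measurable (\<Pi>\<^sub>M s\<in>D. borel)"
proof -
  have c: "(\<lambda>z. z (a + real j * h)) \<in> measurable (\<Pi>\<^sub>M s\<in>D. borel) (borel :: (real \<times> real) measure)"
    if "j \<le> n" for j using assms[OF that] by (rule measurable_component_singleton)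
  have f: "(\<lambda>z. fst (z (a + real j * h))) \<in> borel_measurable (\<Pi>\<^sub>M s\<in>D. (borel :: (real \<times> real) measure))"
    and s: "(\<lambda>z. snd (z (a + real j * h))) \<in> borel_measurable (\<Pi>\<^sub>M s\<in>D. (borel :: (real \<times> real) measure))"
    if "j \<le> n" for j
    using borel_measurable_fst_snd[THEN measurable_compose[OF c[OF that]]] .
  show ?thesis
    unfolding ols_diff_def Let_def
    by (intro borel_measurable_divide borel_measurable_sum borel_measurable_times borel_measurable_diff
      borel_measurable_power f s) auto
qed

text \<open>Increments of Y are \<beta> times those of X plus those of W, so the error of the
  estimator is the ratio of the cross sum to the sum of squares. The statement is for a fixed
  outcome; probability enters only through the two bounds assumed.\<close>

lemma ols_diff_error:
  assumes D: "\<And>j. j \<le> n \<Longrightarrow> a + real j * h \<in> D"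
    and dX: "\<And>j. dX j = fieldX (a + real (Suc j) * h) \<omega> - fieldX (a + real j * h) \<omega>"
    and dW: "\<And>j. dW j = fieldW (a + real (Suc j) * h) \<omega> - fieldW (a + real j * h) \<omega>"
    and S: "(\<Sum>j<n. dX j * dX j) > \<tau>" "\<tau> > 0" and R: "\<bar>\<Sum>j<n. dX j * dW j\<bar> < \<epsilon> * \<tau>"
  shows "\<bar>ols_diff a h n (observed D \<beta> \<omega>) - \<beta>\<bar> \<le> \<epsilon>"
proof -
  have o: "observed D \<beta> \<omega> (a + real j * h) = (fieldX (a + real j * h) \<omega>, fieldX (a + real j * h) \<omega> * \<beta> + fieldW (a + real j * h) \<omega>)"
    if "j \<le> n" for j using D[OF that] by (simp add: observed_def)
  have x: "fst (observed D \<beta> \<omega> (a + real (Suc j) * h)) - fst (observed D \<beta> \<omega> (a + real j * h)) = dX j"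
    if "j < n" for j using that by (simp only: o Suc_leI less_imp_le fst_conv dX)
  have y: "snd (observed D \<beta> \<omega> (a + real (Suc j) * h)) - snd (observed D \<beta> \<omega> (a + real j * h)) = \<beta> * dX j + dW j"
    if "j < n" for j
    using that by (simp only: o Suc_leI less_imp_le snd_conv dX dW) (simp only: algebra_simps)
  have "ols_diff a h n (observed D \<beta> \<omega>) = (\<Sum>j<n. dX j * (\<beta> * dX j + dW j)) / (\<Sum>j<n. (dX j)\<^sup>2)"
    unfolding ols_diff_def Let_def
    by (intro arg_cong2[where f="(/)"] sum.cong refl; simp only: x y lessThan_iff)
  also have "\<dots> = (\<beta> * (\<Sum>j<n. dX j * dX j) + (\<Sum>j<n. dX j * dW j)) / (\<Sum>j<n. dX j * dX j)"
    by (simp add: power2_eq_square sum_distrib_left algebra_simps sum.distrib)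
  finally have "ols_diff a h n (observed D \<beta> \<omega>) - \<beta> = (\<Sum>j<n. dX j * dW j) / (\<Sum>j<n. dX j * dX j)"
    using S by (simp add: field_simps)
  also have "\<bar>\<dots>\<bar> \<le> \<epsilon>"
  proof -
    have "\<bar>\<Sum>j<n. dX j * dW j\<bar> \<le> \<epsilon> * (\<Sum>j<n. dX j * dX j)"
      using R S by (smt (verit) mult_less_cancel_left_pos mult_neg_pos zero_less_mult_iff abs_ge_zero)
    then show ?thesis using S by (simp add: abs_divide field_simps)
  qed
  finally show ?thesis .
qed

theorem ols_consistent:
  assumes P: "P \<in> model_laws \<delta>X \<delta>W" and \<delta>: "0 < \<delta>X" "\<delta>X < 2" "0 < \<delta>W" "\<delta>W < 2" "\<delta>X < \<delta>W + 1"
    and ab: "a < b" "{a..b} \<subseteq> D" and h: "\<And>i. h i > 0" "h \<longlonglongrightarrow> 0" and \<epsilon>: "\<epsilon> > 0"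
  shows "(\<lambda>i. measure P {\<omega> \<in> space P.
      \<bar>ols_diff a (h i) (nat \<lfloor>(b - a) / h i\<rfloor>) (observed D \<beta> \<omega>) - \<beta>\<bar> > \<epsilon>}) \<longlonglongrightarrow> 0"
proof -
  have pr: "prob_space P" and g: "gaussian_field P" and st: "stationary_field P"
    using P by (auto simp: model_laws_def bivariate_law_def)
  interpret prob_space P by fact
  from P obtain \<sigma>X \<phi>X where X: "\<sigma>X > 0" "\<phi>X > 0"
      "\<And>s t. covar P (fieldX s) (fieldX t) = power_exponential \<sigma>X \<phi>X \<delta>X (s - t)"
    unfolding model_laws_def by blast
  from P obtain \<sigma>W \<phi>W where W: "\<sigma>W > 0" "\<phi>W > 0"
      "\<And>s t. covar P (fieldW s) (fieldW t) = power_exponential \<sigma>W \<phi>W \<delta>W (s - t)"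
    unfolding model_laws_def by blast
  from P obtain K L0 c \<alpha> where K: "\<And>s t. covar P (fieldX s) (fieldW t) = K (s - t)"
      "condition_A K L0 c \<alpha>" "\<alpha> > \<delta>X"
    unfolding model_laws_def by blast
  obtain CX where rX: "regular_kernel (power_exponential \<sigma>X \<phi>X \<delta>X) \<delta>X 1 CX"
    using power_exponential_regular X \<delta> by blast
  obtain CW where rW: "regular_kernel (power_exponential \<sigma>W \<phi>W \<delta>W) \<delta>W 1 CW"
    using power_exponential_regular W \<delta> by blast
  \<comment> \<open>The midpoint of \<open>\<delta>X\<close> and \<open>min \<alpha> 2\<close> is
    strictly above \<open>\<delta>X\<close>, strictly below 2 and at most
    \<open>\<alpha>\<close>.\<close>
  define p where "p = (\<delta>X + min \<alpha> 2) / 2"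
  have p: "\<delta>X < p" "p < 2" "p \<le> \<alpha>" "0 < p" using K(3) \<delta> by (auto simp: p_def min_def)
  obtain LK CK where rK: "regular_kernel K p LK CK"
    using condition_A_regular[OF K(2)] p by blast
  define L where "L = min 1 LK"
  have L: "L > 0" "L \<le> 1" "L \<le> LK" and C0: "CX \<ge> 0" "CW \<ge> 0" "CK \<ge> 0"
    using rX rW rK by (auto simp: L_def regular_kernel_def)
  \<comment> \<open>The number of blocks stays fixed as the mesh tends to 0. A block spans less than
    L / 2 plus one step of the lattice.\<close>
  obtain M :: nat where M: "real M > 2 * (b - a) / L" using reals_Archimedean2 by blast
  have M0: "real M > 0" using M ab L by (smt (verit) divide_pos_pos)
  define n where "n i = nat \<lfloor>(b - a) / h i\<rfloor>" for i
  \<comment> \<open>The added 1 rounds the block length up, so that \<open>M\<close> blocks cover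
    all \<open>n i\<close> increments.\<close>
  define m where "m i = n i div M + 1" for i
  have nh: "real (n i) * h i \<le> b - a" "real (n i) * h i > b - a - h i" for i
  proof -
    have "real (n i) = of_int \<lfloor>(b - a) / h i\<rfloor>" using ab h(1)[of i] by (simp add: n_def)
    then have "real (n i) \<le> (b - a) / h i" "real (n i) > (b - a) / h i - 1" by linarith+
    then show "real (n i) * h i \<le> b - a" "real (n i) * h i > b - a - h i"
      using h(1)[of i] by (simp_all add: field_simps)
  qed
  have inD: "a + real j * h i \<in> D" if "j \<le> n i" for i j
  proof -
    have "real j * h i \<le> real (n i) * h i" using that h(1)[of i] by (intro mult_right_mono) auto
    then have "a + real j * h i \<le> b" using nh(1)[of i] by linarith
    moreover have "0 \<le> real j * h i" using h(1)[of i] by simp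
    ultimately show ?thesis by (intro subsetD[OF ab(2)]) simp
  qed
  have Mm: "n i \<le> M * m i" for i
  proof -
    have "n i = M * (n i div M) + n i mod M" "n i mod M < M" using M0 by simp_all
    then show ?thesis unfolding m_def by (simp only: distrib_left)
  qed
  have mh': "real (m i) * h i \<le> (b - a) / real M + h i" for i
  proof -
    have "real (n i div M) \<le> real (n i) / real M" by (simp add: of_nat_div_le_of_nat)
    then have "real (m i) * h i \<le> (real (n i) / real M + 1) * h i"
      using h(1)[of i] by (intro mult_right_mono) (auto simp: m_def)
    also have "\<dots> = real (n i) * h i / real M + h i" by (simp add: algebra_simps)
    also have "\<dots> \<le> (b - a) / real M + h i" using nh(1)[of i] by (simp add: divide_right_mono)
    finally show ?thesis .
  qed
  obtain H where "\<And>i. norm (h i) \<le> H"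
    using convergent_imp_Bseq[OF convergentI[OF h(2)]] unfolding Bseq_def by blast
  then have H: "h i \<le> H" for i by (auto simp: abs_le_iff)
  have mh: "real (m i) * h i \<le> (b - a) / real M + H" for i using mh'[of i] H[of i] by linarith
  have ev: "\<forall>\<^sub>F i in sequentially. h i < e" if "e > 0" for e
    using h(2) that by (rule order_tendstoD(2))
  have nev: "\<forall>\<^sub>F i in sequentially. (b - a) / 2 \<le> real (n i) * h i"
  proof (rule eventually_mono)
    show "\<forall>\<^sub>F i in sequentially. h i < (b - a) / 2" using ab by (intro ev) simp
    show "(b - a) / 2 \<le> real (n i) * h i" if "h i < (b - a) / 2" for i using nh(2)[of i] that by argo
  qed
  have mev: "\<forall>\<^sub>F i in sequentially. real (m i) * h i < L"
  proof (rule eventually_mono)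
    show "\<forall>\<^sub>F i in sequentially. h i < L / 2" using L by (intro ev) simp
    have "(b - a) / real M < L / 2" using M M0 L by (simp add: field_simps)
    then show "real (m i) * h i < L" if "h i < L / 2" for i using mh'[of i] that by argo
  qed
  define dX where "dX i j \<omega> = fieldX (a + real (Suc j) * h i) \<omega> - fieldX (a + real j * h i) \<omega>" for i j \<omega>
  define dW where "dW i j \<omega> = fieldW (a + real (Suc j) * h i) \<omega> - fieldW (a + real j * h i) \<omega>" for i j \<omega>
  have gXW: "\<exists>v. centred_gaussian P (\<lambda>\<omega>. a' * dX i j \<omega> + b' * dW i j \<omega> + c' * dX i k \<omega> + d' * dW i k \<omega>) v"
    for i j k a' b' c' d' unfolding dX_def dW_def by (rule gaussian_field_increments[OF pr g st])
  have gXX: "\<exists>v. centred_gaussian P (\<lambda>\<omega>. a' * dX i j \<omega> + b' * dX i j \<omega> + c' * dX i k \<omega> + d' * dX i k \<omega>) v"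
    for i j k a' b' c' d' using gXW[of "a' + b'" i j 0 "c' + d'" k 0] by (simp add: algebra_simps)
  have cXX: "(\<integral>\<omega>. dX i j \<omega> * dX i k \<omega> \<partial>P) = increment_cov (power_exponential \<sigma>X \<phi>X \<delta>X) (h i) j k" for i j k
    unfolding dX_def by (rule lattice_increment_cov[OF pr g st, of fieldX fieldX]) (auto simp: X(3))
  have cWW: "(\<integral>\<omega>. dW i j \<omega> * dW i k \<omega> \<partial>P) = increment_cov (power_exponential \<sigma>W \<phi>W \<delta>W) (h i) j k" for i j k
    unfolding dW_def by (rule lattice_increment_cov[OF pr g st, of fieldW fieldW]) (auto simp: W(3))
  have cXW: "(\<integral>\<omega>. dX i j \<omega> * dW i k \<omega> \<partial>P) = increment_cov K (h i) j k" for i j k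
    unfolding dX_def dW_def by (rule lattice_increment_cov[OF pr g st, of fieldX fieldW]) (auto simp: K(1))
  have cWX: "(\<integral>\<omega>. dW i j \<omega> * dX i k \<omega> \<partial>P) = increment_cov K (h i) k j" for i j k
    using cXW[of i k j] by (simp add: mult.commute)
  have sym: "nat_dist j k = nat_dist k j" for j k by (simp add: nat_dist_def)
  define g1 where "g1 q C i d = 24 * C * h i powr q * (1 + real d) powr (q - 2)" for q C i d
  have g1: "g1 q C i d * g1 q' C' i d = 576 * C * C' * h i powr (q + q') * (1 + real d) powr (- (4 - q - q'))" for q C q' C' i d
    by (simp add: g1_def powr_add[of "h i"] powr_add[of "1 + real d", symmetric] algebra_simps)
  have g1_nn: "C \<ge> 0 \<Longrightarrow> g1 q C i d \<ge> 0" for q C i d by (simp add: g1_def)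
  have lag: "(real (nat_dist j k) + 1) * h i < L" if "real (m i) * h i < L" "nat_dist j k < m i" for i j k
  proof -
    have "(real (nat_dist j k) + 1) * h i \<le> real (m i) * h i"
      using that(2) h(1)[of i] by (intro mult_right_mono) auto
    then show ?thesis using that(1) by simp
  qed
  have bX: "\<bar>increment_cov (power_exponential \<sigma>X \<phi>X \<delta>X) (h i) j k\<bar> \<le> g1 \<delta>X CX i (nat_dist j k)"
   and bW: "\<bar>increment_cov (power_exponential \<sigma>W \<phi>W \<delta>W) (h i) j k\<bar> \<le> g1 \<delta>W CW i (nat_dist j k)"
   and bK: "\<bar>increment_cov K (h i) j k\<bar> \<le> g1 p CK i (nat_dist j k)"
   if "real (m i) * h i < L" "nat_dist j k < m i" for i j k
    unfolding g1_def using lag[OF that] L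
    by (intro increment_cov_bound[OF rX] increment_cov_bound[OF rW] increment_cov_bound[OF rK] h(1); simp)+
  define bXX where "bXX i d = 2 * (g1 \<delta>X CX i d * g1 \<delta>X CX i d)" for i d
  define bXW where "bXW i d = g1 \<delta>X CX i d * g1 \<delta>W CW i d + g1 p CK i d * g1 p CK i d" for i d
  \<comment> \<open>The inequality 1 - exp (- u) >= u / 2 bounds the expected sum of squares below
    by 2 \<kappa> n h^\<delta>X; half of that becomes the threshold \<open>\<tau>\<close>.\<close>
  define \<kappa> where "\<kappa> = \<sigma>X * \<phi>X / 2"
  have \<kappa>: "\<kappa> > 0" using X by (simp add: \<kappa>_def)
  define N where "N i = real (n i) * h i powr \<delta>X" for i
  define BX where "BX i = 2 * real M * real (n i) * (\<Sum>d<m i. bXX i d) / (\<kappa> * real (n i) * h i powr \<delta>X)\<^sup>2" for i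
  define BW where "BW i = 2 * real M * real (n i) * (\<Sum>d<m i. bXW i d) / (\<epsilon> * \<kappa> / 2 * real (n i) * h i powr \<delta>X)\<^sup>2" for i
  have c2: "(b - a) / 2 > 0" using ab by simp
  have BX0: "BX \<longlonglongrightarrow> 0"
  proof -
    have "2 * real M * real (n i) * (\<Sum>d<m i. (1152 * CX * CX) * h i powr (2 * \<delta>X) * (1 + real d) powr (- (4 - 2 * \<delta>X)))
       / (\<kappa> * real (n i) * h i powr \<delta>X)\<^sup>2 = BX i" for i
      unfolding BX_def bXX_def g1 by (simp add: mult.assoc)
    moreover have "(\<lambda>i. 2 * real M * real (n i) * (\<Sum>d<m i. (1152 * CX * CX) * h i powr (2 * \<delta>X) * (1 + real d) powr (- (4 - 2 * \<delta>X)))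
       / (\<kappa> * real (n i) * h i powr \<delta>X)\<^sup>2) \<longlonglongrightarrow> 0"
      using \<delta> by (intro block_bound_tendsto_0[OF h mh nev c2 \<kappa>]) auto
    ultimately show ?thesis by simp
  qed
  have BW0: "BW \<longlonglongrightarrow> 0"
  proof -
    have e: "2 * real M * real (n i) * (\<Sum>d<m i. (576 * CX * CW) * h i powr (\<delta>X + \<delta>W) * (1 + real d) powr (- (4 - \<delta>X - \<delta>W)))
         / (\<epsilon> * \<kappa> / 2 * real (n i) * h i powr \<delta>X)\<^sup>2
       + 2 * real M * real (n i) * (\<Sum>d<m i. (576 * CK * CK) * h i powr (p + p) * (1 + real d) powr (- (4 - p - p)))
         / (\<epsilon> * \<kappa> / 2 * real (n i) * h i powr \<delta>X)\<^sup>2 = BW i" for i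
      unfolding BW_def bXW_def g1 sum.distrib by (simp add: algebra_simps add_divide_distrib)
    have t2: "\<epsilon> * \<kappa> / 2 > 0" using \<epsilon> \<kappa> by simp
    \<comment> \<open>The first summand has s = \<delta>X + \<delta>W and uses \<delta>X < \<delta>W
      + 1; the second has s = 2 p and uses p > \<delta>X. In both, the condition 1 + s - 2 \<delta>X
      + q > 1 amounts to \<delta>X < 2.\<close>
    have "(\<lambda>i. 2 * real M * real (n i) * (\<Sum>d<m i. (576 * CX * CW) * h i powr (\<delta>X + \<delta>W) * (1 + real d) powr (- (4 - \<delta>X - \<delta>W)))
         / (\<epsilon> * \<kappa> / 2 * real (n i) * h i powr \<delta>X)\<^sup>2
       + 2 * real M * real (n i) * (\<Sum>d<m i. (576 * CK * CK) * h i powr (p + p) * (1 + real d) powr (- (4 - p - p)))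
         / (\<epsilon> * \<kappa> / 2 * real (n i) * h i powr \<delta>X)\<^sup>2) \<longlonglongrightarrow> 0 + 0"
      using \<delta> p by (intro tendsto_add block_bound_tendsto_0[OF h mh nev c2 t2]) auto
    then show ?thesis unfolding e by simp
  qed
  have "(\<lambda>i. 24 * CK * h i powr (p - \<delta>X)) \<longlonglongrightarrow> 24 * CK * 0 powr (p - \<delta>X)"
    using h p by (intro tendsto_intros tendsto_powr2 h(2)) (auto intro!: always_eventually less_imp_le)
  then have "(\<lambda>i. 24 * CK * h i powr (p - \<delta>X)) \<longlonglongrightarrow> 0" by simp
  \<comment> \<open>The mean of the cross sum is O(n h^p), of smaller order than n h^\<delta>X
    because p > \<delta>X.\<close>
  then have Kev: "\<forall>\<^sub>F i in sequentially. 24 * CK * h i powr (p - \<delta>X) < \<epsilon> * \<kappa> / 2"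
    using \<epsilon> \<kappa> by (intro order_tendstoD(2)) auto
  have "(\<lambda>i. \<phi>X * h i powr \<delta>X) \<longlonglongrightarrow> \<phi>X * 0 powr \<delta>X"
    using h \<delta> by (intro tendsto_intros tendsto_powr2 h(2)) (auto intro!: always_eventually less_imp_le)
  then have "(\<lambda>i. \<phi>X * h i powr \<delta>X) \<longlonglongrightarrow> 0" by simp
  then have Xev: "\<forall>\<^sub>F i in sequentially. \<phi>X * h i powr \<delta>X < 1" by (intro order_tendstoD(2)) auto
  have bound: "\<forall>\<^sub>F i in sequentially. measure P {\<omega> \<in> space P.
      \<bar>ols_diff a (h i) (n i) (observed D \<beta> \<omega>) - \<beta>\<bar> > \<epsilon>} \<le> BX i + BW i"
    using nev mev Kev Xev
  proof eventually_elim
    case (elim i)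
    have hi: "h i > 0" by (rule h)
    have ni: "n i > 0" using elim(1) c2 by (cases "n i") auto
    define \<tau> where "\<tau> = \<kappa> * real (n i) * h i powr \<delta>X"
    have \<tau>: "\<tau> > 0" using \<kappa> ni hi by (simp add: \<tau>_def)
    define SX where "SX \<omega> = (\<Sum>j<n i. dX i j \<omega> * dX i j \<omega>)" for \<omega>
    define SW where "SW \<omega> = (\<Sum>j<n i. dX i j \<omega> * dW i j \<omega>)" for \<omega>
    define mX where "mX = (\<Sum>j<n i. (\<integral>\<omega>. dX i j \<omega> * dX i j \<omega> \<partial>P))"
    define mW where "mW = (\<Sum>j<n i. (\<integral>\<omega>. dX i j \<omega> * dW i j \<omega> \<partial>P))"
    have [measurable]: "dX i j \<in> borel_measurable P" "dW i j \<in> borel_measurable P" for j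
      using gXW[of 1 i j 0 0 j 0] gXW[of 0 i j 1 0 j 0] by (auto simp: centred_gaussian_def)
    have PX: "measure P {\<omega>\<in>space P. \<bar>SX \<omega> - mX\<bar> \<ge> \<tau>} \<le> BX i"
      unfolding SX_def mX_def BX_def \<tau>_def[symmetric]
    proof (rule product_sum_chebyshev[OF pr gXX _ _ Mm \<tau>])
      show "0 \<le> bXX i d" for d using C0 g1_nn by (simp add: bXX_def)
      fix j k assume d: "nat_dist j k < m i"
      show "\<bar>(\<integral>\<omega>. dX i j \<omega> * dX i k \<omega> \<partial>P) * (\<integral>\<omega>. dX i j \<omega> * dX i k \<omega> \<partial>P)\<bar>
         + \<bar>(\<integral>\<omega>. dX i j \<omega> * dX i k \<omega> \<partial>P) * (\<integral>\<omega>. dX i j \<omega> * dX i k \<omega> \<partial>P)\<bar> \<le> bXX i (nat_dist j k)"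
        unfolding cXX bXX_def abs_mult
        using mult_mono[OF bX[OF elim(2) d] bX[OF elim(2) d]] C0 g1_nn by simp
    qed
    have PW: "measure P {\<omega>\<in>space P. \<bar>SW \<omega> - mW\<bar> \<ge> \<epsilon> * \<tau> / 2} \<le> BW i"
    proof -
      have "\<epsilon> * \<tau> / 2 = \<epsilon> * \<kappa> / 2 * real (n i) * h i powr \<delta>X" by (simp add: \<tau>_def)
      then have BWe: "BW i = 2 * real M * real (n i) * (\<Sum>d<m i. bXW i d) / (\<epsilon> * \<tau> / 2)\<^sup>2" by (simp only: BW_def)
      have \<tau>2: "\<epsilon> * \<tau> / 2 > 0" using \<epsilon> \<tau> by simp
      show ?thesis
        unfolding SW_def mW_def BWe
      proof (rule product_sum_chebyshev[OF pr gXW _ _ Mm \<tau>2])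
        show "0 \<le> bXW i d" for d using C0 g1_nn by (simp add: bXW_def)
        fix j k assume d: "nat_dist j k < m i"
        have d': "nat_dist k j < m i" using d sym by simp
        have "\<bar>increment_cov (power_exponential \<sigma>X \<phi>X \<delta>X) (h i) j k\<bar> * \<bar>increment_cov (power_exponential \<sigma>W \<phi>W \<delta>W) (h i) j k\<bar>
          \<le> g1 \<delta>X CX i (nat_dist j k) * g1 \<delta>W CW i (nat_dist j k)"
          using C0 g1_nn by (intro mult_mono bX[OF elim(2) d] bW[OF elim(2) d]) auto
        moreover have "\<bar>increment_cov K (h i) j k\<bar> * \<bar>increment_cov K (h i) k j\<bar>
          \<le> g1 p CK i (nat_dist j k) * g1 p CK i (nat_dist j k)"
          using C0 g1_nn bK[OF elim(2) d'] by (intro mult_mono bK[OF elim(2) d]) (auto simp: sym)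
        ultimately show "\<bar>(\<integral>\<omega>. dX i j \<omega> * dX i k \<omega> \<partial>P) * (\<integral>\<omega>. dW i j \<omega> * dW i k \<omega> \<partial>P)\<bar>
         + \<bar>(\<integral>\<omega>. dX i j \<omega> * dW i k \<omega> \<partial>P) * (\<integral>\<omega>. dW i j \<omega> * dX i k \<omega> \<partial>P)\<bar> \<le> bXW i (nat_dist j k)"
          unfolding cXX cWW cXW cWX bXW_def abs_mult by (rule add_mono)
      qed
    qed
    have mXl: "mX \<ge> 2 * \<tau>"
    proof -
      define u where "u = \<phi>X * h i powr \<delta>X"
      have u: "0 \<le> u" "u \<le> 1" using X elim(4) by (auto simp: u_def)
      have "1 - exp (- u) \<ge> u / 2" by (rule one_minus_exp_ge[OF u])
      then have "2 * \<sigma>X * (1 - exp (- u)) \<ge> \<sigma>X * u" using X mult_left_mono[of "u / 2" "1 - exp (- u)" "2 * \<sigma>X"] by simp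
      moreover have "increment_cov (power_exponential \<sigma>X \<phi>X \<delta>X) (h i) j j = 2 * \<sigma>X * (1 - exp (- u))" for j
        using hi \<delta> by (simp add: increment_cov_def power_exponential_def u_def algebra_simps)
      ultimately have "mX \<ge> real (n i) * (\<sigma>X * u)" unfolding mX_def cXX by (simp add: mult_left_mono)
      then show ?thesis by (simp add: \<tau>_def \<kappa>_def u_def mult_ac)
    qed
    have mWl: "\<bar>mW\<bar> \<le> \<epsilon> * \<tau> / 2"
    proof -
      have m1: "nat_dist j j < m i" for j by (simp add: m_def nat_dist_def)
      have "\<bar>mW\<bar> \<le> (\<Sum>j<n i. 24 * CK * h i powr p)"
        unfolding mW_def cXW using bK[OF elim(2) m1]
        by (intro order.trans[OF sum_abs] sum_mono) (simp add: g1_def nat_dist_def)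
      also have "\<dots> = real (n i) * h i powr \<delta>X * (24 * CK * h i powr (p - \<delta>X))"
        using hi by (simp add: powr_diff)
      also have "\<dots> \<le> real (n i) * h i powr \<delta>X * (\<epsilon> * \<kappa> / 2)"
        using elim(3) by (intro mult_left_mono) auto
      finally show ?thesis by (simp add: \<tau>_def mult_ac)
    qed
    \<comment> \<open>Off the two deviation events the denominator exceeds 2 \<tau> - \<tau>, and
      the numerator stays below \<epsilon> \<tau> / 2 twice.\<close>
    have "measure P {\<omega> \<in> space P. \<bar>ols_diff a (h i) (n i) (observed D \<beta> \<omega>) - \<beta>\<bar> > \<epsilon>}
       \<le> measure P ({\<omega>\<in>space P. \<bar>SX \<omega> - mX\<bar> \<ge> \<tau>} \<union> {\<omega>\<in>space P. \<bar>SW \<omega> - mW\<bar> \<ge> \<epsilon> * \<tau> / 2})"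
    proof (rule finite_measure_mono)
      show "{\<omega> \<in> space P. \<epsilon> < \<bar>ols_diff a (h i) (n i) (observed D \<beta> \<omega>) - \<beta>\<bar>}
        \<subseteq> {\<omega>\<in>space P. \<bar>SX \<omega> - mX\<bar> \<ge> \<tau>} \<union> {\<omega>\<in>space P. \<bar>SW \<omega> - mW\<bar> \<ge> \<epsilon> * \<tau> / 2}"
      proof (rule ccontr)
        assume "\<not> ?thesis"
        then obtain \<omega> where \<omega>: "\<epsilon> < \<bar>ols_diff a (h i) (n i) (observed D \<beta> \<omega>) - \<beta>\<bar>"
          "\<bar>SX \<omega> - mX\<bar> < \<tau>" "\<bar>SW \<omega> - mW\<bar> < \<epsilon> * \<tau> / 2" by force
        have "SX \<omega> > \<tau>" using \<omega>(2) mXl by linarith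
        moreover have "\<bar>SW \<omega>\<bar> < \<epsilon> * \<tau>" using \<omega>(3) mWl by linarith
        ultimately have "\<bar>ols_diff a (h i) (n i) (observed D \<beta> \<omega>) - \<beta>\<bar> \<le> \<epsilon>"
          unfolding SX_def SW_def using \<tau>
          by (intro ols_diff_error[where dX="\<lambda>j. dX i j \<omega>" and dW="\<lambda>j. dW i j \<omega>" and \<tau>=\<tau> and \<omega>=\<omega>] inD dX_def dW_def)
        then show False using \<omega>(1) by simp
      qed
    qed (simp add: SX_def SW_def)
    also have "\<dots> \<le> BX i + BW i"
      using PX PW by (intro order.trans[OF measure_Un_le] add_mono) (auto simp: SX_def SW_def)
    finally show ?case .
  qed
  have "(\<lambda>i. BX i + BW i) \<longlonglongrightarrow> 0 + 0" by (intro tendsto_add BX0 BW0)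
  then have lim: "(\<lambda>i. BX i + BW i) \<longlonglongrightarrow> 0" by simp
  show ?thesis unfolding n_def[symmetric]
    by (rule tendsto_sandwich[OF _ bound tendsto_const lim]) auto
qed

section \<open>Positive semidefinite kernels\<close>

definition qform :: "('a \<Rightarrow> 'a \<Rightarrow> real) \<Rightarrow> 'a set \<Rightarrow> ('a \<Rightarrow> real) \<Rightarrow> real" where
  "qform K S c = (\<Sum>s\<in>S. \<Sum>t\<in>S. c s * c t * K s t)"

definition psd_kernel :: "('a \<Rightarrow> 'a \<Rightarrow> real) \<Rightarrow> bool" where
  "psd_kernel K \<longleftrightarrow> (\<forall>s t. K s t = K t s) \<and> (\<forall>S c. finite S \<longrightarrow> qform K S c \<ge> 0)"

lemma psd_kernel_sym: "psd_kernel K \<Longrightarrow> K s t = K t s"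
  by (simp add: psd_kernel_def)

lemma psd_kernel_qform: "psd_kernel K \<Longrightarrow> finite S \<Longrightarrow> qform K S c \<ge> 0"
  by (simp add: psd_kernel_def)

lemma psd_kernel_diag: "psd_kernel K \<Longrightarrow> K t t \<ge> 0"
  using psd_kernel_qform[of K "{t}" "\<lambda>_. 1"] by (simp add: qform_def)

text \<open>The expansion of the squared norm of a combination of sections minus \<open>l\<close>
  times the section at \<open>q\<close>. The point \<open>q\<close> may already belong to
  \<open>S\<close>, so the coefficients are written as a difference of two conditionals.\<close>

lemma qform_shift:
  assumes K: "\<And>s t. K s t = K t s" and S: "finite S"
  shows "qform K (insert q S) (\<lambda>x. (if x \<in> S then c x else 0) - (if x = q then l else 0))
     = qform K S c - 2 * l * (\<Sum>s\<in>S. c s * K s q) + l\<^sup>2 * K q q"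
proof -
  let ?c = "\<lambda>x. (if x \<in> S then c x else 0) - (if x = q then l else 0)"
  have h: "(\<Sum>x\<in>insert q S. ?c x * f x) = (\<Sum>x\<in>S. c x * f x) - l * f q" for f
  proof -
    have "(\<Sum>x\<in>insert q S. ?c x * f x) = (\<Sum>x\<in>insert q S. (if x \<in> S then c x else 0) * f x) - (\<Sum>x\<in>insert q S. (if x = q then l else 0) * f x)"
      by (simp add: left_diff_distrib sum_subtractf)
    also have "(\<Sum>x\<in>insert q S. (if x \<in> S then c x else 0) * f x) = (\<Sum>x\<in>S. c x * f x)"
      using S by (intro sum.mono_neutral_cong_right) auto
    also have "(\<Sum>x\<in>insert q S. (if x = q then l else 0) * f x) = l * f q"
      using S by (simp add: if_distribR if_distrib cong: if_cong)
    finally show ?thesis .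
  qed
  have "qform K (insert q S) ?c = (\<Sum>s\<in>insert q S. ?c s * (\<Sum>t\<in>insert q S. ?c t * K s t))"
    by (simp add: qform_def sum_distrib_left mult.assoc)
  also have "\<dots> = (\<Sum>s\<in>S. c s * (\<Sum>t\<in>S. c t * K s t)) - l * (\<Sum>s\<in>S. c s * K s q) - l * ((\<Sum>t\<in>S. c t * K q t) - l * K q q)"
    unfolding h by (simp add: right_diff_distrib sum_subtractf sum_distrib_left mult_ac)
  also have "(\<Sum>t\<in>S. c t * K q t) = (\<Sum>s\<in>S. c s * K s q)" using K by (intro sum.cong) auto
  also have "(\<Sum>s\<in>S. c s * (\<Sum>t\<in>S. c t * K s t)) = qform K S c"
    by (simp add: qform_def sum_distrib_left mult.assoc)
  finally show ?thesis by (simp add: algebra_simps power2_eq_square)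
qed

lemma psd_kernel_Cauchy_Schwarz:
  assumes "psd_kernel K"
  shows "(K s t)\<^sup>2 \<le> K s s * K t t"
proof (cases "s = t")
  case False
  have Q: "a\<^sup>2 * K s s + 2 * a * b * K s t + b\<^sup>2 * K t t \<ge> 0" for a b
    using psd_kernel_qform[OF assms, of "{s, t}" "\<lambda>x. if x = s then a else b"] False psd_kernel_sym[OF assms, of s t]
    by (simp add: qform_def power2_eq_square algebra_simps)
  show ?thesis
  proof (cases "K t t = 0")
    case True
    \<comment> \<open>With \<open>K t t = 0\<close> the form is linear in \<open>b\<close>. The
      choice b = K s s + 1 makes the mixed term outweigh the square of \<open>a\<close>, and the + 1
      keeps this true when \<open>K s s = 0\<close>.\<close>
    have "(K s t)\<^sup>2 * (K s s + 2) \<le> 0"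
      using Q[of "- K s t" "K s s + 1"] True by (simp add: power2_eq_square algebra_simps)
    then have "(K s t)\<^sup>2 \<le> 0" using psd_kernel_diag[OF assms, of s] by (simp add: mult_le_0_iff)
    then show ?thesis using True by simp
  next
    case False
    then have p: "K t t > 0" using psd_kernel_diag[OF assms, of t] by simp
    have "K t t * (K s s * K t t - (K s t)\<^sup>2) \<ge> 0"
      using Q[of "K t t" "- K s t"] by (simp add: power2_eq_square algebra_simps)
    then show ?thesis using p by (simp add: zero_le_mult_iff)
  qed
qed (simp add: power2_eq_square)

text \<open>The new form is the old one at the minimizing multiple l = B / K q q in
  \<open>qform_shift\<close>. If \<open>K q q = 0\<close>, all quotients are 0 and the form is
  unchanged.\<close>

lemma psd_kernel_schur_complement:
  assumes "psd_kernel K"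
  shows "psd_kernel (\<lambda>s t. K s t - K s q * K q t / K q q)"
  unfolding psd_kernel_def
proof (intro conjI allI impI)
  fix s t show "K s t - K s q * K q t / K q q = K t s - K t q * K q s / K q q"
    using psd_kernel_sym[OF assms] by (metis mult.commute)
next
  fix S c assume S: "finite (S :: 'a set)"
  define B where "B = (\<Sum>s\<in>S. c s * K s q)"
  have "qform (\<lambda>s t. K s t - K s q * K q t / K q q) S c = qform K S c - (\<Sum>s\<in>S. c s * K s q) * (\<Sum>t\<in>S. c t * K q t) / K q q"
    by (simp add: qform_def right_diff_distrib sum_subtractf sum_product sum_divide_distrib mult_ac)
  also have "(\<Sum>t\<in>S. c t * K q t) = B" unfolding B_def using psd_kernel_sym[OF assms] by (intro sum.cong) auto
  also have "qform K S c - (\<Sum>s\<in>S. c s * K s q) * B / K q q =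
      qform K S c - 2 * (B / K q q) * B + (B / K q q)\<^sup>2 * K q q"
    by (simp add: B_def[symmetric] power2_eq_square)
  also have "\<dots> = qform K (insert q S) (\<lambda>x. (if x \<in> S then c x else 0) - (if x = q then B / K q q else 0))"
    unfolding B_def using psd_kernel_sym[OF assms] S by (subst qform_shift) auto
  also have "\<dots> \<ge> 0" using S by (intro psd_kernel_qform[OF assms]) auto
  finally show "qform (\<lambda>s t. K s t - K s q * K q t / K q q) S c \<ge> 0" .
qed

text \<open>Gram--Schmidt in the reproducing kernel space: \<open>residual K q n\<close> is the kernel of the
  orthogonal complement of the sections at \<open>q 0, \<dots>, q (n - 1)\<close>. If a pivot vanishes, the division by
  zero leaves the kernel unchanged, as it should.\<close>

primrec residual :: "('a \<Rightarrow> 'a \<Rightarrow> real) \<Rightarrow> (nat \<Rightarrow> 'a) \<Rightarrow> nat \<Rightarrow> 'a \<Rightarrow> 'a \<Rightarrow> real" where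
  "residual K q 0 = K"
| "residual K q (Suc n) = (\<lambda>s t. residual K q n s t
     - residual K q n s (q n) * residual K q n (q n) t / residual K q n (q n) (q n))"

text \<open>The \<open>n\<close>-th coordinate of the section at \<open>t\<close> in the orthonormal
  system produced by Gram-Schmidt; it is 0 if the pivot vanishes.\<close>

definition feature :: "('a \<Rightarrow> 'a \<Rightarrow> real) \<Rightarrow> (nat \<Rightarrow> 'a) \<Rightarrow> 'a \<Rightarrow> nat \<Rightarrow> real" where
  "feature K q t n = residual K q n t (q n) / sqrt (residual K q n (q n) (q n))"

lemma psd_residual: "psd_kernel K \<Longrightarrow> psd_kernel (residual K q n)"
  by (induction n) (auto intro: psd_kernel_schur_complement)

lemma residual_eq:
  assumes "psd_kernel K"
  shows "K s t = (\<Sum>i<n. feature K q s i * feature K q t i) + residual K q n s t"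
proof (induction n)
  case (Suc n)
  have R: "psd_kernel (residual K q n)" by (rule psd_residual[OF assms])
  have "feature K q s n * feature K q t n = residual K q n s (q n) * residual K q n (q n) t / residual K q n (q n) (q n)"
    using psd_kernel_diag[OF R, of "q n"] psd_kernel_sym[OF R, of "q n" t]
    by (simp add: feature_def flip: real_sqrt_mult)
  then show ?case using Suc by simp
qed simp

lemma residual_pivot:
  assumes "psd_kernel K" "i < n"
  shows "residual K q n (q i) t = 0"
  using assms(2)
proof (induction n arbitrary: t)
  case (Suc n)
  have R: "psd_kernel (residual K q n)" by (rule psd_residual[OF assms(1)])
  show ?case
  proof (cases "i = n")
    case True
    \<comment> \<open>For a positive pivot the row cancels. For a zero pivot nothing is subtracted,
      but the Cauchy-Schwarz inequality shows that the row already vanishes.\<close>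
    show ?thesis
      using True psd_kernel_Cauchy_Schwarz[OF R, of "q n" t] by auto
  next
    case False
    then show ?thesis using Suc by simp
  qed
qed simp

text \<open>The residual kernel vanishes at \<open>q i\<close>, so the squared distance of the
  sections at \<open>t\<close> and \<open>q i\<close> splits into squared differences of features
  plus the residual at \<open>t\<close>.\<close>

lemma residual_diag_le:
  assumes "psd_kernel K" "i < n"
  shows "residual K q n t t \<le> K t t - 2 * K t (q i) + K (q i) (q i)"
proof -
  have R: "psd_kernel (residual K q n)" by (rule psd_residual[OF assms(1)])
  have z: "residual K q n (q i) t = 0" "residual K q n (q i) (q i) = 0" "residual K q n t (q i) = 0"
    using residual_pivot[OF assms] psd_kernel_sym[OF R, of t "q i"] by auto
  have "K t t - 2 * K t (q i) + K (q i) (q i) =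
     (\<Sum>j<n. (feature K q t j - feature K q (q i) j)\<^sup>2) + residual K q n t t"
    unfolding residual_eq[OF assms(1), of t t q n] residual_eq[OF assms(1), of t "q i" q n] residual_eq[OF assms(1), of "q i" "q i" q n] z
    by (simp add: power2_eq_square algebra_simps sum.distrib sum_subtractf sum_distrib_left)
  then show ?thesis by (simp add: sum_nonneg)
qed

text \<open>The expression is the squared distance, in the reproducing kernel space, of the sections
  at \<open>t\<close> and \<open>q i\<close>.\<close>

definition dense_for :: "('a \<Rightarrow> 'a \<Rightarrow> real) \<Rightarrow> (nat \<Rightarrow> 'a) \<Rightarrow> bool" where
  "dense_for K q \<longleftrightarrow> (\<forall>t. \<forall>e>0. \<exists>i. K t t - 2 * K t (q i) + K (q i) (q i) < e)"

lemma residual_diag_tendsto: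
  assumes "psd_kernel K" "dense_for K q"
  shows "(\<lambda>n. residual K q n t t) \<longlonglongrightarrow> 0"
proof (rule LIMSEQ_I)
  fix r :: real assume "r > 0"
  then obtain i where i: "K t t - 2 * K t (q i) + K (q i) (q i) < r"
    using assms(2) by (auto simp: dense_for_def)
  show "\<exists>no. \<forall>n\<ge>no. norm (residual K q n t t - 0) < r"
  proof (intro exI allI impI)
    fix n assume "Suc i \<le> n"
    then have "residual K q n t t < r" using residual_diag_le[OF assms(1), of i n q t] i by simp
    then show "norm (residual K q n t t - 0) < r"
      using psd_kernel_diag[OF psd_residual[OF assms(1)], of q n t] by simp
  qed
qed

lemma feature_sums:
  assumes "psd_kernel K" "dense_for K q"
  shows "(\<lambda>i. feature K q s i * feature K q t i) sums K s t"
proof -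
  have R: "psd_kernel (residual K q n)" for n by (rule psd_residual[OF assms(1)])
  have "(\<lambda>n. residual K q n s s * residual K q n t t) \<longlonglongrightarrow> 0 * 0"
    by (intro tendsto_mult residual_diag_tendsto assms)
  then have "(\<lambda>n. sqrt (residual K q n s s * residual K q n t t)) \<longlonglongrightarrow> sqrt 0"
    by (intro tendsto_real_sqrt) simp
  then have l: "(\<lambda>n. sqrt (residual K q n s s * residual K q n t t)) \<longlonglongrightarrow> 0" by simp
  have "\<bar>residual K q n s t\<bar> \<le> sqrt (residual K q n s s * residual K q n t t)" for n
    using real_sqrt_le_mono[OF psd_kernel_Cauchy_Schwarz[OF R[of n], of s t]] by simp
  then have "(\<lambda>n. residual K q n s t) \<longlonglongrightarrow> 0"
    by (intro Lim_null_comparison[OF _ l] always_eventually) simp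
  then have "(\<lambda>n. K s t - residual K q n s t) \<longlonglongrightarrow> K s t - 0" by (intro tendsto_diff tendsto_const)
  moreover have "K s t - residual K q n s t = (\<Sum>i<n. feature K q s i * feature K q t i)" for n
    using residual_eq[OF assms(1), of s t q n] by simp
  ultimately show ?thesis by (simp add: sums_def)
qed

lemma feature_square_sums:
  assumes "psd_kernel K" "dense_for K q"
  shows "(\<lambda>i. (feature K q t i)\<^sup>2) sums K t t"
  using feature_sums[OF assms, of t t] by (simp add: power2_eq_square)

text \<open>A function \<open>x\<close> of squared norm at most \<open>N\<close> in the reproducing kernel space of \<open>K\<close> is adjoined as
  one more point \<open>None\<close>, so that its coordinates come out of the same Gram--Schmidt process.\<close>

fun adjoin :: "('a \<Rightarrow> 'a \<Rightarrow> real) \<Rightarrow> ('a \<Rightarrow> real) \<Rightarrow> real \<Rightarrow> 'a option \<Rightarrow> 'a option \<Rightarrow> real" where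
  "adjoin K x N None None = N"
| "adjoin K x N None (Some t) = x t"
| "adjoin K x N (Some s) None = x s"
| "adjoin K x N (Some s) (Some t) = K s t"

text \<open>The hypothesis is the dual form of "squared norm at most N": twice the pairing of
  \<open>x\<close> with a combination of sections is at most the squared norm of the latter plus
  \<open>N\<close>. Applied to the coefficients - d / c0 it is, up to the factor c0^2, the
  nonnegativity of the enlarged form.\<close>

lemma psd_adjoin:
  assumes K: "psd_kernel K" and x: "\<And>S c. finite S \<Longrightarrow> 2 * (\<Sum>s\<in>S. c s * x s) \<le> qform K S c + N"
  shows "psd_kernel (adjoin K x N)"
  unfolding psd_kernel_def
proof (intro conjI allI impI)
  show "adjoin K x N s t = adjoin K x N t s" for s t
    using psd_kernel_sym[OF K] by (cases s; cases t) auto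
  fix S :: "'a option set" and c :: "'a option \<Rightarrow> real" assume S: "finite S"
  define T where "T = {t. Some t \<in> S}"
  define d where "d t = c (Some t)" for t
  define c0 where "c0 = (if None \<in> S then c None else 0)"
  have T: "finite T" unfolding T_def using S by (intro finite_vimageI[of S Some, unfolded vimage_def]) auto
  have sum: "(\<Sum>s\<in>S. c s * f s) = c0 * f None + (\<Sum>t\<in>T. d t * f (Some t))" for f
  proof -
    have "(\<Sum>s\<in>S. c s * f s) = (\<Sum>s\<in>insert None S. (if s \<in> S then c s else 0) * f s)"
      using S by (intro sum.mono_neutral_cong_left) auto
    also have "insert None S = insert None (Some ` T)"
    proof (rule set_eqI)
      fix s show "s \<in> insert None S \<longleftrightarrow> s \<in> insert None (Some ` T)"
        by (cases s) (auto simp: T_def)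
    qed
    also have "(\<Sum>s\<in>insert None (Some ` T). (if s \<in> S then c s else 0) * f s) = c0 * f None + (\<Sum>s\<in>Some ` T. (if s \<in> S then c s else 0) * f s)"
      using T by (subst sum.insert) (auto simp: c0_def)
    also have "(\<Sum>s\<in>Some ` T. (if s \<in> S then c s else 0) * f s) = (\<Sum>t\<in>T. d t * f (Some t))"
      by (subst sum.reindex) (auto simp: T_def d_def intro!: sum.cong)
    finally show ?thesis .
  qed
  have "qform (adjoin K x N) S c = (\<Sum>s\<in>S. c s * (\<Sum>t\<in>S. c t * adjoin K x N s t))"
    by (simp add: qform_def sum_distrib_left mult.assoc)
  also have "\<dots> = c0\<^sup>2 * N + 2 * c0 * (\<Sum>t\<in>T. d t * x t) + qform K T d"
    unfolding sum by (simp add: qform_def algebra_simps sum.distrib sum_distrib_left power2_eq_square)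
  also have "\<dots> \<ge> 0"
  proof (cases "c0 = 0")
    case True then show ?thesis using psd_kernel_qform[OF K T] by simp
  next
    case False
    have "2 * (\<Sum>s\<in>T. (- d s / c0) * x s) \<le> qform K T (\<lambda>s. - d s / c0) + N" by (rule x[OF T])
    moreover have "(\<Sum>s\<in>T. (- d s / c0) * x s) = - (\<Sum>s\<in>T. d s * x s) / c0"
      by (simp add: sum_negf sum_divide_distrib)
    moreover have "qform K T (\<lambda>s. - d s / c0) = qform K T d / c0\<^sup>2"
      by (simp add: qform_def sum_divide_distrib power2_eq_square)
    ultimately have "0 \<le> c0\<^sup>2 * (qform K T d / c0\<^sup>2 + N - 2 * (- (\<Sum>s\<in>T. d s * x s) / c0))"
      by simp
    also have "\<dots> = c0\<^sup>2 * N + 2 * c0 * (\<Sum>t\<in>T. d t * x t) + qform K T d"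
      using False by (simp add: field_simps power2_eq_square)
    finally show ?thesis .
  qed
  finally show "qform (adjoin K x N) S c \<ge> 0" .
qed

text \<open>\<open>None\<close> is never a pivot, so the features of \<open>K\<close> are unchanged,
  and the features of \<open>None\<close> are the coordinates of \<open>x\<close>. Their squares sum
  to at most \<open>N\<close>, and the Cauchy-Schwarz inequality for the residual kernel bounds the
  error of the expansion.\<close>

lemma rkhs_coefficients:
  assumes K: "psd_kernel K" and x: "\<And>S c. finite S \<Longrightarrow> 2 * (\<Sum>s\<in>S. c s * x s) \<le> qform K S c + N"
  obtains m where "\<And>n. (\<Sum>i<n. (m i)\<^sup>2) \<le> N"
    "\<And>n t. (x t - (\<Sum>i<n. feature K q t i * m i))\<^sup>2 \<le> N * residual K q n t t"
proof -
  let ?K = "adjoin K x N" and ?q = "Some \<circ> q"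
  have P: "psd_kernel ?K" by (rule psd_adjoin[OF K x])
  have R: "psd_kernel (residual ?K ?q n)" for n by (rule psd_residual[OF P])
  have r: "residual ?K ?q n (Some s) (Some t) = residual K q n s t" for n s t
    by (induction n arbitrary: s t) auto
  have f: "feature ?K ?q (Some t) i = feature K q t i" for t i by (simp add: feature_def r)
  define m where "m = feature ?K ?q None"
  have a: "(\<Sum>i<n. (m i)\<^sup>2) + residual ?K ?q n None None = N" for n
    using residual_eq[OF P, of None None ?q n] by (simp only: adjoin.simps m_def power2_eq_square)
  have N: "residual ?K ?q n None None \<le> N" for n using a[of n] sum_nonneg[of "{..<n}" "\<lambda>i. (m i)\<^sup>2"] by simp
  show ?thesis
  proof
    show "(\<Sum>i<n. (m i)\<^sup>2) \<le> N" for n using a[of n] psd_kernel_diag[OF R, of n None] by simp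
    fix n t
    have "x t - (\<Sum>i<n. feature K q t i * m i) = residual ?K ?q n (Some t) None"
      using residual_eq[OF P, of "Some t" None ?q n] by (simp add: f m_def)
    also have "\<dots>\<^sup>2 \<le> residual ?K ?q n (Some t) (Some t) * residual ?K ?q n None None"
      by (rule psd_kernel_Cauchy_Schwarz[OF R])
    also have "\<dots> \<le> residual K q n t t * N"
      unfolding r by (intro mult_left_mono N psd_kernel_diag psd_residual K)
    finally show "(x t - (\<Sum>i<n. feature K q t i * m i))\<^sup>2 \<le> N * residual K q n t t"
      by (simp add: mult.commute)
  qed
qed

section \<open>Operations that preserve positive semidefiniteness\<close>

lemma qform_cmult: "qform (\<lambda>s t. a * K s t) S c = a * qform K S c"
  by (simp add: qform_def sum_distrib_left mult_ac)

lemma qform_add: "qform (\<lambda>s t. K s t + K' s t) S c = qform K S c + qform K' S c"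
  by (simp add: qform_def sum.distrib algebra_simps)

lemma psd_kernel_zero: "psd_kernel (\<lambda>s t. 0)"
  by (simp add: psd_kernel_def qform_def)

lemma psd_kernel_one: "psd_kernel (\<lambda>s t. 1)"
proof -
  have "qform (\<lambda>s t. 1) S c = (\<Sum>s\<in>S. c s)\<^sup>2" for S and c :: "'a \<Rightarrow> real"
    by (simp add: qform_def power2_eq_square sum_product)
  then show ?thesis by (simp add: psd_kernel_def)
qed

lemma psd_kernel_add: "psd_kernel K \<Longrightarrow> psd_kernel K' \<Longrightarrow> psd_kernel (\<lambda>s t. K s t + K' s t)"
  by (simp add: psd_kernel_def qform_add)

lemma psd_kernel_cmult: "a \<ge> 0 \<Longrightarrow> psd_kernel K \<Longrightarrow> psd_kernel (\<lambda>s t. a * K s t)"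
  by (simp add: psd_kernel_def qform_cmult)

lemma psd_kernel_rank_one_mult:
  assumes "psd_kernel K"
  shows "psd_kernel (\<lambda>s t. f s * f t * K s t)"
proof -
  have "qform (\<lambda>s t. f s * f t * K s t) S c = qform K S (\<lambda>s. c s * f s)" for S c
    by (simp add: qform_def mult_ac)
  then show ?thesis using assms by (auto simp: psd_kernel_def mult_ac)
qed

lemma psd_kernel_limit:
  assumes K: "\<And>n. psd_kernel (K n)" and L: "\<And>s t. (\<lambda>n. K n s t) \<longlonglongrightarrow> L s t"
  shows "psd_kernel L"
  unfolding psd_kernel_def
proof (intro conjI allI impI)
  fix s t
  have "(\<lambda>n. K n s t) = (\<lambda>n. K n t s)" using psd_kernel_sym[OF K] by blast
  then show "L s t = L t s" using L[of s t] L[of t s] LIMSEQ_unique by metis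
next
  fix S :: "'a set" and c assume "finite S"
  have "(\<lambda>n. qform (K n) S c) \<longlonglongrightarrow> qform L S c"
    unfolding qform_def by (intro tendsto_intros L)
  then show "qform L S c \<ge> 0"
    by (rule LIMSEQ_le_const) (use psd_kernel_qform[OF K \<open>finite S\<close>] in blast)
qed

lemma psd_kernel_sums:
  assumes K: "\<And>n. psd_kernel (K n)" and L: "\<And>s t. (\<lambda>n. K n s t) sums L s t"
  shows "psd_kernel L"
proof (rule psd_kernel_limit)
  show "psd_kernel (\<lambda>s t. \<Sum>i<n. K i s t)" for n
    by (induction n) (auto intro: psd_kernel_zero psd_kernel_add K)
  show "(\<lambda>n. \<Sum>i<n. K i s t) \<longlonglongrightarrow> L s t" for s t using L by (simp add: sums_def)
qed

lemma psd_kernel_integral: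
  assumes K: "\<And>u. psd_kernel (K u)" and i: "\<And>s t. integrable M (\<lambda>u. K u s t)"
  shows "psd_kernel (\<lambda>s t. \<integral>u. K u s t \<partial>M)"
  unfolding psd_kernel_def
proof (intro conjI allI impI)
  show "(\<integral>u. K u s t \<partial>M) = (\<integral>u. K u t s \<partial>M)" for s t
    by (intro Bochner_Integration.integral_cong refl psd_kernel_sym[OF K])
  fix S :: "'b set" and c assume S: "finite S"
  have "qform (\<lambda>s t. \<integral>u. K u s t \<partial>M) S c = (\<integral>u. qform (K u) S c \<partial>M)"
    unfolding qform_def using i by simp
  also have "\<dots> \<ge> 0" using psd_kernel_qform[OF K S] by (intro integral_nonneg_AE) auto
  finally show "qform (\<lambda>s t. \<integral>u. K u s t \<partial>M) S c \<ge> 0" .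
qed

text \<open>Each term (s t)^n of the exponential series is a rank one kernel, and multiplication by
  a rank one kernel only rescales the coefficients of the form.\<close>

lemma psd_kernel_exp_product_mult:
  fixes H :: "real \<Rightarrow> real \<Rightarrow> real"
  assumes H: "psd_kernel H" and a: "a \<ge> 0"
  shows "psd_kernel (\<lambda>s t. exp (a * (s * t)) * H s t)"
proof (rule psd_kernel_sums)
  fix n
  have "psd_kernel (\<lambda>s t. (a ^ n / fact n) * (s ^ n * t ^ n * H s t))"
    by (rule psd_kernel_cmult[OF _ psd_kernel_rank_one_mult[OF H, of "\<lambda>s. s ^ n"]]) (use a in simp)
  then show "psd_kernel (\<lambda>s t. ((a * (s * t)) ^ n / fact n) * H s t)"
    by (simp add: power_mult_distrib mult_ac)
next
  fix s t show "(\<lambda>n. ((a * (s * t)) ^ n / fact n) * H s t) sums (exp (a * (s * t)) * H s t)"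
    using exp_converges[of "a * (s * t)"] by (intro sums_mult2) (simp add: divide_inverse mult.commute)
qed

text \<open>Expanding the square leaves a rank one factor and the exponential of 2 u s t. The factor
  \<open>H\<close> allows iteration, which later yields powers of mixtures of Gaussian
  kernels.\<close>

lemma psd_kernel_gaussian_mult:
  fixes H :: "real \<Rightarrow> real \<Rightarrow> real"
  assumes H: "psd_kernel H" and u: "u \<ge> 0"
  shows "psd_kernel (\<lambda>s t. exp (- u * (s - t)\<^sup>2) * H s t)"
proof -
  have "psd_kernel (\<lambda>s t. exp (- u * s\<^sup>2) * exp (- u * t\<^sup>2) * (exp (2 * u * (s * t)) * H s t))"
    using u by (intro psd_kernel_rank_one_mult psd_kernel_exp_product_mult H) simp
  moreover have "exp (- u * s\<^sup>2) * exp (- u * t\<^sup>2) * (exp (2 * u * (s * t)) * H s t)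
      = exp (- u * (s - t)\<^sup>2) * H s t" for s t
    by (simp add: power2_eq_square algebra_simps flip: exp_add)
  ultimately show ?thesis by (simp only:)
qed

section \<open>Positive semidefiniteness of the power exponential covariance\<close>

lemma integrable_powr_from_0:
  assumes "a > -1" "c \<ge> 0"
  shows "integrable lborel (\<lambda>x. indicator {0..c} x * x powr a :: real)"
proof (rule integrableI_nonneg)
  have "(\<integral>\<^sup>+x. ennreal (indicator {0..c} x * x powr a) \<partial>lborel) = ennreal (c powr (a + 1) / (a + 1))"
    using nn_integral_has_integral_lebesgue[OF _ has_integral_powr_from_0[OF assms]] by simp
  then show "(\<integral>\<^sup>+x. ennreal (indicator {0..c} x * x powr a) \<partial>lborel) < \<infinity>" by simp
qed auto

lemma integrable_powr_to_inf:
  assumes "e < -1" "a > 0"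
  shows "integrable lborel (\<lambda>x. indicator {a..} x * x powr e :: real)"
proof (rule integrableI_nonneg)
  have "(\<integral>\<^sup>+x. ennreal (indicator {a..} x * x powr e) \<partial>lborel) = ennreal (-(a powr (e + 1)) / (e + 1))"
    using nn_integral_has_integral_lebesgue[OF _ has_integral_powr_to_inf[OF assms]] by simp
  then show "(\<integral>\<^sup>+x. ennreal (indicator {a..} x * x powr e) \<partial>lborel) < \<infinity>" by simp
qed auto

text \<open>Used with p = \<delta> / 2 and x = (s - t)^2, where exp (- u x) is a Gaussian kernel. Up
  to a factor, u^(- 1 - p) is the Levy density of the p-stable subordinator.\<close>

definition bernstein_integrand :: "real \<Rightarrow> real \<Rightarrow> real \<Rightarrow> real" where
  "bernstein_integrand p x u = indicator {0<..} u * ((1 - exp (- u * x)) * u powr (- 1 - p))"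

lemma bernstein_integrand_nonneg: "x \<ge> 0 \<Longrightarrow> bernstein_integrand p x u \<ge> 0"
  by (auto simp: bernstein_integrand_def indicator_def)

lemma bernstein_integrand_measurable[measurable]: "bernstein_integrand p x \<in> borel_measurable borel"
  unfolding bernstein_integrand_def by measurable

lemma integrable_bernstein_integrand:
  assumes p: "0 < p" "p < 1" and x: "x \<ge> 0"
  shows "integrable lborel (bernstein_integrand p x)"
proof (rule Bochner_Integration.integrable_bound)
  show "integrable lborel (\<lambda>u. x * (indicator {0..1} u * u powr (- p)) + indicator {1..} u * u powr (- 1 - p))"
    using p by (intro Bochner_Integration.integrable_add integrable_mult_right
      integrable_powr_from_0 integrable_powr_to_inf) auto
  show "AE u in lborel. norm (bernstein_integrand p x u)
     \<le> norm (x * (indicator {0..1} u * u powr (- p)) + indicator {1..} u * u powr (- 1 - p))"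
  proof (intro AE_I2)
    fix u :: real
    have "bernstein_integrand p x u \<le> x * (indicator {0..1} u * u powr (- p)) + indicator {1..} u * u powr (- 1 - p)"
    proof (cases "0 < u")
      case True
      show ?thesis
      proof (cases "u < 1")
        case t: True
        have "1 - exp (- u * x) \<le> u * x" using exp_ge_add_one_self[of "- u * x"] by simp
        then have "(1 - exp (- u * x)) * u powr (- 1 - p) \<le> u * x * u powr (- 1 - p)"
          by (intro mult_right_mono) auto
        also have "\<dots> = x * u powr (- p)"
          using True powr_mult_base[of u "- 1 - p"] by (simp add: mult_ac)
        finally show ?thesis using True t by (simp add: bernstein_integrand_def)
      next
        case False
        have "(1 - exp (- u * x)) * u powr (- 1 - p) \<le> 1 * u powr (- 1 - p)"
          by (intro mult_right_mono) auto
        then have "bernstein_integrand p x u \<le> u powr (- 1 - p)" using True by (simp add: bernstein_integrand_def)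
        moreover have "0 \<le> x * (indicator {0..1} u * u powr (- p))" using x by simp
        ultimately show ?thesis using False by simp
      qed
    next
      case False
      then show ?thesis using x by (simp add: bernstein_integrand_def)
    qed
    then show "norm (bernstein_integrand p x u)
     \<le> norm (x * (indicator {0..1} u * u powr (- p)) + indicator {1..} u * u powr (- 1 - p))"
      using bernstein_integrand_nonneg[OF x, of p u] by simp
  qed
qed simp

text \<open>The subordination \<open>x powr p = c * \<integral> (1 - exp (- u * x)) * u powr (- 1 - p) du\<close>.\<close>

lemma integral_bernstein_integrand:
  assumes p: "0 < p" "p < 1" and x: "x \<ge> 0"
  shows "(\<integral>u. bernstein_integrand p x u \<partial>lborel) = x powr p * (\<integral>u. bernstein_integrand p 1 u \<partial>lborel)"
proof (cases "x = 0")
  case False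
  then have x: "x > 0" using x by simp
  have "(\<integral>u. bernstein_integrand p x u \<partial>lborel) = \<bar>1 / x\<bar> *\<^sub>R (\<integral>v. bernstein_integrand p x (0 + (1 / x) * v) \<partial>lborel)"
    using x by (intro lborel_integral_real_affine) simp
  also have "(\<lambda>v. bernstein_integrand p x (0 + (1 / x) * v)) = (\<lambda>v. x powr (1 + p) * bernstein_integrand p 1 v)"
  proof
    fix v
    have "(v / x) powr (- 1 - p) = x powr (1 + p) * v powr (- 1 - p)" if "v > 0"
      using x that by (simp add: powr_divide powr_diff powr_add powr_minus field_simps)
    then show "bernstein_integrand p x (0 + (1 / x) * v) = x powr (1 + p) * bernstein_integrand p 1 v"
      using x by (auto simp: bernstein_integrand_def indicator_def field_simps)
  qed
  also have "\<bar>1 / x\<bar> *\<^sub>R (\<integral>v. x powr (1 + p) * bernstein_integrand p 1 v \<partial>lborel)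
      = x powr p * (\<integral>v. bernstein_integrand p 1 v \<partial>lborel)"
    using x by (simp add: powr_add)
  finally show ?thesis .
qed (simp add: bernstein_integrand_def)

lemma integral_bernstein_integrand_pos:
  assumes p: "0 < p" "p < 1"
  shows "(\<integral>u. bernstein_integrand p 1 u \<partial>lborel) > 0"
proof -
  define c where "c = (1 - exp (- 1)) * 2 powr (- 1 - p)"
  have c: "c > 0" by (simp add: c_def)
  have "c = (\<integral>u. indicator {1..2::real} u * c \<partial>lborel)" by simp
  also have "\<dots> \<le> (\<integral>u. bernstein_integrand p 1 u \<partial>lborel)"
  proof (rule integral_mono)
    show "integrable lborel (bernstein_integrand p 1)" using p by (intro integrable_bernstein_integrand) auto
    show "integrable lborel (\<lambda>u. indicator {1..2::real} u * c)"
      by (intro integrable_mult_left integrable_real_indicator) auto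
    fix u :: real
    have "c \<le> (1 - exp (- u)) * u powr (- 1 - p)" if "1 \<le> u" "u \<le> 2"
      unfolding c_def using that p by (intro mult_mono powr_mono2') auto
    then show "indicator {1..2} u * c \<le> bernstein_integrand p 1 u"
      using bernstein_integrand_nonneg[of 1 p u] by (auto simp: bernstein_integrand_def indicator_def)
  qed
  finally show ?thesis using c by simp
qed

text \<open>Schoenberg's argument: |t|^\<delta> is a mixture of the functions 1 - exp (- u t^2), so
  exp (- \<phi> |t|^\<delta>) is a limit of positive multiples of exponentials of Gaussian mixtures,
  and these expand into power series with positive coefficients.\<close>

theorem psd_power_exponential:
  assumes \<sigma>: "\<sigma>2 > 0" "\<phi> > 0" and \<delta>: "0 < \<delta>" "\<delta> < 2"
  shows "psd_kernel (\<lambda>s t. power_exponential \<sigma>2 \<phi> \<delta> (s - t))"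
proof -
  define p where "p = \<delta> / 2"
  have p: "0 < p" "p < 1" using \<delta> by (auto simp: p_def)
  define J where "J = (\<integral>u. bernstein_integrand p 1 u \<partial>lborel)"
  have J: "J > 0" unfolding J_def using p by (rule integral_bernstein_integrand_pos)
  \<comment> \<open>The density is not integrable at 0. Cutting it off there gives a finite total
    mass \<open>\<Lambda> n\<close>, which can be separated from the Gaussian mixture
    \<open>G n\<close>.\<close>
  define w where "w n u = indicator {1 / real (Suc n)..} u * u powr (- 1 - p)" for n and u :: real
  have iw: "integrable lborel (w n)" for n
    unfolding w_def using p by (intro integrable_powr_to_inf) auto
  have w0: "w n u \<ge> 0" and wu: "w n u \<noteq> 0 \<Longrightarrow> u > 0" for n u
    by (auto simp: w_def indicator_def split: if_splits intro: less_le_trans[of 0 "1 / real (Suc n)"])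
  define G where "G n s t = (\<integral>u. w n u * exp (- u * (s - t)\<^sup>2) \<partial>lborel)" for n s t
  have iG: "integrable lborel (\<lambda>u. w n u * exp (- u * x))" if "x \<ge> 0" for n x
  proof (rule Bochner_Integration.integrable_bound[OF iw[of n]])
    show "AE u in lborel. norm (w n u * exp (- u * x)) \<le> norm (w n u)"
    proof (intro AE_I2)
      fix u show "norm (w n u * exp (- u * x)) \<le> norm (w n u)"
      proof (cases "w n u = 0")
        case False
        then have "exp (- u * x) \<le> 1" using wu[OF False] that by simp
        then show ?thesis using w0[of n u] by (simp add: mult_left_le)
      qed simp
    qed
  qed (simp add: w_def)
  \<comment> \<open>Multiplication by \<open>G n\<close> can be repeated, which gives all powers of
    \<open>G n\<close> and hence its exponential.\<close>
  have Gmult: "psd_kernel (\<lambda>s t. G n s t * H s t)" if H: "psd_kernel H" for n H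
  proof -
    have "psd_kernel (\<lambda>s t. \<integral>u. w n u * (exp (- u * (s - t)\<^sup>2) * H s t) \<partial>lborel)"
    proof (rule psd_kernel_integral)
      fix u
      show "psd_kernel (\<lambda>s t. w n u * (exp (- u * (s - t)\<^sup>2) * H s t))"
      proof (cases "w n u = 0")
        case False
        then show ?thesis using w0[of n u] wu[OF False]
          by (intro psd_kernel_cmult psd_kernel_gaussian_mult H) auto
      qed (simp add: psd_kernel_zero)
    next
      fix s t show "integrable lborel (\<lambda>u. w n u * (exp (- u * (s - t)\<^sup>2) * H s t))"
        using integrable_mult_left[OF iG[of "(s - t)\<^sup>2" n], of "H s t"] by (simp add: mult_ac)
    qed
    moreover have "(\<integral>u. w n u * (exp (- u * (s - t)\<^sup>2) * H s t) \<partial>lborel) = G n s t * H s t" for s t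
      unfolding G_def by (simp flip: mult.assoc)
    ultimately show ?thesis by simp
  qed
  define a where "a = \<phi> / J"
  have a: "a > 0" using J \<sigma> by (simp add: a_def)
  have expG: "psd_kernel (\<lambda>s t. exp (a * G n s t))" for n
  proof (rule psd_kernel_sums)
    fix k
    have "psd_kernel (\<lambda>s t. G n s t ^ k)"
      by (induction k) (auto intro: psd_kernel_one Gmult)
    then have "psd_kernel (\<lambda>s t. (a ^ k / fact k) * G n s t ^ k)" using a by (intro psd_kernel_cmult) auto
    then show "psd_kernel (\<lambda>s t. (a * G n s t) ^ k / fact k)" by (simp add: power_mult_distrib)
    show "(\<lambda>k. (a * G n s t) ^ k / fact k) sums exp (a * G n s t)" for s t
      using exp_converges[of "a * G n s t"] by (simp add: divide_inverse mult.commute)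
  qed
  define \<Lambda> where "\<Lambda> n = (\<integral>u. w n u \<partial>lborel)" for n
  have psd: "psd_kernel (\<lambda>s t. \<sigma>2 * (exp (- a * \<Lambda> n) * exp (a * G n s t)))" for n
    using \<sigma> by (intro psd_kernel_cmult expG) auto
  show ?thesis
  proof (rule psd_kernel_limit[OF psd])
    fix s t :: real
    define x where "x = (s - t)\<^sup>2"
    have x: "x \<ge> 0" by (simp add: x_def)
    have "(\<lambda>n. \<integral>u. w n u * (1 - exp (- u * x)) \<partial>lborel) \<longlonglongrightarrow> (\<integral>u. bernstein_integrand p x u \<partial>lborel)"
    proof (rule integral_dominated_convergence)
      show "integrable lborel (bernstein_integrand p x)" by (rule integrable_bernstein_integrand[OF p x])
      show "AE u in lborel. (\<lambda>n. w n u * (1 - exp (- u * x))) \<longlonglongrightarrow> bernstein_integrand p x u"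
      proof (intro AE_I2)
        fix u :: real
        show "(\<lambda>n. w n u * (1 - exp (- u * x))) \<longlonglongrightarrow> bernstein_integrand p x u"
        proof (cases "u > 0")
          case True
          then obtain N where N: "1 / real (Suc N) < u" using nat_approx_posE by blast
          have "w n u * (1 - exp (- u * x)) = bernstein_integrand p x u" if "n \<ge> N" for n
          proof -
            have "1 / real (Suc n) \<le> 1 / real (Suc N)" using that by (simp add: frac_le)
            then show ?thesis using N True by (simp add: w_def bernstein_integrand_def)
          qed
          then show ?thesis by (intro tendsto_eventually) (auto simp: eventually_sequentially)
        next
          case False
          then have "w n u = 0" for n using wu[of n u] by blast
          then show ?thesis using False by (simp add: bernstein_integrand_def)
        qed
      qed
      show "AE u in lborel. norm (w n u * (1 - exp (- u * x))) \<le> bernstein_integrand p x u" for n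
      proof (intro AE_I2)
        fix u show "norm (w n u * (1 - exp (- u * x))) \<le> bernstein_integrand p x u"
        proof (cases "w n u = 0")
          case False
          then show ?thesis using wu[OF False] x
            by (auto simp: w_def bernstein_integrand_def indicator_def abs_mult)
        qed (simp add: bernstein_integrand_nonneg[OF x])
      qed
    qed (auto simp: w_def)
    also have "(\<integral>u. bernstein_integrand p x u \<partial>lborel) = x powr p * J"
      unfolding J_def by (rule integral_bernstein_integrand[OF p x])
    also have "x powr p = \<bar>s - t\<bar> powr \<delta>"
      using powr_powr[of "\<bar>s - t\<bar>" 2 p] by (cases "s = t") (auto simp: x_def p_def)
    finally have "(\<lambda>n. \<sigma>2 * exp (- a * (\<integral>u. w n u * (1 - exp (- u * x)) \<partial>lborel)))
       \<longlonglongrightarrow> \<sigma>2 * exp (- a * (\<bar>s - t\<bar> powr \<delta> * J))" by (intro tendsto_intros)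
    moreover have "- a * (\<bar>s - t\<bar> powr \<delta> * J) = - \<phi> * \<bar>s - t\<bar> powr \<delta>" using J by (simp add: a_def)
    ultimately have l: "(\<lambda>n. \<sigma>2 * exp (- a * (\<integral>u. w n u * (1 - exp (- u * x)) \<partial>lborel)))
       \<longlonglongrightarrow> power_exponential \<sigma>2 \<phi> \<delta> (s - t)" by (simp only: power_exponential_def)
    have "(\<integral>u. w n u * (1 - exp (- u * x)) \<partial>lborel) = \<Lambda> n - G n s t" for n
      unfolding \<Lambda>_def G_def x_def[symmetric] using iw iG[OF x] by (simp add: right_diff_distrib)
    then have "\<sigma>2 * (exp (- a * \<Lambda> n) * exp (a * G n s t)) =
        \<sigma>2 * exp (- a * (\<integral>u. w n u * (1 - exp (- u * x)) \<partial>lborel))" for n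
      by (simp only: right_diff_distrib) (simp flip: exp_add)
    then show "(\<lambda>n. \<sigma>2 * (exp (- a * \<Lambda> n) * exp (a * G n s t))) \<longlonglongrightarrow> power_exponential \<sigma>2 \<phi> \<delta> (s - t)"
      using l by (simp only:)
  qed
qed

text \<open>Away from the origin the second difference is O(h^2), whereas at the origin it is of the
  larger order h^\<delta>; this contrast isolates one coefficient of a null vector. Negative
  arguments reduce to positive ones by evenness.\<close>

lemma power_exponential_second_difference_off_zero:
  assumes "x \<noteq> 0"
  shows "\<exists>M. \<forall>\<^sub>F h in at_right 0. \<bar>2 * power_exponential \<sigma>2 \<phi> \<delta> x
     - power_exponential \<sigma>2 \<phi> \<delta> (x + h) - power_exponential \<sigma>2 \<phi> \<delta> (x - h)\<bar> \<le> M * h\<^sup>2"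
proof -
  let ?K = "power_exponential \<sigma>2 \<phi> \<delta>"
  have pos: "\<exists>M. \<forall>\<^sub>F h in at_right 0. \<bar>2 * ?K x - ?K (x + h) - ?K (x - h)\<bar> \<le> M * h\<^sup>2" if x: "x > 0" for x
  proof -
    have "continuous_on {x/2..2*x} (pe_deriv2 \<sigma>2 \<phi> \<delta>)"
      unfolding pe_deriv2_def using x by (intro continuous_intros) auto
    then have "compact (pe_deriv2 \<sigma>2 \<phi> \<delta> ` {x/2..2*x})" by (intro compact_continuous_image) auto
    then obtain M where "\<forall>y\<in>pe_deriv2 \<sigma>2 \<phi> \<delta> ` {x/2..2*x}. \<bar>y\<bar> \<le> M"
      using compact_imp_bounded[of "pe_deriv2 \<sigma>2 \<phi> \<delta> ` {x/2..2*x}"] unfolding bounded_iff real_norm_def by blast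
    then have M: "\<bar>pe_deriv2 \<sigma>2 \<phi> \<delta> y\<bar> \<le> M" if "y \<in> {x/2..2*x}" for y using that by blast
    have "\<forall>\<^sub>F h in at_right 0. h \<in> {0<..<x/2}" using x by (intro eventually_at_right_real) auto
    then have "\<forall>\<^sub>F h in at_right 0. \<bar>2 * ?K x - ?K (x + h) - ?K (x - h)\<bar> \<le> 2 * M * h\<^sup>2"
    proof eventually_elim
      case (elim h)
      show ?case
      proof (rule second_difference_mvt)
        show "h > 0" using elim by simp
        fix t assume "x - h \<le> t" "t \<le> x + h"
        then have "t > 0" "t \<in> {x/2..2*x}" using elim x by auto
        then show "(?K has_real_derivative pe_deriv1 \<sigma>2 \<phi> \<delta> t) (at t) \<and>
          (pe_deriv1 \<sigma>2 \<phi> \<delta> has_real_derivative pe_deriv2 \<sigma>2 \<phi> \<delta> t) (at t) \<and> \<bar>pe_deriv2 \<sigma>2 \<phi> \<delta> t\<bar> \<le> M"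
          using power_exponential_DERIV M by blast
      qed
    qed
    then show ?thesis by blast
  qed
  show ?thesis
  proof (cases "x > 0")
    case False
    then have "- x > 0" using assms by simp
    moreover have "?K (- x + h) = ?K (x - h)" "?K (- x - h) = ?K (x + h)" for h
    proof -
      have "- x + h = - (x - h)" "- x - h = - (x + h)" by simp_all
      then show "?K (- x + h) = ?K (x - h)" "?K (- x - h) = ?K (x + h)"
        by (simp_all only: power_exponential_even)
    qed
    ultimately show ?thesis
      using pos[of "- x"] by (simp only: power_exponential_even simp_thms cancel_ab_semigroup_add_class.diff_right_commute[of "2 * ?K x"] True_implies_equals)
  qed (rule pos)
qed

text \<open>A null vector \<open>c\<close> would make \<open>\<Sum>\<^sub>s c s * K (s - r)\<close> vanish for every \<open>r\<close>; near \<open>r = s\<^sub>0\<close> only one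
  term of this sum fails to be twice differentiable.\<close>

theorem power_exponential_strict:
  assumes \<sigma>: "\<sigma>2 > 0" "\<phi> > 0" and \<delta>: "0 < \<delta>" "\<delta> < 2"
    and psd: "psd_kernel (\<lambda>s t. power_exponential \<sigma>2 \<phi> \<delta> (s - t))"
    and S: "finite S" "s0 \<in> S" "c s0 \<noteq> 0"
  shows "qform (\<lambda>s t. power_exponential \<sigma>2 \<phi> \<delta> (s - t)) S c > 0"
proof (rule ccontr)
  define K where "K = power_exponential \<sigma>2 \<phi> \<delta>"
  note psd = psd[folded K_def]
  assume "\<not> ?thesis"
  then have q0: "qform (\<lambda>s t. K (s - t)) S c = 0"
    using psd_kernel_qform[OF psd S(1), of c] by (simp add: K_def)
  have K0: "K 0 > 0" using \<sigma> \<delta> by (simp add: K_def power_exponential_def)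
  have B: "(\<Sum>s\<in>S. c s * K (s - r)) = 0" for r
  proof -
    \<comment> \<open>The form is tested with \<open>c\<close> minus the minimizing multiple B / K 0
      at \<open>r\<close>; as \<open>c\<close> is a null vector, the value is - B^2 / K 0, which
      must be nonnegative.\<close>
    define B where "B = (\<Sum>s\<in>S. c s * K (s - r))"
    have "0 \<le> qform (\<lambda>s t. K (s - t)) (insert r S) (\<lambda>x. (if x \<in> S then c x else 0) - (if x = r then B / K 0 else 0))"
      using S by (intro psd_kernel_qform[OF psd]) auto
    also have "\<dots> = - 2 * (B / K 0) * B + (B / K 0)\<^sup>2 * K 0"
      using S psd_kernel_sym[OF psd] by (subst qform_shift) (auto simp: q0 B_def)
    also have "\<dots> = - B\<^sup>2 / K 0" using K0 by (simp add: power2_eq_square field_simps)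
    finally have "B\<^sup>2 \<le> 0" using K0 by (simp add: zero_le_divide_iff divide_le_0_iff)
    then show ?thesis by (simp add: B_def[symmetric])
  qed
  define d where "d s h = 2 * K (s - s0) - K (s - s0 + h) - K (s - s0 - h)" for s h
  have sum0: "(\<Sum>s\<in>S. c s * d s h) = 0" for h
  proof -
    have "(\<Sum>s\<in>S. c s * d s h) = 2 * (\<Sum>s\<in>S. c s * K (s - s0)) - (\<Sum>s\<in>S. c s * K (s - (s0 - h))) - (\<Sum>s\<in>S. c s * K (s - (s0 + h)))"
      by (simp add: d_def algebra_simps sum_subtractf sum_distrib_left sum.distrib)
    then show ?thesis by (simp add: B)
  qed
  have "\<exists>M. \<forall>\<^sub>F h in at_right 0. \<bar>d s h\<bar> \<le> M * h\<^sup>2" if "s \<in> S - {s0}" for s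
    unfolding d_def K_def using that by (intro power_exponential_second_difference_off_zero) auto
  then obtain M where M: "\<And>s. s \<in> S - {s0} \<Longrightarrow> \<forall>\<^sub>F h in at_right 0. \<bar>d s h\<bar> \<le> M s * h\<^sup>2"
    by metis
  then have ev1: "\<forall>\<^sub>F h in at_right 0. \<forall>s\<in>S - {s0}. \<bar>d s h\<bar> \<le> M s * h\<^sup>2"
    using S by (intro eventually_ball_finite) auto
  define k where "k = (\<Sum>s\<in>S - {s0}. \<bar>c s\<bar> * M s)"
  have t: "((\<lambda>h. h powr e) \<longlongrightarrow> 0) (at_right (0::real))" if "e > 0" for e
  proof -
    have "((\<lambda>h. h powr e) \<longlongrightarrow> 0 powr e) (at_right 0)"
      using that by (intro tendsto_powr2 tendsto_intros) (auto simp: eventually_at_right_less eventually_mono[OF eventually_at_right_less])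
    then show ?thesis by simp
  qed
  have "((\<lambda>h. \<phi> * h powr \<delta>) \<longlongrightarrow> \<phi> * 0) (at_right 0)" by (intro tendsto_intros t \<delta>)
  then have ev2: "\<forall>\<^sub>F h in at_right 0. \<phi> * h powr \<delta> < 1" by (intro order_tendstoD(2)) auto
  have "((\<lambda>h. k * h powr (2 - \<delta>)) \<longlongrightarrow> k * 0) (at_right 0)" using \<delta> by (intro tendsto_intros t) auto
  then have ev3: "\<forall>\<^sub>F h in at_right 0. k * h powr (2 - \<delta>) < \<bar>c s0\<bar> * (\<sigma>2 * \<phi>)"
    using S \<sigma> by (intro order_tendstoD(2)) auto
  \<comment> \<open>For small \<open>h\<close> the term at \<open>s0\<close> has modulus at least |c
    s0| \<sigma>2 \<phi> h^\<delta>, and the others together at most k h^2. The event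
    \<open>ev3\<close> makes these incompatible, because \<delta> < 2.\<close>
  have "\<forall>\<^sub>F h in at_right (0::real). False"
    using ev1 ev2 ev3 eventually_at_right_less[of 0]
  proof eventually_elim
    case (elim h)
    have "c s0 * d s0 h = - (\<Sum>s\<in>S - {s0}. c s * d s h)"
      using sum0[of h] S by (simp add: sum.remove[of S s0])
    then have "\<bar>c s0\<bar> * \<bar>d s0 h\<bar> = \<bar>\<Sum>s\<in>S - {s0}. c s * d s h\<bar>" by (metis abs_minus_cancel abs_mult)
    also have "\<dots> \<le> (\<Sum>s\<in>S - {s0}. \<bar>c s\<bar> * (M s * h\<^sup>2))"
      using elim(1) by (intro order.trans[OF sum_abs] sum_mono) (auto simp: abs_mult intro!: mult_left_mono)
    also have "\<dots> = k * h\<^sup>2" unfolding k_def sum_distrib_right by (simp add: mult_ac)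
    also have "h\<^sup>2 = h powr (2 - \<delta>) * h powr \<delta>" using elim(4) by (simp flip: powr_add)
    also have "k * (h powr (2 - \<delta>) * h powr \<delta>) < \<bar>c s0\<bar> * (\<sigma>2 * \<phi>) * h powr \<delta>"
      using mult_strict_right_mono[OF elim(3), of "h powr \<delta>"] elim(4) by (simp add: mult_ac)
    also have "\<dots> = \<bar>c s0\<bar> * (2 * (\<sigma>2 * (\<phi> * h powr \<delta> / 2)))" by simp
    also have "\<dots> \<le> \<bar>c s0\<bar> * (2 * (\<sigma>2 * (1 - exp (- (\<phi> * h powr \<delta>)))))"
      using \<sigma> elim by (intro mult_left_mono one_minus_exp_ge) auto
    also have "2 * (\<sigma>2 * (1 - exp (- (\<phi> * h powr \<delta>)))) = d s0 h"
      using elim(4) \<delta> by (simp add: d_def K_def power_exponential_def right_diff_distrib)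
    also have "\<bar>c s0\<bar> * d s0 h \<le> \<bar>c s0\<bar> * \<bar>d s0 h\<bar>" by (intro mult_left_mono) auto
    finally show False by simp
  qed
  then show False by simp
qed

section \<open>A Sobolev bound for the reproducing kernel norm\<close>

lemma antiderivative_exists:
  fixes f :: "real \<Rightarrow> real"
  assumes "continuous_on UNIV f"
  shows "\<exists>F. \<forall>x. (F has_real_derivative f x) (at x)"
proof (intro exI allI)
  fix x :: real
  have "((\<lambda>u. LBINT y=ereal 0..ereal u. f y) has_vector_derivative f x) (at x within {-\<bar>x\<bar>-1..\<bar>x\<bar>+1})"
    using assms by (intro interval_integral_FTC2) (auto intro: continuous_on_subset)
  moreover have "at x within {-\<bar>x\<bar>-1..\<bar>x\<bar>+1} = at x"
    by (intro at_within_interior) auto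
  ultimately show "((\<lambda>u. LBINT y=ereal 0..ereal u. f y) has_real_derivative f x) (at x)"
    by (simp add: has_real_derivative_iff_has_vector_derivative)
qed

lemma
  fixes h :: "real \<Rightarrow> real"
  assumes "a \<le> b" and h: "\<And>r. a \<le> r \<Longrightarrow> r \<le> b \<Longrightarrow> isCont h r"
  shows integrable_Icc: "integrable lborel (\<lambda>r. indicator {a..b} r * h r)"
    and integral_Icc_FTC: "(\<And>r. a \<le> r \<Longrightarrow> r \<le> b \<Longrightarrow> (F has_real_derivative h r) (at r)) \<Longrightarrow>
      (\<integral>r. indicator {a..b} r * h r \<partial>lborel) = F b - F a"
proof -
  have "continuous_on {a..b} h" using h by (intro continuous_at_imp_continuous_on) auto
  then show "integrable lborel (\<lambda>r. indicator {a..b} r * h r)"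
    using borel_integrable_compact[of "{a..b}" h] by (simp add: mult.commute)
  assume "\<And>r. a \<le> r \<Longrightarrow> r \<le> b \<Longrightarrow> (F has_real_derivative h r) (at r)"
  then show "(\<integral>r. indicator {a..b} r * h r \<partial>lborel) = F b - F a"
    using integral_FTC_Icc_real[OF assms(1), of F h] h by (simp add: mult.commute)
qed

text \<open>The dyadic differences \<open>a r - a (2 * r)\<close> telescope, on average over the scale with respect
  to \<open>dr / r\<close>.\<close>

lemma dyadic_telescope:
  fixes a :: "real \<Rightarrow> real"
  assumes a: "\<And>r. r > 0 \<Longrightarrow> isCont a r" and \<epsilon>: "0 < \<epsilon>" "\<epsilon> < 1 / 2"
  shows "\<exists>\<xi>. \<epsilon> < \<xi> \<and> \<xi> < 2 * \<epsilon> \<and>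
    (\<integral>r. indicator {\<epsilon>..1} r * ((a r - a (2 * r)) / r) \<partial>lborel)
      + (\<integral>r. indicator {1..2} r * (a r / r) \<partial>lborel) - L * ln 2 = (a \<xi> - L) * \<epsilon> / \<xi>"
proof -
  \<comment> \<open>An antiderivative of a r / r. The limits \<epsilon> / 2 and 3 keep
    [\<epsilon>, 2] in the interior, where derivatives are two-sided.\<close>
  define b where "b r = integral {\<epsilon> / 2..r} (\<lambda>u. a u / u)" for r
  have b: "(b has_real_derivative a r / r) (at r)" if "\<epsilon> \<le> r" "r \<le> 2" for r
  proof -
    have "continuous_on {\<epsilon> / 2..3} (\<lambda>u. a u / u)"
      using \<epsilon> by (intro continuous_intros continuous_at_imp_continuous_on ballI a) auto
    then have "(b has_real_derivative a r / r) (at r within {\<epsilon> / 2..3})"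
      unfolding b_def using that \<epsilon> by (intro integral_has_real_derivative) auto
    moreover have "at r within {\<epsilon> / 2..3} = at r" using that \<epsilon> by (intro at_within_interior) auto
    ultimately show ?thesis by simp
  qed
  have "((\<lambda>r. b r - b (2 * r)) has_real_derivative (a r - a (2 * r)) / r) (at r)" if "\<epsilon> \<le> r" "r \<le> 1" for r
  proof -
    have "((\<lambda>r. b (2 * r)) has_real_derivative (a (2 * r) / (2 * r)) * 2) (at r)"
      using that \<epsilon> by (intro DERIV_chain2[of b _ "\<lambda>r. 2 * r"] b) (auto intro!: derivative_eq_intros)
    then have "((\<lambda>r. b r - b (2 * r)) has_real_derivative a r / r - (a (2 * r) / (2 * r)) * 2) (at r)"
      using that by (intro DERIV_diff b) auto
    then show ?thesis by (simp add: diff_divide_distrib)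
  qed
  then have 1: "(\<integral>r. indicator {\<epsilon>..1} r * ((a r - a (2 * r)) / r) \<partial>lborel) = (b 1 - b (2 * 1)) - (b \<epsilon> - b (2 * \<epsilon>))"
    using \<epsilon> by (intro integral_Icc_FTC[where F="\<lambda>r. b r - b (2 * r)"] continuous_intros a isCont_o2[of _ "\<lambda>r. 2 * r" a]) auto
  have 2: "(\<integral>r. indicator {1..2} r * (a r / r) \<partial>lborel) = b 2 - b 1"
    using \<epsilon> by (intro integral_Icc_FTC continuous_intros a b) auto
  \<comment> \<open>After cancellation the integral of a r / r over [\<epsilon>, 2 \<epsilon>] is
    left; subtracting L ln 2 centres it at \<open>L\<close>, and the mean value theorem evaluates it
    at one scale.\<close>
  have "((\<lambda>r. b r - L * ln r) has_real_derivative (a r / r - L * (1 / r))) (at r)" if "\<epsilon> \<le> r" "r \<le> 2 * \<epsilon>" for r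
    using that \<epsilon> by (intro DERIV_diff DERIV_cmult b DERIV_ln_divide) auto
  then obtain \<xi> where \<xi>: "\<epsilon> < \<xi>" "\<xi> < 2 * \<epsilon>"
      "(b (2 * \<epsilon>) - L * ln (2 * \<epsilon>)) - (b \<epsilon> - L * ln \<epsilon>) = (2 * \<epsilon> - \<epsilon>) * (a \<xi> / \<xi> - L * (1 / \<xi>))"
    using MVT2[of \<epsilon> "2 * \<epsilon>" "\<lambda>r. b r - L * ln r" "\<lambda>r. a r / r - L * (1 / r)"] \<epsilon> by auto
  have "ln (2 * \<epsilon>) = ln 2 + ln \<epsilon>" using \<epsilon> by (simp add: ln_mult)
  moreover have "(2 * \<epsilon> - \<epsilon>) * (a \<xi> / \<xi> - L * (1 / \<xi>)) = (a \<xi> - L) * \<epsilon> / \<xi>"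
    using \<xi> \<epsilon> by (simp add: field_simps)
  ultimately show ?thesis using \<xi> unfolding 1 2 by (intro exI[of _ \<xi>]) (auto simp: algebra_simps)
qed

definition boxcar :: "real set \<Rightarrow> (real \<Rightarrow> real) \<Rightarrow> real \<Rightarrow> real \<Rightarrow> real" where
  "boxcar S c r y = (\<Sum>s\<in>S. c s * indicator {s - r..s} y)"

text \<open>Windows of length \<open>r\<close> ending at \<open>s\<close> and \<open>t\<close>
  overlap in length max 0 (r - |s - t|), so the triangle kernel is a Gram matrix in L^2.\<close>

lemma integrable_boxcar_square: "finite S \<Longrightarrow> integrable lborel (\<lambda>y. (boxcar S c r y)\<^sup>2)"
  and integral_boxcar_square:
    "finite S \<Longrightarrow> (\<integral>y. (boxcar S c r y)\<^sup>2 \<partial>lborel) = qform (\<lambda>s t. max 0 (r - \<bar>s - t\<bar>)) S c"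
proof -
  assume S: "finite S"
  have e: "(boxcar S c r y)\<^sup>2 = (\<Sum>s\<in>S. \<Sum>t\<in>S. c s * c t * indicator ({s - r..s} \<inter> {t - r..t}) y)" for y
    by (simp add: boxcar_def power2_eq_square sum_product indicator_inter_arith mult_ac del: Int_atLeastAtMost)
  have em: "emeasure lborel ({s - r..s} \<inter> {t - r..t}) = ennreal (max 0 (r - \<bar>s - t\<bar>))" for s t
    by (auto simp: emeasure_lborel_Icc_eq max_def min_def abs_if)
  have i: "integrable lborel (indicator ({s - r..s} \<inter> {t - r..t}) :: real \<Rightarrow> real)" for s t
    using em by (intro integrable_real_indicator) auto
  have m: "measure lborel ({s - r..s} \<inter> {t - r..t}) = max 0 (r - \<bar>s - t\<bar>)" for s t
    by (rule measure_eq_emeasure_eq_ennreal[OF _ em]) simp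
  show "integrable lborel (\<lambda>y. (boxcar S c r y)\<^sup>2)" unfolding e using i by (auto simp del: Int_atLeastAtMost)
  show "(\<integral>y. (boxcar S c r y)\<^sup>2 \<partial>lborel) = qform (\<lambda>s t. max 0 (r - \<bar>s - t\<bar>)) S c"
    unfolding e qform_def using i by (simp add: m del: Int_atLeastAtMost)
qed

text \<open>For \<delta> < 1 both powers in the second derivative have positive coefficients, and
  the one more singular at 0 is kept.\<close>

lemma pe_deriv2_lower:
  assumes \<delta>: "0 < \<delta>" "\<delta> < 1" and r: "0 < r"
  shows "exp (- (r powr \<delta>)) * \<delta> * (1 - \<delta>) * r powr (\<delta> - 2) \<le> pe_deriv2 1 1 \<delta> r"
proof -
  have "exp (- (r powr \<delta>)) * (\<delta> * (1 - \<delta>) * r powr (\<delta> - 2)) \<le>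
      exp (- (r powr \<delta>)) * (\<delta>\<^sup>2 * r powr (2 * \<delta> - 2) + \<delta> * (1 - \<delta>) * r powr (\<delta> - 2))"
    using \<delta> by (intro mult_left_mono) auto
  then show ?thesis by (simp add: pe_deriv2_def algebra_simps)
qed

lemma pe_deriv2_pos:
  assumes \<delta>: "0 < \<delta>" "\<delta> < 1" and r: "0 < r"
  shows "pe_deriv2 1 1 \<delta> r > 0"
proof -
  have "0 < exp (- (r powr \<delta>)) * \<delta> * (1 - \<delta>) * r powr (\<delta> - 2)" using \<delta> r by simp
  then show ?thesis using pe_deriv2_lower[OF assms] by linarith
qed

lemma isCont_pe_deriv2: "r > 0 \<Longrightarrow> isCont (pe_deriv2 \<sigma>2 \<phi> \<delta>) r"
  unfolding pe_deriv2_def by (intro continuous_intros) auto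

lemma powr_at_0: "e > 0 \<Longrightarrow> (\<lambda>n. (1 / real (Suc n)) powr e) \<longlonglongrightarrow> 0"
proof -
  assume "e > 0"
  then have "(\<lambda>n. (1 / real (Suc n)) powr e) \<longlonglongrightarrow> 0 powr e"
    by (intro tendsto_powr2 LIMSEQ_Suc[OF lim_1_over_n] tendsto_const) auto
  then show ?thesis by simp
qed

text \<open>Polya's representation of a convex covariance.\<close>

lemma triangle_mixture:
  assumes \<delta>: "0 < \<delta>" "\<delta> < 1" and u: "u \<ge> 0"
  shows "(\<lambda>n. \<integral>r. indicator {1 / real (Suc n)..real n + 2} r * (pe_deriv2 1 1 \<delta> r * max 0 (r - u)) \<partial>lborel)
    \<longlonglongrightarrow> power_exponential 1 1 \<delta> u"
proof -
  let ?f = "power_exponential 1 1 \<delta>" and ?f' = "pe_deriv1 1 1 \<delta>" and ?f'' = "pe_deriv2 1 1 \<delta>"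
  \<comment> \<open>Integration by parts of the second derivative against r - u. The boundary term
    at infinity tends to 0, the one at r = u equals - f u.\<close>
  define H where "H r = (r - u) * ?f' r - ?f r" for r
  have dH: "(H has_real_derivative ?f'' r * (r - u)) (at r)" if "r > 0" for r
  proof -
    have "((\<lambda>r. (r - u) * ?f' r - ?f r) has_real_derivative (1 * ?f' r + ?f'' r * (r - u)) - ?f' r) (at r)"
      using that by (intro DERIV_diff DERIV_mult power_exponential_DERIV) (auto intro!: derivative_eq_intros)
    then show ?thesis by (simp add: H_def[abs_def])
  qed
  \<comment> \<open>The integrand vanishes below \<open>u\<close>; the maximum with 1 / (n + 1)
    keeps the lower limit positive when u = 0.\<close>
  define l where "l n = max (1 / real (Suc n)) u" for n
  have l0: "l n > 0" for n by (simp add: l_def less_max_iff_disj)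
  have I: "(\<integral>r. indicator {1 / real (Suc n)..real n + 2} r * (?f'' r * max 0 (r - u)) \<partial>lborel) = H (real n + 2) - H (l n)"
    if "u \<le> real n + 2" for n
  proof -
    have "indicator {1 / real (Suc n)..real n + 2} r * (?f'' r * max 0 (r - u)) = indicator {l n..real n + 2} r * (?f'' r * (r - u))" for r
      by (auto simp: l_def indicator_def max_def)
    then have "(\<integral>r. indicator {1 / real (Suc n)..real n + 2} r * (?f'' r * max 0 (r - u)) \<partial>lborel)
       = (\<integral>r. indicator {l n..real n + 2} r * (?f'' r * (r - u)) \<partial>lborel)" by (simp only:)
    also have "\<dots> = H (real n + 2) - H (l n)"
    proof (rule integral_Icc_FTC)
      have "1 / real (Suc n) \<le> real n + 2" by (simp add: field_simps)
      then show "l n \<le> real n + 2" using that by (simp add: l_def)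
      fix r assume "l n \<le> r"
      then have r: "r > 0" using l0[of n] by linarith
      show "isCont (\<lambda>r. ?f'' r * (r - u)) r" using r by (intro continuous_intros isCont_pe_deriv2)
      show "(H has_real_derivative ?f'' r * (r - u)) (at r)" using r by (rule dH)
    qed
    finally show ?thesis .
  qed
  have rf': "r * ?f' r = - \<delta> * (r powr \<delta> / exp (r powr \<delta>))" if "r > 0" for r
    using that powr_mult_base[of r "\<delta> - 1"] by (simp add: pe_deriv1_def exp_minus field_simps)
  have HT: "(\<lambda>n. H (real n + 2)) \<longlonglongrightarrow> 0"
  proof -
    have top: "filterlim (\<lambda>n. (real n + 2) powr \<delta>) at_top sequentially"
    proof -
      have "filterlim (\<lambda>n. 2 + real n) at_top sequentially"
        by (rule filterlim_tendsto_add_at_top[OF tendsto_const filterlim_real_sequentially])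
      then have "filterlim (\<lambda>n. exp (\<delta> * ln (2 + real n))) at_top sequentially"
        by (intro filterlim_compose[OF exp_at_top]
          filterlim_tendsto_pos_mult_at_top[OF tendsto_const \<delta>(1)] filterlim_compose[OF ln_at_top])
      then show ?thesis by (simp add: powr_def add.commute)
    qed
    have 1: "(\<lambda>n. - \<delta> * ((real n + 2) powr \<delta> / exp ((real n + 2) powr \<delta>))) \<longlonglongrightarrow> - \<delta> * 0"
      using filterlim_compose[OF tendsto_power_div_exp_0[of 1] top] by (intro tendsto_intros) simp
    have 2: "(\<lambda>n. exp (- ((real n + 2) powr \<delta>))) \<longlonglongrightarrow> 0"
      by (intro filterlim_compose[OF exp_at_bot] filterlim_compose[OF filterlim_uminus_at_bot_at_top top])
    have "(\<lambda>n. \<bar>- \<delta> * ((real n + 2) powr \<delta> / exp ((real n + 2) powr \<delta>))\<bar> + exp (- ((real n + 2) powr \<delta>))) \<longlonglongrightarrow> \<bar>- \<delta> * 0\<bar> + 0"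
      by (intro tendsto_add tendsto_rabs 1 2)
    then have 3: "(\<lambda>n. \<bar>- \<delta> * ((real n + 2) powr \<delta> / exp ((real n + 2) powr \<delta>))\<bar> + exp (- ((real n + 2) powr \<delta>))) \<longlonglongrightarrow> 0" by simp
    have ev: "\<forall>\<^sub>F n in sequentially. u \<le> real n" using eventually_ge_at_top[of "nat \<lceil>u\<rceil>"] by eventually_elim linarith
    show ?thesis
    proof (rule Lim_null_comparison[OF eventually_mono[OF ev] 3])
      fix n assume n: "u \<le> real n"
      define r where "r = real n + 2"
      have r: "r > 0" "0 \<le> r - u" "r - u \<le> r" using u n by (auto simp: r_def)
      have "norm (H r) \<le> \<bar>(r - u) * ?f' r\<bar> + \<bar>?f r\<bar>" by (simp add: H_def)
      also have "\<bar>(r - u) * ?f' r\<bar> \<le> \<bar>r * ?f' r\<bar>" using r by (simp add: abs_mult mult_right_mono)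
      also have "\<bar>?f r\<bar> = exp (- (r powr \<delta>))" using r by (simp add: power_exponential_def)
      finally show "norm (H (real n + 2)) \<le> \<bar>- \<delta> * ((real n + 2) powr \<delta> / exp ((real n + 2) powr \<delta>))\<bar> + exp (- ((real n + 2) powr \<delta>))"
        using rf'[OF r(1)] by (simp add: r_def)
    qed
  qed
  \<comment> \<open>For u > 0 the lower limit is eventually \<open>u\<close> itself. For u = 0 the
    extra term r f'(r) is of order r^\<delta> and vanishes in the limit.\<close>
  have Hl: "(\<lambda>n. H (l n)) \<longlonglongrightarrow> - ?f u"
  proof (cases "u = 0")
    case True
    have z: "(\<lambda>n. (1 / real (Suc n)) powr \<delta>) \<longlonglongrightarrow> 0" using \<delta>(1) by (rule powr_at_0)
    have "(\<lambda>n. - \<delta> * ((1 / real (Suc n)) powr \<delta> / exp ((1 / real (Suc n)) powr \<delta>)) - exp (- ((1 / real (Suc n)) powr \<delta>)))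
      \<longlonglongrightarrow> - \<delta> * (0 / exp 0) - exp (- 0)"
      by (intro tendsto_intros z) simp
    moreover have "H (l n) = - \<delta> * ((1 / real (Suc n)) powr \<delta> / exp ((1 / real (Suc n)) powr \<delta>)) - exp (- ((1 / real (Suc n)) powr \<delta>))" for n
      using rf'[of "1 / real (Suc n)"] True by (simp add: H_def l_def power_exponential_def max_def)
    ultimately show ?thesis using True \<delta> by (simp add: power_exponential_def)
  next
    case False
    then have "u > 0" using u by simp
    then obtain N where N: "1 / real (Suc N) < u" using nat_approx_posE by blast
    have "H (l n) = - ?f u" if "n \<ge> N" for n
    proof -
      have "1 / real (Suc n) \<le> 1 / real (Suc N)" using that by (simp add: frac_le)
      then have "l n = u" using N by (simp add: l_def)
      then show ?thesis by (simp add: H_def)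
    qed
    then show ?thesis by (intro tendsto_eventually) (auto simp: eventually_sequentially)
  qed
  have "(\<lambda>n. H (real n + 2) - H (l n)) \<longlonglongrightarrow> 0 - - ?f u" by (intro tendsto_diff HT Hl)
  then have lim: "(\<lambda>n. H (real n + 2) - H (l n)) \<longlonglongrightarrow> ?f u" by simp
  have ev: "\<forall>\<^sub>F n in sequentially. u \<le> real n + 2" using eventually_ge_at_top[of "nat \<lceil>u\<rceil>"] by eventually_elim linarith
  show ?thesis
    by (rule Lim_transform_eventually[OF lim eventually_mono[OF ev]]) (rule I[symmetric])
qed

lemma isCont_triangle_qform: "isCont (\<lambda>r. qform (\<lambda>s t. max 0 (r - \<bar>s - t\<bar>)) S c) r"
  unfolding qform_def by (intro continuous_intros)

lemma triangle_qform_nonneg: "finite S \<Longrightarrow> qform (\<lambda>s t. max 0 (r - \<bar>s - t\<bar>)) S c \<ge> 0"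
  by (subst integral_boxcar_square[symmetric]) auto

text \<open>Both the second derivative and the triangle form are nonnegative, so restricting the
  mixture to scales in [\<epsilon>, 2] can only decrease it.\<close>

lemma triangle_mixture_le:
  assumes \<delta>: "0 < \<delta>" "\<delta> < 1" and S: "finite S" and \<epsilon>: "0 < \<epsilon>" "\<epsilon> \<le> 2"
  shows "(\<integral>r. indicator {\<epsilon>..2} r * (pe_deriv2 1 1 \<delta> r * qform (\<lambda>s t. max 0 (r - \<bar>s - t\<bar>)) S c) \<partial>lborel)
     \<le> qform (\<lambda>s t. power_exponential 1 1 \<delta> (s - t)) S c"
proof -
  let ?f'' = "pe_deriv2 1 1 \<delta>" and ?Q = "\<lambda>r. qform (\<lambda>s t. max 0 (r - \<bar>s - t\<bar>)) S c"
  have p: "1 / real (Suc n) \<le> real n + 2" "0 < 1 / real (Suc n)" for n by (simp_all add: field_simps)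
  have pos: "r > 0" if "1 / real (Suc n) \<le> r" for r n using that p(2)[of n] by linarith
  have i: "integrable lborel (\<lambda>r. indicator {1 / real (Suc n)..real n + 2} r * (?f'' r * max 0 (r - u)))" for n u
    using p[of n] pos[of n] by (intro integrable_Icc continuous_intros isCont_pe_deriv2) auto
  have iQ: "integrable lborel (\<lambda>r. indicator {a..b} r * (?f'' r * ?Q r))" if "0 < a" "a \<le> b" for a b
    using that by (intro integrable_Icc continuous_intros isCont_pe_deriv2 isCont_triangle_qform) auto
  have e: "(\<integral>r. indicator {1 / real (Suc n)..real n + 2} r * (?f'' r * ?Q r) \<partial>lborel) =
     (\<Sum>s\<in>S. \<Sum>t\<in>S. c s * c t * (\<integral>r. indicator {1 / real (Suc n)..real n + 2} r * (?f'' r * max 0 (r - \<bar>s - t\<bar>)) \<partial>lborel))" for n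
  proof -
    have "indicator {1 / real (Suc n)..real n + 2} r * (?f'' r * ?Q r) =
      (\<Sum>s\<in>S. \<Sum>t\<in>S. c s * c t * (indicator {1 / real (Suc n)..real n + 2} r * (?f'' r * max 0 (r - \<bar>s - t\<bar>))))" for r
      by (simp add: qform_def sum_distrib_left mult_ac)
    then show ?thesis using i by simp
  qed
  have lim: "(\<lambda>n. \<integral>r. indicator {1 / real (Suc n)..real n + 2} r * (?f'' r * ?Q r) \<partial>lborel)
     \<longlonglongrightarrow> (\<Sum>s\<in>S. \<Sum>t\<in>S. c s * c t * power_exponential 1 1 \<delta> \<bar>s - t\<bar>)"
    unfolding e by (intro tendsto_intros triangle_mixture \<delta>) auto
  obtain N where N: "1 / real (Suc N) < \<epsilon>" using nat_approx_posE \<epsilon>(1) by blast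
  have "(\<integral>r. indicator {\<epsilon>..2} r * (?f'' r * ?Q r) \<partial>lborel) \<le> (\<Sum>s\<in>S. \<Sum>t\<in>S. c s * c t * power_exponential 1 1 \<delta> \<bar>s - t\<bar>)"
  proof (rule LIMSEQ_le_const[OF lim], intro exI allI impI)
    fix n assume "N \<le> n"
    then have "1 / real (Suc n) \<le> 1 / real (Suc N)" by (simp add: frac_le)
    then have n: "1 / real (Suc n) \<le> \<epsilon>" using N by simp
    show "(\<integral>r. indicator {\<epsilon>..2} r * (?f'' r * ?Q r) \<partial>lborel)
      \<le> (\<integral>r. indicator {1 / real (Suc n)..real n + 2} r * (?f'' r * ?Q r) \<partial>lborel)"
    proof (rule integral_mono[OF iQ[OF \<epsilon>] iQ[OF p(2,1)]])
      fix r
      have "?f'' r * ?Q r \<ge> 0" if "r > 0"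
        using pe_deriv2_pos[OF \<delta> that] triangle_qform_nonneg[OF S] by simp
      then show "indicator {\<epsilon>..2} r * (?f'' r * ?Q r) \<le> indicator {1 / real (Suc n)..real n + 2} r * (?f'' r * ?Q r)"
        using n pos[of n r] by (auto simp: indicator_def)
    qed
  qed
  also have "\<dots> = qform (\<lambda>s t. power_exponential 1 1 \<delta> (s - t)) S c"
    by (simp add: qform_def power_exponential_def)
  finally show ?thesis .
qed

definition shift_energy :: "(real \<Rightarrow> real) \<Rightarrow> real \<Rightarrow> real" where
  "shift_energy x r = (\<integral>y. (x y - x (y - r))\<^sup>2 \<partial>lborel)"

text \<open>Chosen so that \<open>polya_const \<delta> * r powr (\<delta> - 2)\<close> is a lower
  bound for the second derivative of the covariance on (0, 2].\<close>

definition polya_const :: "real \<Rightarrow> real" where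
  "polya_const \<delta> = exp (- (2 powr \<delta>)) * \<delta> * (1 - \<delta>)"

text \<open>A squared Slobodeckij norm of order (1 + \<delta>) / 2: the weight for order s is r^(- 1
  - 2 s). The denominator collects the constant of the lower bound for the Polya density and the
  factor ln 2 of the dyadic average.\<close>

definition sobolev_norm :: "real \<Rightarrow> (real \<Rightarrow> real) \<Rightarrow> real" where
  "sobolev_norm \<delta> x = ((\<integral>r. indicator {0<..1} r * (r powr (- 2 - \<delta>) * shift_energy x r) \<partial>lborel)
     + (\<integral>y. (x y)\<^sup>2 \<partial>lborel)) / (polya_const \<delta> * (ln 2)\<^sup>2)"

lemma shift_energy_measurable[measurable]:
  assumes [measurable]: "x \<in> borel_measurable borel"
  shows "shift_energy x \<in> borel_measurable borel"
  unfolding shift_energy_def by measurable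

lemma shift_energy_nonneg: "shift_energy x r \<ge> 0"
  by (simp add: shift_energy_def)

lemma integrable_compact_support:
  fixes f :: "real \<Rightarrow> real"
  assumes "continuous_on UNIV f" "\<And>y. \<bar>y\<bar> > R \<Longrightarrow> f y = 0"
  shows "integrable lborel f"
proof -
  have "integrable lborel (\<lambda>y. indicator {- \<bar>R\<bar>..\<bar>R\<bar>} y * f y)"
    using assms(1) by (intro integrable_Icc) (auto simp: continuous_on_eq_continuous_at)
  moreover have "indicator {- \<bar>R\<bar>..\<bar>R\<bar>} y * f y = f y" for y
  proof (cases "\<bar>y\<bar> > R")
    case False
    then have "- \<bar>R\<bar> \<le> y" "y \<le> \<bar>R\<bar>" by linarith+
    then show ?thesis by simp
  qed (simp add: assms(2))
  ultimately show ?thesis by simp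
qed

text \<open>The integrand is of order r^(e - 2 - \<delta>), which is integrable at 0 since e > 1 +
  \<delta>.\<close>

lemma integrable_weighted_shift_energy:
  assumes x: "continuous_on UNIV x" and e: "e > 1 + \<delta>"
    and A: "\<And>r. 0 < r \<Longrightarrow> r \<le> 1 \<Longrightarrow> shift_energy x r \<le> A * r powr e"
  shows "integrable lborel (\<lambda>r. indicator {0<..1} r * (r powr (- 2 - \<delta>) * shift_energy x r))"
proof (rule Bochner_Integration.integrable_bound)
  have [measurable]: "x \<in> borel_measurable borel" using x by (rule borel_measurable_continuous_onI)
  show "integrable lborel (\<lambda>r. A * (indicator {0..1} r * r powr (e - 2 - \<delta>)))"
    using e by (intro integrable_mult_right integrable_powr_from_0) auto
  show "(\<lambda>r. indicator {0<..1} r * (r powr (- 2 - \<delta>) * shift_energy x r)) \<in> borel_measurable lborel" by measurable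
  show "AE r in lborel. norm (indicator {0<..1} r * (r powr (- 2 - \<delta>) * shift_energy x r))
      \<le> norm (A * (indicator {0..1} r * r powr (e - 2 - \<delta>)))"
  proof (intro AE_I2)
    fix r :: real
    show "norm (indicator {0<..1} r * (r powr (- 2 - \<delta>) * shift_energy x r))
      \<le> norm (A * (indicator {0..1} r * r powr (e - 2 - \<delta>)))"
    proof (cases "0 < r \<and> r \<le> 1")
      case True
      have "r powr (- 2 - \<delta>) * shift_energy x r \<le> r powr (- 2 - \<delta>) * (A * r powr e)"
        using A True by (intro mult_left_mono) auto
      also have "\<dots> = A * r powr (e - 2 - \<delta>)"
        by (simp add: powr_add[symmetric] algebra_simps)
      finally show ?thesis using True shift_energy_nonneg[of x r] by simp
    qed simp
  qed
qed

lemma young_weighted: "0 < F \<Longrightarrow> 2 * (p * q) \<le> F * p\<^sup>2 + q\<^sup>2 / (F::real)"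
proof -
  assume F: "0 < F"
  have "0 \<le> (F * p - q)\<^sup>2 / F" using F by simp
  also have "\<dots> = F * p\<^sup>2 + q\<^sup>2 / F - 2 * (p * q)" using F by (simp add: power2_eq_square field_simps)
  finally show ?thesis by simp
qed

text \<open>The form dominates the integral over r in [\<epsilon>, 2] of the Polya density times the
  squared L^2 norm of the boxcar sum. The values \<open>x s\<close> are recovered from averages of
  \<open>x\<close> over windows, so the left side becomes an integral over r of L^2 pairings of
  boxcar sums with increments of \<open>x\<close> (r <= 1) or with \<open>x\<close> itself (1 <= r
  <= 2). Young's inequality, weighted by the Polya density, separates the factors. Small scales
  involve increments only, so the singular weight meets the shift energy.\<close>

theorem rkhs_norm_bound:
  assumes \<delta>: "0 < \<delta>" "\<delta> < 1" and x: "continuous_on UNIV x" "\<And>y. \<bar>y\<bar> > R \<Longrightarrow> x y = 0"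
    and e: "e > 1 + \<delta>" and A: "\<And>r. 0 < r \<Longrightarrow> r \<le> 1 \<Longrightarrow> shift_energy x r \<le> A * r powr e"
    and S: "finite S"
  shows "2 * (\<Sum>s\<in>S. c s * x s) \<le> qform (\<lambda>s t. power_exponential 1 1 \<delta> (s - t)) S c + sobolev_norm \<delta> x"
proof -
  let ?f'' = "pe_deriv2 1 1 \<delta>" and ?Q = "\<lambda>r. qform (\<lambda>s t. max 0 (r - \<bar>s - t\<bar>)) S c"
  define \<kappa> where "\<kappa> = polya_const \<delta> * (ln 2)\<^sup>2"
  have c0: "polya_const \<delta> > 0" using \<delta> by (simp add: polya_const_def)
  have \<kappa>: "\<kappa> > 0" using c0 by (simp add: \<kappa>_def)
  have low: "polya_const \<delta> * r powr (\<delta> - 2) \<le> ?f'' r" if "0 < r" "r \<le> 2" for r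
  proof -
    have "r powr \<delta> \<le> 2 powr \<delta>" using that \<delta> by (intro powr_mono2) auto
    then have "polya_const \<delta> * r powr (\<delta> - 2) \<le> exp (- (r powr \<delta>)) * \<delta> * (1 - \<delta>) * r powr (\<delta> - 2)"
      unfolding polya_const_def using \<delta> by (intro mult_right_mono) auto
    then show ?thesis using pe_deriv2_lower[OF \<delta> that(1)] by linarith
  qed
  obtain X where X: "\<And>y. (X has_real_derivative x y) (at y)"
    using antiderivative_exists[OF x(1)] by blast
  have cx: "isCont x y" for y using x(1) by (simp add: continuous_on_eq_continuous_at)
  have cX: "isCont X y" for y using X DERIV_isCont by blast
  \<comment> \<open>The average of \<open>x\<close> over \<open>{s - r..s}\<close>, which tends to
    \<open>x s\<close> as r decreases to 0.\<close>
  define a where "a s r = (X s - X (s - r)) / r" for s r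
  have ca: "isCont (a s) r" if "r > 0" for s r
    unfolding a_def[abs_def] using that by (intro continuous_intros isCont_o2[OF _ cX]) auto
  define P where "P r = (\<Sum>s\<in>S. c s * ((a s r - a s (2 * r)) / r))" for r
  define P' where "P' r = (\<Sum>s\<in>S. c s * (a s r / r))" for r
  have cP: "isCont P r" if "r > 0" for r
    unfolding P_def[abs_def] using that
    by (intro continuous_intros ca isCont_o2[of r "\<lambda>r. 2 * r" "a _"]) auto
  have cP': "isCont P' r" if "r > 0" for r
    unfolding P'_def[abs_def] using that by (intro continuous_intros ca) auto
  have ix2: "integrable lborel (\<lambda>y. (x y)\<^sup>2)"
    using x by (intro integrable_compact_support[of _ R] continuous_intros) auto
  have id2: "integrable lborel (\<lambda>y. (x y - x (y - r))\<^sup>2)" for r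
    using x by (intro integrable_compact_support[of _ "\<bar>R\<bar> + \<bar>r\<bar>"] continuous_intros
      continuous_on_compose2[OF x(1)]) (auto simp: x(2))
  have bsum: "(\<lambda>y. boxcar S c r y * z y) = (\<lambda>y. \<Sum>s\<in>S. c s * (indicator {s - r..s} y * z y))" for r z
    by (auto simp: boxcar_def sum_distrib_right mult.assoc)
  have step1: "2 / ln 2 * P r \<le> ?f'' r * ?Q r + r powr (- 2 - \<delta>) * shift_energy x r / \<kappa>"
    if r: "0 < r" "r \<le> 1" for r
  proof -
    have f: "?f'' r > 0" using pe_deriv2_pos[OF \<delta> r(1)] .
    let ?d = "\<lambda>y. x y - x (y - r)"
    have cd: "isCont ?d y" for y by (intro continuous_intros cx isCont_o2[OF _ cx])
    have dX: "((\<lambda>y. X y - X (y - r)) has_real_derivative ?d y) (at y)" for y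
      by (intro DERIV_diff X DERIV_shift[THEN iffD1, of _ _ _ "- r", simplified])
    \<comment> \<open>The averages over lengths r and 2 r differ by half the difference of the
      averages over two adjacent windows, that is, by an average of increments of \<open>x\<close>
      over step r.\<close>
    have I: "(\<integral>y. indicator {s - r..s} y * ?d y \<partial>lborel) = 2 * r * (a s r - a s (2 * r))" for s
    proof -
      have "(\<integral>y. indicator {s - r..s} y * ?d y \<partial>lborel) = (X s - X (s - r)) - (X (s - r) - X (s - r - r))"
        using r by (intro integral_Icc_FTC dX cd) auto
      also have "s - r - r = s - 2 * r" by simp
      also have "(X s - X (s - r)) - (X (s - r) - X (s - 2 * r)) = 2 * r * (a s r - a s (2 * r))"
        using r by (simp add: a_def field_simps)
      finally show ?thesis .
    qed
    have i: "integrable lborel (\<lambda>y. indicator {s - r..s} y * ?d y)" for s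
      using r by (intro integrable_Icc cd) auto
    have "(\<integral>y. boxcar S c r y * ?d y \<partial>lborel) = 2 * r\<^sup>2 * P r"
      unfolding bsum using i I r by (simp add: P_def sum_distrib_left power2_eq_square mult_ac)
    moreover have ib: "integrable lborel (\<lambda>y. boxcar S c r y * ?d y)" unfolding bsum using i by auto
    ultimately have "2 / ln 2 * P r = (\<integral>y. 2 * (boxcar S c r y * (?d y / (2 * r\<^sup>2 * ln 2))) \<partial>lborel)"
      using r by simp
    also have "\<dots> \<le> (\<integral>y. ?f'' r * (boxcar S c r y)\<^sup>2 + (?d y / (2 * r\<^sup>2 * ln 2))\<^sup>2 / ?f'' r \<partial>lborel)"
      using ib id2[of r] integrable_boxcar_square[OF S, of c r] f
      by (intro integral_mono young_weighted) (auto simp: power_divide)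
    also have "\<dots> = ?f'' r * ?Q r + shift_energy x r / ((2 * r\<^sup>2 * ln 2)\<^sup>2 * ?f'' r)"
      using id2[of r] integrable_boxcar_square[OF S, of c r] integral_boxcar_square[OF S, of c r]
      by (simp add: power_divide shift_energy_def)
    also have "shift_energy x r / ((2 * r\<^sup>2 * ln 2)\<^sup>2 * ?f'' r) \<le> shift_energy x r / (\<kappa> / r powr (- 2 - \<delta>))"
    proof (rule divide_left_mono)
      \<comment> \<open>The lower bound on the Polya density turns r^(-4) divided by it into the
        weight r^(- 2 - \<delta>); a factor 4 is given away.\<close>
      have "\<kappa> / r powr (- 2 - \<delta>) = (r\<^sup>2 * ln 2)\<^sup>2 * (polya_const \<delta> * r powr (\<delta> - 2))"
        using r by (simp add: \<kappa>_def powr_diff powr_minus power2_eq_square field_simps)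
      also have "\<dots> \<le> (2 * r\<^sup>2 * ln 2)\<^sup>2 * ?f'' r"
        using r c0 by (intro mult_mono low power_mono) auto
      finally show "\<kappa> / r powr (- 2 - \<delta>) \<le> (2 * r\<^sup>2 * ln 2)\<^sup>2 * ?f'' r" .
    qed (use r f \<kappa> shift_energy_nonneg in auto)
    finally show ?thesis by (simp add: mult.commute)
  qed
  have step2: "2 / ln 2 * P' r \<le> ?f'' r * ?Q r + (\<integral>y. (x y)\<^sup>2 \<partial>lborel) / \<kappa>"
    if r: "1 \<le> r" "r \<le> 2" for r
  proof -
    have f: "?f'' r > 0" using pe_deriv2_pos[OF \<delta>] r by simp
    have I: "(\<integral>y. indicator {s - r..s} y * x y \<partial>lborel) = r * a s r" for s
      using r by (subst integral_Icc_FTC[OF _ cx X]) (auto simp: a_def)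
    have i: "integrable lborel (\<lambda>y. indicator {s - r..s} y * x y)" for s
      using r by (intro integrable_Icc cx) auto
    have "(\<integral>y. boxcar S c r y * x y \<partial>lborel) = r\<^sup>2 * P' r"
      unfolding bsum using i I r by (simp add: P'_def sum_distrib_left power2_eq_square mult_ac)
    moreover have ib: "integrable lborel (\<lambda>y. boxcar S c r y * x y)" unfolding bsum using i by auto
    ultimately have "2 / ln 2 * P' r = (\<integral>y. 2 * (boxcar S c r y * (x y / (r\<^sup>2 * ln 2))) \<partial>lborel)"
      using r by simp
    also have "\<dots> \<le> (\<integral>y. ?f'' r * (boxcar S c r y)\<^sup>2 + (x y / (r\<^sup>2 * ln 2))\<^sup>2 / ?f'' r \<partial>lborel)"
      using ib ix2 integrable_boxcar_square[OF S, of c r] f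
      by (intro integral_mono young_weighted) (auto simp: power_divide)
    also have "\<dots> = ?f'' r * ?Q r + (\<integral>y. (x y)\<^sup>2 \<partial>lborel) / ((r\<^sup>2 * ln 2)\<^sup>2 * ?f'' r)"
      using ix2 integrable_boxcar_square[OF S, of c r] integral_boxcar_square[OF S, of c r]
      by (simp add: power_divide)
    also have "(\<integral>y. (x y)\<^sup>2 \<partial>lborel) / ((r\<^sup>2 * ln 2)\<^sup>2 * ?f'' r) \<le> (\<integral>y. (x y)\<^sup>2 \<partial>lborel) / \<kappa>"
    proof (rule divide_left_mono)
      \<comment> \<open>On [1, 2] the weight r^(- 2 - \<delta>) is at most 1, so the same constant
        \<open>\<kappa>\<close> serves.\<close>
      have "1 \<le> r powr (2 + \<delta>)" using r \<delta> by (intro ge_one_powr_ge_zero) auto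
      then have "\<kappa> \<le> \<kappa> * r powr (2 + \<delta>)" using \<kappa> by simp
      also have "\<dots> = (r\<^sup>2 * ln 2)\<^sup>2 * (polya_const \<delta> * r powr (\<delta> - 2))"
        using r by (simp add: \<kappa>_def powr_diff powr_add power2_eq_square field_simps)
      also have "\<dots> \<le> (r\<^sup>2 * ln 2)\<^sup>2 * ?f'' r" using r by (intro mult_left_mono low) auto
      finally show "\<kappa> \<le> (r\<^sup>2 * ln 2)\<^sup>2 * ?f'' r" .
    qed (use r f \<kappa> in auto)
    finally show ?thesis by simp
  qed
  define T where "T s \<epsilon> = (\<integral>r. indicator {\<epsilon>..1} r * ((a s r - a s (2 * r)) / r) \<partial>lborel)
      + (\<integral>r. indicator {1..2} r * (a s r / r) \<partial>lborel)" for s \<epsilon>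
  have TP: "(\<Sum>s\<in>S. c s * T s \<epsilon>) = (\<integral>r. indicator {\<epsilon>..1} r * P r \<partial>lborel) + (\<integral>r. indicator {1..2} r * P' r \<partial>lborel)"
    if \<epsilon>: "0 < \<epsilon>" "\<epsilon> < 1 / 2" for \<epsilon>
  proof -
    have i1: "integrable lborel (\<lambda>r. indicator {\<epsilon>..1} r * ((a s r - a s (2 * r)) / r))" for s
      using \<epsilon> by (intro integrable_Icc continuous_intros ca isCont_o2[of _ "\<lambda>r. 2 * r" "a _"]) auto
    have i2: "integrable lborel (\<lambda>r. indicator {1..2} r * (a s r / r))" for s
      by (intro integrable_Icc continuous_intros ca) auto
    have "(\<lambda>r. indicator {\<epsilon>..1} r * P r) = (\<lambda>r. \<Sum>s\<in>S. c s * (indicator {\<epsilon>..1} r * ((a s r - a s (2 * r)) / r)))"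
      "(\<lambda>r. indicator {1..2} r * P' r) = (\<lambda>r. \<Sum>s\<in>S. c s * (indicator {1..2} r * (a s r / r)))"
      by (simp_all add: P_def P'_def sum_distrib_left mult_ac)
    moreover have "(\<integral>r. (\<Sum>s\<in>S. c s * G s r) \<partial>lborel) = (\<Sum>s\<in>S. c s * (\<integral>r. G s r \<partial>lborel))"
      if "\<And>s. integrable lborel (G s)" for G :: "real \<Rightarrow> real \<Rightarrow> real"
      using that by simp
    note this[OF i1] this[OF i2]
    ultimately show ?thesis by (simp only: T_def distrib_left sum.distrib)
  qed
  have bound: "2 / ln 2 * (\<Sum>s\<in>S. c s * T s \<epsilon>) \<le> qform (\<lambda>s t. power_exponential 1 1 \<delta> (s - t)) S c + sobolev_norm \<delta> x"
    if \<epsilon>: "0 < \<epsilon>" "\<epsilon> < 1 / 2" for \<epsilon>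
  proof -
    have iQ: "integrable lborel (\<lambda>r. indicator {a..b} r * (?f'' r * ?Q r))" if "0 < a" "a \<le> b" for a b
      using that by (intro integrable_Icc continuous_intros isCont_pe_deriv2 isCont_triangle_qform) auto
    note iE = integrable_weighted_shift_energy[OF x(1) e A]
    have "2 / ln 2 * (\<integral>r. indicator {\<epsilon>..1} r * P r \<partial>lborel) = (\<integral>r. indicator {\<epsilon>..1} r * (2 / ln 2 * P r) \<partial>lborel)"
      by (simp add: mult.left_commute[of _ "2 / ln 2"] del: times_divide_eq_left)
    also have "\<dots> \<le> (\<integral>r. indicator {\<epsilon>..1} r * (?f'' r * ?Q r)
        + (indicator {0<..1} r * (r powr (- 2 - \<delta>) * shift_energy x r)) / \<kappa> \<partial>lborel)"
    proof (rule integral_mono)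
      show "integrable lborel (\<lambda>r. indicator {\<epsilon>..1} r * (2 / ln 2 * P r))"
        using \<epsilon> by (intro integrable_Icc continuous_intros cP) auto
      show "integrable lborel (\<lambda>r. indicator {\<epsilon>..1} r * (?f'' r * ?Q r)
        + (indicator {0<..1} r * (r powr (- 2 - \<delta>) * shift_energy x r)) / \<kappa>)"
        using \<epsilon> by (intro Bochner_Integration.integrable_add iQ integrable_divide iE) auto
      show "indicator {\<epsilon>..1} r * (2 / ln 2 * P r) \<le> indicator {\<epsilon>..1} r * (?f'' r * ?Q r)
        + (indicator {0<..1} r * (r powr (- 2 - \<delta>) * shift_energy x r)) / \<kappa>" for r
        using step1[of r] \<epsilon> \<kappa> shift_energy_nonneg[of x r] by (auto simp: indicator_def)
    qed
    also have "\<dots> = (\<integral>r. indicator {\<epsilon>..1} r * (?f'' r * ?Q r) \<partial>lborel)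
        + (\<integral>r. indicator {0<..1} r * (r powr (- 2 - \<delta>) * shift_energy x r) \<partial>lborel) / \<kappa>"
      using \<epsilon> iE iQ[of \<epsilon> 1] by simp
    finally have p1: "2 / ln 2 * (\<integral>r. indicator {\<epsilon>..1} r * P r \<partial>lborel) \<le> \<dots>" .
    have "2 / ln 2 * (\<integral>r. indicator {1..2} r * P' r \<partial>lborel) = (\<integral>r. indicator {1..2} r * (2 / ln 2 * P' r) \<partial>lborel)"
      by (simp add: mult.left_commute[of _ "2 / ln 2"] del: times_divide_eq_left)
    also have "\<dots> \<le> (\<integral>r. indicator {1..2} r * (?f'' r * ?Q r) + indicator {1..2} r * ((\<integral>y. (x y)\<^sup>2 \<partial>lborel) / \<kappa>) \<partial>lborel)"
    proof (rule integral_mono)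
      show "integrable lborel (\<lambda>r. indicator {1..2} r * (2 / ln 2 * P' r))"
        by (intro integrable_Icc continuous_intros cP') auto
      show "integrable lborel (\<lambda>r. indicator {1..2} r * (?f'' r * ?Q r) + indicator {1..2} r * ((\<integral>y. (x y)\<^sup>2 \<partial>lborel) / \<kappa>))"
        by (intro Bochner_Integration.integrable_add iQ integrable_Icc continuous_intros) auto
      show "indicator {1..2} r * (2 / ln 2 * P' r) \<le> indicator {1..2} r * (?f'' r * ?Q r) + indicator {1..2} r * ((\<integral>y. (x y)\<^sup>2 \<partial>lborel) / \<kappa>)" for r
        using step2[of r] by (auto simp: indicator_def)
    qed
    also have "\<dots> = (\<integral>r. indicator {1..2} r * (?f'' r * ?Q r) \<partial>lborel) + (\<integral>y. (x y)\<^sup>2 \<partial>lborel) / \<kappa>"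
      using iQ[of 1 2] integrable_Icc[of 1 2 "\<lambda>_. (\<integral>y. (x y)\<^sup>2 \<partial>lborel) / \<kappa>"] by simp
    finally have p2: "2 / ln 2 * (\<integral>r. indicator {1..2} r * P' r \<partial>lborel) \<le> \<dots>" .
    have "(\<integral>r. indicator {\<epsilon>..1} r * (?f'' r * ?Q r) \<partial>lborel) + (\<integral>r. indicator {1..2} r * (?f'' r * ?Q r) \<partial>lborel)
       = (\<integral>r. indicator {\<epsilon>..1} r * (?f'' r * ?Q r) + indicator {1..2} r * (?f'' r * ?Q r) \<partial>lborel)"
      using iQ[of \<epsilon> 1] iQ[of 1 2] \<epsilon> by simp
    \<comment> \<open>The two ranges share the point r = 1, which is a null set.\<close>
    also have "\<dots> = (\<integral>r. indicator {\<epsilon>..2} r * (?f'' r * ?Q r) \<partial>lborel)"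
    proof (rule integral_cong_AE)
      show "AE r in lborel. indicator {\<epsilon>..1} r * (?f'' r * ?Q r) + indicator {1..2} r * (?f'' r * ?Q r) = indicator {\<epsilon>..2} r * (?f'' r * ?Q r)"
        using AE_lborel_singleton[of "1::real"] by eventually_elim (use \<epsilon> in \<open>auto simp: indicator_def\<close>)
    qed (use iQ[of \<epsilon> 1] iQ[of 1 2] iQ[of \<epsilon> 2] \<epsilon> in auto)
    also have "\<dots> \<le> qform (\<lambda>s t. power_exponential 1 1 \<delta> (s - t)) S c"
      using \<epsilon> by (intro triangle_mixture_le \<delta> S) auto
    finally show ?thesis
      using p1 p2 unfolding TP[OF \<epsilon>] sobolev_norm_def \<kappa>_def[symmetric] add_divide_distrib distrib_left by linarith
  qed
  have aL: "((\<lambda>r. a s r) \<longlongrightarrow> x s) (at_right 0)" for s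
  proof -
    have "((\<lambda>h. (X (s + h) - X s) / h) \<longlongrightarrow> x s) (at 0)" using X[of s] by (simp add: DERIV_def)
    then have "((\<lambda>h. (X (s + h) - X s) / h) \<longlongrightarrow> x s) (at_left 0)" by (rule tendsto_within_subset) auto
    then have "((\<lambda>h. (X (s + - h) - X s) / - h) \<longlongrightarrow> x s) (at_right 0)"
      by (simp add: filterlim_at_left_to_right)
    then show ?thesis by (simp add: a_def minus_divide_left)
  qed
  \<comment> \<open>The telescoped error is (a s \<xi> - x s) \<epsilon> / \<xi> with \<epsilon> <
    \<xi> < 2 \<epsilon>, hence small. The index shift by 3 keeps \<epsilon> below 1 / 2.\<close>
  have Tlim: "(\<lambda>n. T s (1 / real (n + 3))) \<longlonglongrightarrow> x s * ln 2" for s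
  proof (rule LIMSEQ_I)
    fix \<eta> :: real assume \<eta>: "\<eta> > 0"
    have "\<forall>\<^sub>F r in at_right 0. dist (a s r) (x s) < \<eta>" using aL \<eta> by (rule tendstoD)
    then obtain d where d: "d > 0" "\<And>r. 0 < r \<Longrightarrow> r < d \<Longrightarrow> \<bar>a s r - x s\<bar> < \<eta>"
      by (auto simp: eventually_at_right_field dist_real_def)
    obtain N where N: "1 / real (Suc N) < d / 2" using nat_approx_posE[of "d / 2"] d(1) by auto
    show "\<exists>N. \<forall>n\<ge>N. norm (T s (1 / real (n + 3)) - x s * ln 2) < \<eta>"
    proof (intro exI allI impI)
      fix n assume n: "N \<le> n"
      define \<epsilon> where "\<epsilon> = 1 / real (n + 3)"
      have "\<epsilon> \<le> 1 / real (Suc N)" unfolding \<epsilon>_def using n by (intro divide_left_mono) auto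
      then have "2 * \<epsilon> < d" using N by linarith
      moreover have "0 < \<epsilon>" "\<epsilon> < 1 / 2" by (simp_all add: \<epsilon>_def)
      ultimately have \<epsilon>: "0 < \<epsilon>" "\<epsilon> < 1 / 2" "2 * \<epsilon> < d" by blast+
      obtain \<xi> where \<xi>: "\<epsilon> < \<xi>" "\<xi> < 2 * \<epsilon>" "T s \<epsilon> - x s * ln 2 = (a s \<xi> - x s) * \<epsilon> / \<xi>"
        using dyadic_telescope[OF ca \<epsilon>(1,2), of s "x s"] unfolding T_def by blast
      have "\<bar>T s \<epsilon> - x s * ln 2\<bar> = \<bar>a s \<xi> - x s\<bar> * (\<epsilon> / \<xi>)" using \<xi> \<epsilon> by (simp add: abs_mult)
      also have "\<dots> \<le> \<bar>a s \<xi> - x s\<bar> * 1" using \<xi> \<epsilon> by (intro mult_left_mono) auto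
      also have "\<dots> < \<eta>" using d(2)[of \<xi>] \<xi> \<epsilon> by simp
      finally show "norm (T s (1 / real (n + 3)) - x s * ln 2) < \<eta>" by (simp add: \<epsilon>_def)
    qed
  qed
  have "(\<lambda>n. 2 / ln 2 * (\<Sum>s\<in>S. c s * T s (1 / real (n + 3)))) \<longlonglongrightarrow> 2 / ln 2 * (\<Sum>s\<in>S. c s * (x s * ln 2))"
    by (intro tendsto_intros Tlim)
  moreover have "2 / ln 2 * (\<Sum>s\<in>S. c s * (x s * ln 2)) = 2 * (\<Sum>s\<in>S. c s * x s)"
    by (simp add: sum_distrib_left sum_distrib_right[symmetric] mult_ac)
  ultimately have "(\<lambda>n. 2 / ln 2 * (\<Sum>s\<in>S. c s * T s (1 / real (n + 3)))) \<longlonglongrightarrow> 2 * (\<Sum>s\<in>S. c s * x s)" by simp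
  then show ?thesis
    by (rule LIMSEQ_le_const2) (use bound in \<open>auto simp: field_simps\<close>)
qed

section \<open>Gaussian noise\<close>

lemma char_scaled_std_normal:
  "char (distr std_normal_distribution borel (\<lambda>x. a * x)) \<theta> = exp (- (\<theta> * a)\<^sup>2 / 2)"
proof -
  have "char (distr std_normal_distribution borel (\<lambda>x. a * x)) \<theta> = char std_normal_distribution (\<theta> * a)"
    unfolding char_def by (subst integral_distr) (auto simp: mult.assoc)
  then show ?thesis by (simp add: char_std_normal_distribution)
qed

lemma char_centred_gaussian:
  assumes "centred_gaussian P U v"
  shows "char (distr P borel U) \<theta> = complex_of_real (exp (- \<theta>\<^sup>2 * v / 2))"
proof -
  have "distr P borel U = distr std_normal_distribution borel (\<lambda>x. sqrt v * x)" "v \<ge> 0"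
    using assms by (auto simp: centred_gaussian_def)
  then show ?thesis by (simp add: char_scaled_std_normal power_mult_distrib)
qed

lemma centred_gaussianI_char:
  assumes P: "prob_space P" and U[measurable]: "U \<in> borel_measurable P" and v: "v \<ge> 0"
    and c: "\<And>\<theta>. char (distr P borel U) \<theta> = complex_of_real (exp (- \<theta>\<^sup>2 * v / 2))"
  shows "centred_gaussian P U v"
  unfolding centred_gaussian_def
proof (intro conjI U v Levy_uniqueness ext)
  interpret prob_space P by fact
  show "real_distribution (distr P borel U)" by simp
  interpret N: prob_space std_normal_distribution by (rule prob_space_normal_density) simp
  show "real_distribution (distr std_normal_distribution borel (\<lambda>x. sqrt v * x))"
    by (rule N.real_distribution_distr) simp
  show "char (distr P borel U) \<theta> = char (distr std_normal_distribution borel (\<lambda>x. sqrt v * x)) \<theta>" for \<theta>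
    using v by (simp add: c char_scaled_std_normal power_mult_distrib)
qed

lemma centred_gaussian_limit:
  assumes P: "prob_space P" and g: "\<And>n. centred_gaussian P (U n) (v n)"
    and U: "AE \<omega> in P. (\<lambda>n. U n \<omega>) \<longlonglongrightarrow> V \<omega>" and V[measurable]: "V \<in> borel_measurable P" and v: "v \<longlonglongrightarrow> w"
  shows "centred_gaussian P V w"
proof (rule centred_gaussianI_char[OF P V])
  interpret prob_space P by fact
  have m[measurable]: "U n \<in> borel_measurable P" for n using g by (auto simp: centred_gaussian_def)
  show "w \<ge> 0" using g by (intro LIMSEQ_le_const[OF v]) (auto simp: centred_gaussian_def)
  fix \<theta>
  have e: "char (distr P borel Y) \<theta> = (CLINT \<omega>|P. iexp (\<theta> * Y \<omega>))" if [measurable]: "Y \<in> borel_measurable P" for Y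
    unfolding char_def by (subst integral_distr) auto
  have "(\<lambda>n. CLINT \<omega>|P. iexp (\<theta> * U n \<omega>)) \<longlonglongrightarrow> (CLINT \<omega>|P. iexp (\<theta> * V \<omega>))"
  proof (rule integral_dominated_convergence)
    show "integrable P (\<lambda>_. 1 :: real)" by simp
    show "AE \<omega> in P. (\<lambda>n. iexp (\<theta> * U n \<omega>)) \<longlonglongrightarrow> iexp (\<theta> * V \<omega>)"
      using U by eventually_elim (intro tendsto_intros)
  qed auto
  moreover have "(CLINT \<omega>|P. iexp (\<theta> * U n \<omega>)) = complex_of_real (exp (- \<theta>\<^sup>2 * v n / 2))" for n
    using char_centred_gaussian[OF g[of n], of \<theta>] e[OF m[of n]] by simp
  moreover have "(\<lambda>n. complex_of_real (exp (- \<theta>\<^sup>2 * v n / 2))) \<longlonglongrightarrow> complex_of_real (exp (- \<theta>\<^sup>2 * w / 2))"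
    by (intro tendsto_intros v) auto
  ultimately show "char (distr P borel V) \<theta> = complex_of_real (exp (- \<theta>\<^sup>2 * w / 2))"
    using e[OF V] LIMSEQ_unique by simp
qed

lemma centred_gaussian_cong_AE:
  assumes "centred_gaussian P U v" "AE \<omega> in P. U \<omega> = V \<omega>" "V \<in> borel_measurable P"
  shows "centred_gaussian P V v"
  using assms distr_cong_AE[of P P borel borel U V] by (auto simp: centred_gaussian_def)

section \<open>Sequences of independent standard normal variables and their Gaussian series\<close>

definition noise :: "(nat \<Rightarrow> real) measure" where
  "noise = (\<Pi>\<^sub>M i\<in>UNIV. std_normal_distribution)"

lemma sets_noise[measurable_cong]: "sets noise = sets (\<Pi>\<^sub>M i\<in>UNIV. borel)"
  unfolding noise_def by (intro sets_PiM_cong) auto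

lemma space_noise[simp]: "space noise = UNIV"
  by (simp add: noise_def space_PiM PiE_def)

interpretation std_normal: prob_space std_normal_distribution
  by (rule prob_space_normal_density) simp

interpretation noise_product: product_prob_space "\<lambda>i :: nat. std_normal_distribution" UNIV
  by standard

interpretation noise: prob_space noise
  unfolding noise_def by (rule noise_product.prob_space_axioms)

lemma noise_component_measurable[measurable]: "(\<lambda>\<xi>. \<xi> i) \<in> borel_measurable noise"
  by (subst measurable_cong_sets[OF sets_noise refl]) simp

lemma distr_noise_component: "distr noise borel (\<lambda>\<xi>. \<xi> i) = std_normal_distribution"
proof -
  have "distr noise borel (\<lambda>\<xi>. \<xi> i) = distr noise std_normal_distribution (\<lambda>\<xi>. \<xi> i)"
    by (intro distr_cong) auto
  also have "\<dots> = std_normal_distribution"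
    unfolding noise_def by (rule distr_PiM_component) (auto intro: std_normal.prob_space_axioms)
  finally show ?thesis .
qed

lemma indep_noise_components: "noise.indep_vars (\<lambda>_. borel) (\<lambda>i \<xi>. \<xi> i) UNIV"
proof (subst noise.indep_vars_iff_distr_eq_PiM')
  have "distr noise (\<Pi>\<^sub>M i\<in>UNIV. borel) (\<lambda>\<xi>. \<lambda>i\<in>UNIV. \<xi> i) = distr noise noise (\<lambda>\<xi>. \<xi>)"
    by (intro distr_cong) (auto simp: sets_noise)
  also have "\<dots> = noise" by (rule distr_id)
  finally show "distr noise (\<Pi>\<^sub>M i\<in>UNIV. borel) (\<lambda>\<xi>. \<lambda>i\<in>UNIV. \<xi> i) = (\<Pi>\<^sub>M i\<in>UNIV. distr noise borel (\<lambda>\<xi>. \<xi> i))"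
    unfolding distr_noise_component by (simp only: noise_def)
qed auto

definition partial :: "(nat \<Rightarrow> real) \<Rightarrow> nat \<Rightarrow> (nat \<Rightarrow> real) \<Rightarrow> real" where
  "partial v n \<xi> = (\<Sum>i<n. v i * \<xi> i)"

lemma partial_measurable[measurable]: "partial v n \<in> borel_measurable noise"
  unfolding partial_def by measurable

lemma partial_gaussian: "centred_gaussian noise (partial v n) (\<Sum>i<n. (v i)\<^sup>2)"
proof (rule centred_gaussianI_char[OF noise.prob_space_axioms])
  fix \<theta>
  have "noise.indep_vars (\<lambda>_. borel) (\<lambda>i. (\<lambda>x. v i * x) \<circ> (\<lambda>\<xi>. \<xi> i)) {..<n}"
    using noise.indep_vars_subset[OF indep_noise_components, of "{..<n}"]
    by (intro noise.indep_vars_compose) auto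
  then have iv: "noise.indep_vars (\<lambda>_. borel) (\<lambda>i \<xi>. v i * \<xi> i) {..<n}" by (simp add: comp_def)
  have "distr noise borel (\<lambda>\<xi>. v i * \<xi> i) = distr std_normal_distribution borel (\<lambda>x. v i * x)" for i
    by (subst distr_noise_component[symmetric, of i], subst distr_distr) (auto simp: comp_def)
  then have "char (distr noise borel (partial v n)) \<theta> = (\<Prod>i<n. complex_of_real (exp (- (\<theta> * v i)\<^sup>2 / 2)))"
    using noise.char_distr_sum[OF iv, of \<theta>] unfolding partial_def by (simp add: char_scaled_std_normal)
  also have "\<dots> = complex_of_real (exp (\<Sum>i<n. - (\<theta> * v i)\<^sup>2 / 2))"
    by (simp add: exp_sum flip: of_real_prod)
  also have "(\<Sum>i<n. - (\<theta> * v i)\<^sup>2 / 2) = - \<theta>\<^sup>2 * (\<Sum>i<n. (v i)\<^sup>2) / 2"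
    by (simp add: power_mult_distrib sum_negf sum_distrib_left sum_divide_distrib)
  finally show "char (distr noise borel (partial v n)) \<theta> = complex_of_real (exp (- \<theta>\<^sup>2 * (\<Sum>i<n. (v i)\<^sup>2) / 2))" .
qed (auto intro: sum_nonneg)

definition norm_sq :: "(nat \<Rightarrow> real) \<Rightarrow> real" where
  "norm_sq v = (\<Sum>i. (v i)\<^sup>2)"

text \<open>For square summable \<open>v\<close> this is the sum of squares from \<open>n\<close>
  on, the variance of the remainder of the series.\<close>

definition tail_sq :: "(nat \<Rightarrow> real) \<Rightarrow> nat \<Rightarrow> real" where
  "tail_sq v n = norm_sq v - (\<Sum>i<n. (v i)\<^sup>2)"

definition square_summable :: "(nat \<Rightarrow> real) \<Rightarrow> bool" where
  "square_summable v \<longleftrightarrow> summable (\<lambda>i. (v i)\<^sup>2)"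

text \<open>The requirement n >= k makes the levels tend to infinity even when \<open>v\<close> has
  finite support.\<close>

definition level :: "(nat \<Rightarrow> real) \<Rightarrow> nat \<Rightarrow> nat" where
  "level v k = (LEAST n. n \<ge> k \<and> tail_sq v n \<le> (1 / 4) ^ k)"

lemma square_summable_add:
  assumes "square_summable u" "square_summable v"
  shows "square_summable (\<lambda>i. a * u i + b * v i)"
  unfolding square_summable_def
proof (rule summable_comparison_test')
  show "summable (\<lambda>i. 2 * (a\<^sup>2 * (u i)\<^sup>2) + 2 * (b\<^sup>2 * (v i)\<^sup>2))"
    using assms unfolding square_summable_def by (intro summable_add summable_mult)
  have "(a * u i + b * v i)\<^sup>2 \<le> 2 * (a * u i)\<^sup>2 + 2 * (b * v i)\<^sup>2" for i
    using sum_squares_bound[of "a * u i" "b * v i"] by (simp add: power2_sum)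
  then show "norm ((a * u i + b * v i)\<^sup>2) \<le> 2 * (a\<^sup>2 * (u i)\<^sup>2) + 2 * (b\<^sup>2 * (v i)\<^sup>2)" for i
    by (simp add: power_mult_distrib)
qed

lemma square_summable_mult:
  assumes "square_summable u" "square_summable v"
  shows "summable (\<lambda>i. u i * v i)"
proof (rule summable_comparison_test')
  show "summable (\<lambda>i. (u i)\<^sup>2 + (v i)\<^sup>2)"
    using assms unfolding square_summable_def by (intro summable_add)
  have "2 * (\<bar>u i\<bar> * \<bar>v i\<bar>) \<le> (u i)\<^sup>2 + (v i)\<^sup>2" for i using sum_squares_bound[of "\<bar>u i\<bar>" "\<bar>v i\<bar>"] by simp
  then show "norm (u i * v i) \<le> (u i)\<^sup>2 + (v i)\<^sup>2" for i
    using mult_nonneg_nonneg[of "\<bar>u i\<bar>" "\<bar>v i\<bar>"] unfolding real_norm_def abs_mult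
    by (smt (verit) abs_ge_zero)
qed

lemma tail_sq_nonneg: "square_summable v \<Longrightarrow> tail_sq v n \<ge> 0"
  unfolding tail_sq_def norm_sq_def square_summable_def using sum_le_suminf[of "\<lambda>i. (v i)\<^sup>2" "{..<n}"] by simp

lemma tail_sq_tendsto: "square_summable v \<Longrightarrow> tail_sq v \<longlonglongrightarrow> 0"
proof -
  assume "square_summable v"
  then have "(\<lambda>n. \<Sum>i<n. (v i)\<^sup>2) \<longlonglongrightarrow> norm_sq v"
    unfolding norm_sq_def square_summable_def by (rule summable_LIMSEQ)
  then have "(\<lambda>n. norm_sq v - (\<Sum>i<n. (v i)\<^sup>2)) \<longlonglongrightarrow> norm_sq v - norm_sq v" by (intro tendsto_diff tendsto_const)
  then show ?thesis by (simp add: tail_sq_def[abs_def])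
qed

lemma level:
  assumes "square_summable v"
  shows "level v k \<ge> k" "tail_sq v (level v k) \<le> (1 / 4) ^ k"
proof -
  have "\<forall>\<^sub>F n in sequentially. tail_sq v n < (1 / 4) ^ k"
    using tail_sq_tendsto[OF assms] by (rule order_tendstoD) simp
  then have "\<forall>\<^sub>F n in sequentially. n \<ge> k \<and> tail_sq v n \<le> (1 / 4) ^ k"
    using eventually_ge_at_top[of k] by eventually_elim auto
  then have "\<exists>n. n \<ge> k \<and> tail_sq v n \<le> (1 / 4) ^ k"
    by (auto simp: eventually_sequentially)
  from LeastI_ex[OF this] show "level v k \<ge> k" "tail_sq v (level v k) \<le> (1 / 4) ^ k"
    unfolding level_def by auto
qed

lemma partial_diff_gaussian:
  assumes "m \<le> n"
  shows "centred_gaussian noise (\<lambda>\<xi>. partial v n \<xi> - partial v m \<xi>) (tail_sq v m - tail_sq v n)"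
proof -
  have split: "(\<Sum>i<n. f i) - (\<Sum>i<m. f i) = (\<Sum>i<n. if i < m then 0 else f i)" for f :: "nat \<Rightarrow> real"
  proof -
    have "(\<Sum>i<n. f i) = (\<Sum>i<n. if i < m then f i else 0) + (\<Sum>i<n. if i < m then 0 else f i)"
      by (simp add: sum.distrib[symmetric] if_distrib cong: if_cong)
    also have "(\<Sum>i<n. if i < m then f i else 0) = (\<Sum>i<m. f i)"
      using assms by (intro sum.mono_neutral_cong_right) auto
    finally show ?thesis by simp
  qed
  have "partial v n \<xi> - partial v m \<xi> = partial (\<lambda>i. if i < m then 0 else v i) n \<xi>" for \<xi>
    unfolding partial_def split by (intro sum.cong) auto
  moreover have "tail_sq v m - tail_sq v n = (\<Sum>i<n. (if i < m then 0 else v i)\<^sup>2)"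
    unfolding tail_sq_def using split[of "\<lambda>i. (v i)\<^sup>2"] by (auto intro!: sum.cong)
  ultimately show ?thesis using partial_gaussian[of "\<lambda>i. if i < m then 0 else v i" n] by simp
qed

text \<open>The variance of the \<open>k\<close>-th increment is at most 4^(-k), so its first
  absolute moment is at most 2^(-k), by 2 |d| <= 2^k d^2 + 2^(-k). The sum of the moduli then has
  finite expectation and is almost surely finite.\<close>

lemma AE_partial_level_convergent:
  assumes v: "square_summable v"
  shows "AE \<xi> in noise. convergent (\<lambda>k. partial v (level v k) \<xi>)"
proof -
  define d where "d k \<xi> = partial v (level v (Suc k)) \<xi> - partial v (level v k) \<xi>" for k \<xi>
  have [measurable]: "d k \<in> borel_measurable noise" for k unfolding d_def by measurable
  have d2: "(\<integral>\<xi>. (d k \<xi>)\<^sup>2 \<partial>noise) \<le> (1 / 4) ^ k" and i2: "integrable noise (\<lambda>\<xi>. (d k \<xi>)\<^sup>2)" for k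
  proof -
    have "\<exists>w. centred_gaussian noise (d k) w \<and> w \<le> (1 / 4) ^ k"
    proof (cases "level v k \<le> level v (Suc k)")
      case True
      then show ?thesis
        using partial_diff_gaussian[OF True, of v] level(2)[OF v, of k] tail_sq_nonneg[OF v, of "level v (Suc k)"]
        unfolding d_def[abs_def] by (intro exI[of _ "tail_sq v (level v k) - tail_sq v (level v (Suc k))"]) auto
    next
      case False
      let ?w = "tail_sq v (level v (Suc k)) - tail_sq v (level v k)"
      have g: "centred_gaussian noise (\<lambda>\<xi>. partial v (level v k) \<xi> - partial v (level v (Suc k)) \<xi>) ?w"
        using False by (intro partial_diff_gaussian) auto
      have "centred_gaussian noise (d k) ?w"
      proof (rule centred_gaussianI_char[OF noise.prob_space_axioms])
        show "?w \<ge> 0" using g by (simp add: centred_gaussian_def)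
        show "char (distr noise borel (d k)) \<theta> = complex_of_real (exp (- \<theta>\<^sup>2 * ?w / 2))" for \<theta>
        proof -
          have "char (distr noise borel (d k)) \<theta> = char (distr noise borel (\<lambda>\<xi>. partial v (level v k) \<xi> - partial v (level v (Suc k)) \<xi>)) (- \<theta>)"
            unfolding char_def d_def by (simp add: integral_distr algebra_simps)
          then show ?thesis using char_centred_gaussian[OF g, of "- \<theta>"] by simp
        qed
      qed measurable
      moreover have "?w \<le> (1 / 4) ^ Suc k" using level(2)[OF v, of "Suc k"] tail_sq_nonneg[OF v, of "level v k"] by simp
      moreover have "(1 / 4 :: real) ^ Suc k \<le> (1 / 4) ^ k" by simp
      ultimately show ?thesis by (intro exI[of _ ?w]) linarith
    qed
    then obtain w where w: "centred_gaussian noise (d k) w" "w \<le> (1 / 4) ^ k" by blast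
    show "(\<integral>\<xi>. (d k \<xi>)\<^sup>2 \<partial>noise) \<le> (1 / 4) ^ k" "integrable noise (\<lambda>\<xi>. (d k \<xi>)\<^sup>2)"
      using centred_gaussian_second[OF w(1)] centred_gaussian_integrable_power[OF w(1), of 2] w(2) by auto
  qed
  have d1: "(\<integral>\<^sup>+\<xi>. ennreal \<bar>d k \<xi>\<bar> \<partial>noise) \<le> ennreal ((1 / 2) ^ k)" for k
  proof -
    have "\<bar>d k \<xi>\<bar> \<le> (2 ^ k * (d k \<xi>)\<^sup>2 + (1 / 2) ^ k) / 2" for \<xi>
    proof -
      have "0 \<le> (2 ^ k * \<bar>d k \<xi>\<bar> - 1)\<^sup>2 / 2 ^ k" by simp
      also have "\<dots> = 2 ^ k * (d k \<xi>)\<^sup>2 + (1 / 2) ^ k - 2 * \<bar>d k \<xi>\<bar>"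
      proof -
        have "(K * D - 1)\<^sup>2 / K = K * D\<^sup>2 + 1 / K - 2 * D" if "K > 0" for K D :: real
          using that by (simp add: power2_eq_square field_simps)
        from this[of "2 ^ k" "\<bar>d k \<xi>\<bar>"] show ?thesis by (simp add: power_divide)
      qed
      finally show ?thesis by simp
    qed
    then have "(\<integral>\<^sup>+\<xi>. ennreal \<bar>d k \<xi>\<bar> \<partial>noise) \<le> (\<integral>\<^sup>+\<xi>. ennreal ((2 ^ k * (d k \<xi>)\<^sup>2 + (1 / 2) ^ k) / 2) \<partial>noise)"
      by (intro nn_integral_mono ennreal_leI)
    also have "\<dots> = ennreal (\<integral>\<xi>. (2 ^ k * (d k \<xi>)\<^sup>2 + (1 / 2) ^ k) / 2 \<partial>noise)"
      using i2 by (intro nn_integral_eq_integral) auto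
    also have "(\<integral>\<xi>. (2 ^ k * (d k \<xi>)\<^sup>2 + (1 / 2) ^ k) / 2 \<partial>noise) = (2 ^ k * (\<integral>\<xi>. (d k \<xi>)\<^sup>2 \<partial>noise) + (1 / 2) ^ k) / 2"
      using i2[of k] by (simp add: noise.prob_space[unfolded space_noise])
    also have "ennreal \<dots> \<le> ennreal ((2 ^ k * (1 / 4) ^ k + (1 / 2) ^ k) / 2)"
      using d2[of k] by (intro ennreal_leI divide_right_mono add_right_mono mult_left_mono) auto
    also have "(2 ^ k * (1 / 4) ^ k + (1 / 2) ^ k) / 2 = (1 / 2 :: real) ^ k"
      by (simp flip: power_mult_distrib)
    finally show ?thesis .
  qed
  have "(\<integral>\<^sup>+\<xi>. (\<Sum>k. ennreal \<bar>d k \<xi>\<bar>) \<partial>noise) = (\<Sum>k. \<integral>\<^sup>+\<xi>. ennreal \<bar>d k \<xi>\<bar> \<partial>noise)"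
    by (intro nn_integral_suminf) measurable
  also have "\<dots> \<le> (\<Sum>k. ennreal ((1 / 2) ^ k))" by (intro suminf_le d1) auto
  also have "\<dots> = ennreal (\<Sum>k. (1 / 2) ^ k)" by (intro suminf_ennreal2) (auto intro: summable_geometric)
  also have "\<dots> < \<infinity>" by simp
  finally have "AE \<xi> in noise. (\<Sum>k. ennreal \<bar>d k \<xi>\<bar>) \<noteq> \<infinity>"
    by (intro nn_integral_PInf_AE) auto
  then show ?thesis
  proof eventually_elim
    case (elim \<xi>)
    then have "summable (\<lambda>k. \<bar>d k \<xi>\<bar>)" by (intro summable_suminf_not_top) auto
    then have "summable (\<lambda>k. d k \<xi>)" by (rule summable_rabs_cancel)
    then have "convergent (\<lambda>n. \<Sum>k<n. d k \<xi>)" by (simp add: summable_iff_convergent)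
    moreover have "(\<Sum>k<n. d k \<xi>) = partial v (level v n) \<xi> - partial v (level v 0) \<xi>" for n
      unfolding d_def by (rule sum_lessThan_telescope)
    ultimately have "convergent (\<lambda>n. partial v (level v n) \<xi> - partial v (level v 0) \<xi>)" by simp
    from convergent_add[OF this convergent_const[of "partial v (level v 0) \<xi>"]] show ?case by simp
  qed
qed

text \<open>The partial sums are taken along the subsequence \<open>level v\<close>, whose increments have summable first
  moments, so that almost sure convergence needs no martingale argument.\<close>

definition isonormal :: "(nat \<Rightarrow> real) \<Rightarrow> (nat \<Rightarrow> real) \<Rightarrow> real" where
  "isonormal v \<xi> = lim (\<lambda>k. partial v (level v k) \<xi>)"

lemma isonormal_measurable[measurable]: "isonormal v \<in> borel_measurable noise"
  unfolding isonormal_def by measurable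

lemma isonormal_diff_gaussian:
  assumes v: "square_summable v"
  shows "centred_gaussian noise (\<lambda>\<xi>. isonormal v \<xi> - partial v n \<xi>) (tail_sq v n)"
proof (rule centred_gaussian_limit[OF noise.prob_space_axioms])
  \<comment> \<open>The index k + n ensures that the level is at least \<open>n\<close>.\<close>
  show "centred_gaussian noise (\<lambda>\<xi>. partial v (level v (k + n)) \<xi> - partial v n \<xi>) (tail_sq v n - tail_sq v (level v (k + n)))" for k
    using level(1)[OF v, of "k + n"] by (intro partial_diff_gaussian) auto
  show "AE \<xi> in noise. (\<lambda>k. partial v (level v (k + n)) \<xi> - partial v n \<xi>) \<longlonglongrightarrow> isonormal v \<xi> - partial v n \<xi>"
    using AE_partial_level_convergent[OF v]
  proof eventually_elim
    case (elim \<xi>)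
    then have "(\<lambda>k. partial v (level v k) \<xi>) \<longlonglongrightarrow> isonormal v \<xi>"
      by (simp add: isonormal_def convergent_LIMSEQ_iff)
    then show ?case by (intro tendsto_diff tendsto_const LIMSEQ_ignore_initial_segment)
  qed
  have "filterlim (level v) at_top sequentially"
    using level(1)[OF v] by (intro filterlim_at_top_mono[OF filterlim_ident]) auto
  then have "(\<lambda>k. tail_sq v (level v k)) \<longlonglongrightarrow> 0"
    by (rule filterlim_compose[OF tail_sq_tendsto[OF v]])
  then have "(\<lambda>k. tail_sq v n - tail_sq v (level v (k + n))) \<longlonglongrightarrow> tail_sq v n - 0"
    by (intro tendsto_diff tendsto_const LIMSEQ_ignore_initial_segment)
  then show "(\<lambda>k. tail_sq v n - tail_sq v (level v (k + n))) \<longlonglongrightarrow> tail_sq v n" by simp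
qed measurable

lemma isonormal_gaussian: "square_summable v \<Longrightarrow> centred_gaussian noise (isonormal v) (norm_sq v)"
  using isonormal_diff_gaussian[of v 0] by (simp add: partial_def tail_sq_def)

text \<open>Linearity is not inherited along the limits, because the levels of \<open>u\<close>,
  \<open>v\<close> and their combination differ. Each limit is compared in L^2 with partial sums of
  a common length, where linearity is exact.\<close>

lemma isonormal_linear:
  assumes u: "square_summable u" and v: "square_summable v"
  shows "AE \<xi> in noise. isonormal (\<lambda>i. a * u i + b * v i) \<xi> = a * isonormal u \<xi> + b * isonormal v \<xi>"
proof -
  define w where "w i = a * u i + b * v i" for i
  have w: "square_summable w" unfolding w_def by (rule square_summable_add[OF u v])
  define e where "e z n \<xi> = isonormal z \<xi> - partial z n \<xi>" for z n \<xi>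
  have E: "(\<integral>\<xi>. (e z n \<xi>)\<^sup>2 \<partial>noise) = tail_sq z n" "integrable noise (\<lambda>\<xi>. (e z n \<xi>)\<^sup>2)" if "square_summable z" for z n
    using centred_gaussian_second[OF isonormal_diff_gaussian[OF that, of n]]
      centred_gaussian_integrable_power[OF isonormal_diff_gaussian[OF that, of n], of 2] by (auto simp: e_def)
  define d where "d \<xi> = isonormal w \<xi> - a * isonormal u \<xi> - b * isonormal v \<xi>" for \<xi>
  have [measurable]: "d \<in> borel_measurable noise" unfolding d_def by measurable
  have "partial w n \<xi> = a * partial u n \<xi> + b * partial v n \<xi>" for n \<xi>
    by (simp add: partial_def w_def algebra_simps sum.distrib sum_distrib_left)
  then have d: "d \<xi> = e w n \<xi> + (- a * e u n \<xi>) + (- b * e v n \<xi>)" for n \<xi>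
    by (simp add: d_def e_def algebra_simps)
  have le: "(d \<xi>)\<^sup>2 \<le> 3 * (e w n \<xi>)\<^sup>2 + 3 * (a\<^sup>2 * (e u n \<xi>)\<^sup>2) + 3 * (b\<^sup>2 * (e v n \<xi>)\<^sup>2)" for n \<xi>
  proof -
    have "(x + y + z)\<^sup>2 \<le> 3 * x\<^sup>2 + 3 * y\<^sup>2 + 3 * z\<^sup>2" for x y z :: real
      using sum_squares_ge_zero[of "x - y" "y - z"] zero_le_power2[of "x - z"]
      by (simp add: power2_eq_square algebra_simps)
    from this[of "e w n \<xi>" "- a * e u n \<xi>" "- b * e v n \<xi>"] show ?thesis
      unfolding d[of \<xi> n] by (simp add: power_mult_distrib)
  qed
  have id: "integrable noise (\<lambda>\<xi>. (d \<xi>)\<^sup>2)"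
    by (rule Bochner_Integration.integrable_bound[of _ "\<lambda>\<xi>. 3 * (e w 0 \<xi>)\<^sup>2 + 3 * (a\<^sup>2 * (e u 0 \<xi>)\<^sup>2) + 3 * (b\<^sup>2 * (e v 0 \<xi>)\<^sup>2)"])
      (use E u v w le[of _ 0] in \<open>auto intro!: order.trans[OF le[of _ 0]]\<close>)
  have bound: "(\<integral>\<xi>. (d \<xi>)\<^sup>2 \<partial>noise) \<le> 3 * tail_sq w n + 3 * (a\<^sup>2 * tail_sq u n) + 3 * (b\<^sup>2 * tail_sq v n)" for n
  proof -
    have "(\<integral>\<xi>. (d \<xi>)\<^sup>2 \<partial>noise) \<le> (\<integral>\<xi>. 3 * (e w n \<xi>)\<^sup>2 + 3 * (a\<^sup>2 * (e u n \<xi>)\<^sup>2) + 3 * (b\<^sup>2 * (e v n \<xi>)\<^sup>2) \<partial>noise)"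
      using le id E u v w by (intro integral_mono) auto
    also have "\<dots> = 3 * tail_sq w n + 3 * (a\<^sup>2 * tail_sq u n) + 3 * (b\<^sup>2 * tail_sq v n)"
      using E u v w by simp
    finally show ?thesis .
  qed
  have "(\<lambda>n. 3 * tail_sq w n + 3 * (a\<^sup>2 * tail_sq u n) + 3 * (b\<^sup>2 * tail_sq v n)) \<longlonglongrightarrow> 3 * 0 + 3 * (a\<^sup>2 * 0) + 3 * (b\<^sup>2 * 0)"
    by (intro tendsto_intros tail_sq_tendsto u v w)
  then have "(\<integral>\<xi>. (d \<xi>)\<^sup>2 \<partial>noise) \<le> 3 * 0 + 3 * (a\<^sup>2 * 0) + 3 * (b\<^sup>2 * 0)"
    by (rule LIMSEQ_le_const) (use bound in auto)
  then have "(\<integral>\<xi>. (d \<xi>)\<^sup>2 \<partial>noise) = 0" by (simp add: antisym)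
  then have "AE \<xi> in noise. (d \<xi>)\<^sup>2 = 0" using id by (subst (asm) integral_nonneg_eq_0_iff_AE) auto
  then show ?thesis by eventually_elim (simp add: d_def w_def[abs_def])
qed

text \<open>A pointwise statement: the set of admissible \<open>\<xi>\<close> does not depend on
  \<open>m\<close>. This matters because the shift will be random, a function of the other
  noise.\<close>

lemma isonormal_shift:
  assumes v: "square_summable v" and m: "square_summable m"
    and c: "convergent (\<lambda>k. partial v (level v k) \<xi>)"
  shows "isonormal v (\<lambda>i. \<xi> i + m i) = isonormal v \<xi> + (\<Sum>i. v i * m i)"
proof -
  have "(\<lambda>n. \<Sum>i<n. v i * m i) \<longlonglongrightarrow> (\<Sum>i. v i * m i)"
    using square_summable_mult[OF v m] by (rule summable_LIMSEQ)
  moreover have "filterlim (level v) at_top sequentially"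
    using level(1)[OF v] by (intro filterlim_at_top_mono[OF filterlim_ident]) auto
  ultimately have "(\<lambda>k. \<Sum>i<level v k. v i * m i) \<longlonglongrightarrow> (\<Sum>i. v i * m i)" by (rule filterlim_compose)
  moreover have "(\<lambda>k. partial v (level v k) \<xi>) \<longlonglongrightarrow> isonormal v \<xi>"
    using c by (simp add: isonormal_def convergent_LIMSEQ_iff)
  ultimately have "(\<lambda>k. partial v (level v k) \<xi> + (\<Sum>i<level v k. v i * m i)) \<longlonglongrightarrow> isonormal v \<xi> + (\<Sum>i. v i * m i)"
    by (intro tendsto_add)
  moreover have "partial v n (\<lambda>i. \<xi> i + m i) = partial v n \<xi> + (\<Sum>i<n. v i * m i)" for n
    by (simp add: partial_def algebra_simps sum.distrib)
  ultimately show ?thesis unfolding isonormal_def by (intro limI) simp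
qed

section \<open>Shifts of Gaussian noise\<close>

text \<open>The density of the normal law with mean \<open>m\<close> and variance 1 with respect to
  the standard normal law.\<close>

definition likelihood :: "real \<Rightarrow> real \<Rightarrow> real" where
  "likelihood m x = exp (m * x - m\<^sup>2 / 2)"

lemma likelihood_measurable[measurable]: "likelihood m \<in> borel_measurable borel"
  unfolding likelihood_def by measurable

lemma likelihood_nonneg: "likelihood m x \<ge> 0"
  by (simp add: likelihood_def)

text \<open>The square is again a likelihood, for the shift 2 m, up to exp (m^2); its expectation is
  therefore exp (m^2).\<close>

lemma likelihood_square: "(likelihood m x)\<^sup>2 = exp (m\<^sup>2) * likelihood (2 * m) x"
  by (simp add: likelihood_def power2_eq_square algebra_simps flip: exp_add)

lemma std_normal_shift:
  assumes [measurable]: "f \<in> borel_measurable borel"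
  shows "(\<integral>\<^sup>+x. f (x + m) \<partial>std_normal_distribution) = (\<integral>\<^sup>+x. f x * ennreal (likelihood m x) \<partial>std_normal_distribution)"
proof -
  have "(\<integral>\<^sup>+x. f (x + m) \<partial>std_normal_distribution) = (\<integral>\<^sup>+x. std_normal_density x * f (x + m) \<partial>lborel)"
    by (intro nn_integral_density) auto
  also have "\<dots> = (\<integral>\<^sup>+x. std_normal_density (x - m) * f x \<partial>lborel)"
    by (subst nn_integral_real_affine[where c=1 and t=m and f="\<lambda>x. std_normal_density (x - m) * f x"]) (auto simp: add.commute)
  also have "\<dots> = (\<integral>\<^sup>+x. std_normal_density x * (f x * ennreal (likelihood m x)) \<partial>lborel)"
  proof (intro nn_integral_cong)
    fix x
    have "std_normal_density (x - m) = std_normal_density x * likelihood m x"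
      by (simp add: std_normal_density_def likelihood_def power2_eq_square field_simps flip: exp_add)
    then show "std_normal_density (x - m) * f x = std_normal_density x * (f x * ennreal (likelihood m x))"
      by (simp add: ennreal_mult likelihood_def mult_ac)
  qed
  also have "\<dots> = (\<integral>\<^sup>+x. f x * ennreal (likelihood m x) \<partial>std_normal_distribution)"
    by (intro nn_integral_density[symmetric]) auto
  finally show ?thesis .
qed

interpretation std_normal_noise: pair_sigma_finite std_normal_distribution noise
  by standard

lemma fun_upd_noise_measurable:
  "(\<lambda>(x, X). X(i := x)) \<in> measurable (std_normal_distribution \<Otimes>\<^sub>M noise) noise"
proof -
  have "(\<lambda>(x, X). X(i := x)) \<in> measurable (std_normal_distribution \<Otimes>\<^sub>M (\<Pi>\<^sub>M i\<in>UNIV. std_normal_distribution))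
     (\<Pi>\<^sub>M i\<in>insert i UNIV. std_normal_distribution)"
    unfolding split_beta' by (intro measurable_fun_upd[where J=UNIV]) auto
  then show ?thesis by (simp add: noise_def)
qed

text \<open>Coordinate \<open>i\<close> is overwritten by a fresh standard normal variable.
  One-dimensional statements thus transfer to one coordinate without splitting the index
  set.\<close>

lemma nn_integral_noise_resample:
  assumes g: "g \<in> borel_measurable noise"
  shows "(\<integral>\<^sup>+\<xi>. g \<xi> \<partial>noise) = (\<integral>\<^sup>+X. \<integral>\<^sup>+x. g (X(i := x)) \<partial>std_normal_distribution \<partial>noise)"
proof -
  have "distr (std_normal_distribution \<Otimes>\<^sub>M noise) noise (\<lambda>(x, X). X(i := x)) = noise"
    using distr_pair_PiM_eq_PiM[of UNIV "\<lambda>_. std_normal_distribution" i]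
    by (simp add: noise_def std_normal.prob_space_axioms)
  then have "(\<integral>\<^sup>+\<xi>. g \<xi> \<partial>noise) = (\<integral>\<^sup>+\<xi>. g \<xi> \<partial>distr (std_normal_distribution \<Otimes>\<^sub>M noise) noise (\<lambda>(x, X). X(i := x)))" by simp
  also have "\<dots> = (\<integral>\<^sup>+p. g ((\<lambda>(x, X). X(i := x)) p) \<partial>(std_normal_distribution \<Otimes>\<^sub>M noise))"
    by (rule nn_integral_distr[OF fun_upd_noise_measurable]) (simp add: g)
  also have "\<dots> = (\<integral>\<^sup>+X. \<integral>\<^sup>+x. g ((\<lambda>(x, X). X(i := x)) (x, X)) \<partial>std_normal_distribution \<partial>noise)"
    by (rule std_normal_noise.nn_integral_snd[symmetric]) (rule measurable_compose[OF fun_upd_noise_measurable g])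
  finally show ?thesis by simp
qed

lemma noise_measurableI:
  assumes "\<And>i. (\<lambda>\<xi>. f \<xi> i) \<in> borel_measurable M"
  shows "f \<in> measurable M noise"
proof -
  have "(\<lambda>\<xi>. \<lambda>i\<in>UNIV. f \<xi> i) \<in> measurable M (\<Pi>\<^sub>M i\<in>UNIV. borel)"
    using assms by (intro measurable_restrict) auto
  then show ?thesis by (simp add: measurable_cong_sets[OF refl sets_noise] restrict_def)
qed

lemma noise_shift_coordinate:
  assumes g[measurable]: "g \<in> borel_measurable noise"
  shows "(\<integral>\<^sup>+\<xi>. g (\<xi>(i := \<xi> i + m)) \<partial>noise) = (\<integral>\<^sup>+\<xi>. g \<xi> * ennreal (likelihood m (\<xi> i)) \<partial>noise)"
proof -
  have m1: "(\<lambda>\<xi>. \<xi>(i := \<xi> i + m)) \<in> measurable noise noise"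
    by (rule noise_measurableI) (simp add: fun_upd_def)
  have m2: "(\<lambda>x. g (X(i := x))) \<in> borel_measurable borel" for X
  proof -
    have "(\<lambda>x. X(i := x)) \<in> measurable borel noise" by (rule noise_measurableI) (simp add: fun_upd_def)
    then show ?thesis by (rule measurable_compose) (rule g)
  qed
  have "(\<integral>\<^sup>+\<xi>. g (\<xi>(i := \<xi> i + m)) \<partial>noise) = (\<integral>\<^sup>+X. \<integral>\<^sup>+x. g (X(i := x + m)) \<partial>std_normal_distribution \<partial>noise)"
    by (subst nn_integral_noise_resample[OF measurable_compose[OF m1 g], of i]) simp
  also have "\<dots> = (\<integral>\<^sup>+X. \<integral>\<^sup>+x. g (X(i := x)) * ennreal (likelihood m x) \<partial>std_normal_distribution \<partial>noise)"
    by (intro nn_integral_cong std_normal_shift m2)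
  also have "\<dots> = (\<integral>\<^sup>+\<xi>. g \<xi> * ennreal (likelihood m (\<xi> i)) \<partial>noise)"
    by (subst nn_integral_noise_resample[of "\<lambda>\<xi>. g \<xi> * ennreal (likelihood m (\<xi> i))" i]) simp_all
  finally show ?thesis .
qed

definition shift_upto :: "(nat \<Rightarrow> real) \<Rightarrow> nat \<Rightarrow> (nat \<Rightarrow> real) \<Rightarrow> nat \<Rightarrow> real" where
  "shift_upto m n \<xi> = (\<lambda>i. if i < n then \<xi> i + m i else \<xi> i)"

lemma shift_upto_measurable[measurable]: "shift_upto m n \<in> measurable noise noise"
  by (rule noise_measurableI) (auto simp: shift_upto_def)

lemma noise_shift_upto:
  assumes "g \<in> borel_measurable noise"
  shows "(\<integral>\<^sup>+\<xi>. g (shift_upto m n \<xi>) \<partial>noise) = (\<integral>\<^sup>+\<xi>. g \<xi> * (\<Prod>i<n. ennreal (likelihood (m i) (\<xi> i))) \<partial>noise)"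
  using assms
proof (induction n arbitrary: g)
  case 0
  then show ?case by (simp add: shift_upto_def)
next
  case (Suc n)
  note g[measurable] = Suc.prems
  have s: "shift_upto m (Suc n) \<xi> = shift_upto m n (\<xi>(n := \<xi> n + m n))" for \<xi>
    by (auto simp: shift_upto_def)
  have "(\<integral>\<^sup>+\<xi>. g (shift_upto m (Suc n) \<xi>) \<partial>noise) = (\<integral>\<^sup>+\<xi>. g (shift_upto m n \<xi>) * ennreal (likelihood (m n) (\<xi> n)) \<partial>noise)"
    unfolding s by (rule noise_shift_coordinate[where g="\<lambda>\<xi>. g (shift_upto m n \<xi>)"]) measurable
  also have "\<dots> = (\<integral>\<^sup>+\<xi>. (\<lambda>\<xi>. g \<xi> * ennreal (likelihood (m n) (\<xi> n))) (shift_upto m n \<xi>) \<partial>noise)"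
    by (simp add: shift_upto_def)
  also have "\<dots> = (\<integral>\<^sup>+\<xi>. (g \<xi> * ennreal (likelihood (m n) (\<xi> n))) * (\<Prod>i<n. ennreal (likelihood (m i) (\<xi> i))) \<partial>noise)"
    by (rule Suc.IH) measurable
  finally show ?case by (simp add: mult_ac)
qed

text \<open>The Cauchy-Schwarz inequality for the indicator of \<open>E\<close> and the likelihood
  ratio \<open>L\<close>. The second moment of \<open>L\<close> is exp of the sum of the squared
  shifts, since its square is the likelihood ratio for the doubled shift, which integrates to
  1.\<close>

lemma noise_shift_upto_le:
  assumes E[measurable]: "E \<in> sets noise" and M: "(\<Sum>i<n. (m i)\<^sup>2) \<le> M"
  shows "(measure noise (shift_upto m n -` E))\<^sup>2 \<le> exp M * measure noise E"
proof -
  define L where "L \<xi> = (\<Prod>i<n. ennreal (likelihood (m i) (\<xi> i)))" for \<xi>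
  have [measurable]: "L \<in> borel_measurable noise" unfolding L_def by measurable
  have L2: "(L \<xi>)\<^sup>2 = ennreal (exp (\<Sum>i<n. (m i)\<^sup>2)) * (\<Prod>i<n. ennreal (likelihood (2 * m i) (\<xi> i)))" for \<xi>
  proof -
    have "(L \<xi>)\<^sup>2 = (\<Prod>i<n. ennreal (exp ((m i)\<^sup>2)) * ennreal (likelihood (2 * m i) (\<xi> i)))"
      unfolding L_def prod_power_distrib
      by (intro prod.cong refl) (simp add: likelihood_square ennreal_power likelihood_nonneg flip: ennreal_mult)
    then show ?thesis by (simp add: prod.distrib exp_sum prod_ennreal)
  qed
  have "emeasure noise (shift_upto m n -` E) = (\<integral>\<^sup>+\<xi>. indicator E (shift_upto m n \<xi>) \<partial>noise)"
  proof -
    have "shift_upto m n -` E \<in> sets noise" using measurable_sets[OF shift_upto_measurable E] by simp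
    then have "emeasure noise (shift_upto m n -` E) = (\<integral>\<^sup>+\<xi>. indicator (shift_upto m n -` E) \<xi> \<partial>noise)" by simp
    also have "indicator (shift_upto m n -` E) = (\<lambda>\<xi>. indicator E (shift_upto m n \<xi>) :: ennreal)"
      by (auto simp: indicator_def)
    finally show ?thesis .
  qed
  also have "\<dots> = (\<integral>\<^sup>+\<xi>. indicator E \<xi> * L \<xi> \<partial>noise)" unfolding L_def by (rule noise_shift_upto) measurable
  finally have "(emeasure noise (shift_upto m n -` E))\<^sup>2 \<le> (\<integral>\<^sup>+\<xi>. (indicator E \<xi>)\<^sup>2 \<partial>noise) * (\<integral>\<^sup>+\<xi>. (L \<xi>)\<^sup>2 \<partial>noise)"
    using Cauchy_Schwarz_nn_integral[of "indicator E" noise L] by simp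
  also have "(\<integral>\<^sup>+\<xi>. (indicator E \<xi>)\<^sup>2 \<partial>noise) = emeasure noise E"
    by (subst nn_integral_indicator[OF E, symmetric], intro nn_integral_cong) (auto simp: indicator_def)
  also have "(\<integral>\<^sup>+\<xi>. (L \<xi>)\<^sup>2 \<partial>noise) = ennreal (exp (\<Sum>i<n. (m i)\<^sup>2)) * (\<integral>\<^sup>+\<xi>. 1 * (\<Prod>i<n. ennreal (likelihood (2 * m i) (\<xi> i))) \<partial>noise)"
    unfolding L2 by (subst nn_integral_cmult[symmetric]) auto
  also have "(\<integral>\<^sup>+\<xi>. 1 * (\<Prod>i<n. ennreal (likelihood (2 * m i) (\<xi> i))) \<partial>noise) = 1"
    by (subst noise_shift_upto[where g="\<lambda>_. 1" and m="\<lambda>i. 2 * m i", symmetric]) (auto simp: noise.emeasure_space_1[unfolded space_noise])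
  finally have "ennreal ((measure noise (shift_upto m n -` E))\<^sup>2) \<le> ennreal (measure noise E * exp (\<Sum>i<n. (m i)\<^sup>2))"
    by (simp add: noise.emeasure_eq_measure ennreal_mult ennreal_power)
  then have "(measure noise (shift_upto m n -` E))\<^sup>2 \<le> measure noise E * exp (\<Sum>i<n. (m i)\<^sup>2)"
    by simp
  also have "\<dots> \<le> measure noise E * exp M" using M by (intro mult_left_mono) auto
  finally show ?thesis by (simp add: mult.commute)
qed

section \<open>Approximation by cylinder sets\<close>

definition finite_cylinder :: "(nat \<Rightarrow> real) set \<Rightarrow> bool" where
  "finite_cylinder C \<longleftrightarrow> C \<in> sets noise \<and> (\<exists>n. \<forall>\<xi> \<xi>'. (\<forall>i<n. \<xi> i = \<xi>' i) \<longrightarrow> (\<xi> \<in> C \<longleftrightarrow> \<xi>' \<in> C))"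

text \<open>One cylinder has to be close under both measures, because the shift inequality compares
  two measures of the same set.\<close>

definition approximable :: "(nat \<Rightarrow> real) measure \<Rightarrow> (nat \<Rightarrow> real) measure \<Rightarrow> (nat \<Rightarrow> real) set \<Rightarrow> bool" where
  "approximable P Q E \<longleftrightarrow> (\<forall>e>0. \<exists>C. finite_cylinder C \<and>
     measure P (sym_diff E C) < e \<and> measure Q (sym_diff E C) < e)"

lemma sym_diff_sets: "A \<in> sets P \<Longrightarrow> B \<in> sets P \<Longrightarrow> sym_diff A B \<in> sets P"
  by auto

lemma finite_cylinder_Un: "finite_cylinder A \<Longrightarrow> finite_cylinder B \<Longrightarrow> finite_cylinder (A \<union> B)"
proof -
  assume "finite_cylinder A" "finite_cylinder B"
  then obtain n n' where sets: "A \<in> sets noise" "B \<in> sets noise"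
    and n: "\<And>\<xi> \<xi>'. \<forall>i<n. \<xi> i = \<xi>' i \<Longrightarrow> (\<xi> \<in> A \<longleftrightarrow> \<xi>' \<in> A)"
    and n': "\<And>\<xi> \<xi>'. \<forall>i<n'. \<xi> i = \<xi>' i \<Longrightarrow> (\<xi> \<in> B \<longleftrightarrow> \<xi>' \<in> B)"
    unfolding finite_cylinder_def by blast
  have "\<xi> \<in> A \<union> B \<longleftrightarrow> \<xi>' \<in> A \<union> B" if "\<forall>i<max n n'. \<xi> i = \<xi>' i" for \<xi> \<xi>'
    using n[of \<xi> \<xi>'] n'[of \<xi> \<xi>'] that by auto
  then show ?thesis using sets unfolding finite_cylinder_def by blast
qed

lemma finite_cylinder_Compl: "finite_cylinder A \<Longrightarrow> finite_cylinder (- A)"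
  unfolding finite_cylinder_def using sets.compl_sets[of A noise] by (auto simp: Compl_eq_Diff_UNIV)

lemma finite_cylinder_empty: "finite_cylinder {}"
  by (auto simp: finite_cylinder_def)

text \<open>The approximable sets form a sigma-algebra: complements have the same symmetric
  differences, and a countable union is close to a finite one under both measures, by continuity
  from above.\<close>

lemma approximable_all:
  assumes P: "prob_space P" "sets P = sets noise" and Q: "prob_space Q" "sets Q = sets noise"
    and E: "E \<in> sets noise"
  shows "approximable P Q E"
proof -
  interpret P: prob_space P by fact
  interpret Q: prob_space Q by fact
  have cs: "finite_cylinder C \<Longrightarrow> C \<in> sets noise" for C by (simp add: finite_cylinder_def)
  have mono: "measure R A \<le> measure R B" if "R = P \<or> R = Q" "A \<subseteq> B" "B \<in> sets noise" for R A B
    using that P Q P.finite_measure_mono[of A B] Q.finite_measure_mono[of A B] by auto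
  have Un: "measure R (A \<union> B) \<le> measure R A + measure R B" if "R = P \<or> R = Q" "A \<in> sets noise" "B \<in> sets noise" for R A B
    using that P Q by (auto intro: measure_Un_le)
  have aUn: "approximable P Q (A \<union> B)" if A: "A \<in> sets noise" "approximable P Q A" and B: "B \<in> sets noise" "approximable P Q B" for A B
    unfolding approximable_def
  proof (intro allI impI)
    fix e :: real assume e: "e > 0"
    obtain C where C: "finite_cylinder C" "measure P (sym_diff A C) < e / 2" "measure Q (sym_diff A C) < e / 2"
      using A(2) e unfolding approximable_def by (meson half_gt_zero)
    obtain C' where C': "finite_cylinder C'" "measure P (sym_diff B C') < e / 2" "measure Q (sym_diff B C') < e / 2"
      using B(2) e unfolding approximable_def by (meson half_gt_zero)
    have s: "sym_diff A C \<in> sets noise" "sym_diff B C' \<in> sets noise" using A B C C' cs by (auto intro!: sym_diff_sets)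
    have "measure R (sym_diff (A \<union> B) (C \<union> C')) \<le> measure R (sym_diff A C) + measure R (sym_diff B C')" if "R = P \<or> R = Q" for R
      using that s by (intro order.trans[OF mono Un]) auto
    then show "\<exists>C. finite_cylinder C \<and> measure P (sym_diff (A \<union> B) C) < e \<and> measure Q (sym_diff (A \<union> B) C) < e"
      using C C' by (intro exI[of _ "C \<union> C'"]) (smt (verit) finite_cylinder_Un field_sum_of_halves)
  qed
  have "E \<in> sigma_sets (\<Pi>\<^sub>E i\<in>UNIV. space borel) {{f\<in>\<Pi>\<^sub>E i\<in>UNIV. space borel. f i \<in> A} | i A. i \<in> UNIV \<and> A \<in> sets borel}"
    using E unfolding sets_noise sets_PiM_single .
  then have "E \<in> sets noise \<and> approximable P Q E"
  proof (induction rule: sigma_sets.induct)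
    case (Basic A)
    then obtain i B where A: "A = {\<xi>. \<xi> i \<in> B}" "B \<in> sets borel" by (auto simp: PiE_def)
    have "finite_cylinder A"
      unfolding finite_cylinder_def
    proof (intro conjI exI[of _ "Suc i"])
      have "(\<lambda>\<xi>. \<xi> i) -` B \<inter> space noise \<in> sets noise"
        using A(2) by (intro measurable_sets[OF noise_component_measurable])
      then show "A \<in> sets noise" by (simp add: A vimage_def)
    qed (auto simp: A)
    then show ?case using cs by (auto simp: approximable_def intro!: exI[of _ A])
  next
    case Empty
    then show ?case using finite_cylinder_empty by (auto simp: approximable_def intro!: exI[of _ "{}"])
  next
    case (Compl A)
    have s: "sym_diff (UNIV - A) (- C) = sym_diff A C" for C by auto
    have "approximable P Q (UNIV - A)"
      using Compl(2) finite_cylinder_Compl s unfolding approximable_def by metis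
    then show ?case using Compl sets.compl_sets[of A noise] by (auto simp: PiE_def)
  next
    case (Union a)
    have as: "a k \<in> sets noise" for k using Union by auto
    have aU: "(\<Union>k<n. a k) \<in> sets noise \<and> approximable P Q (\<Union>k<n. a k)" for n
    proof (induction n)
      case 0 then show ?case using finite_cylinder_empty by (auto simp: approximable_def intro!: exI[of _ "{}"])
    next
      case (Suc n)
      then show ?case using aUn[of "\<Union>k<n. a k" "a n"] Union(2)[of n] by (auto simp: lessThan_Suc Un_commute)
    qed
    have "approximable P Q (\<Union>k. a k)"
      unfolding approximable_def
    proof (intro allI impI)
      fix e :: real assume e: "e > 0"
      have lim: "(\<lambda>n. measure R ((\<Union>k. a k) - (\<Union>k<n. a k))) \<longlonglongrightarrow> 0" if R: "R = P \<or> R = Q" for R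
      proof -
        interpret R: prob_space R using R P Q by auto
        have sR: "sets R = sets noise" using R P Q by auto
        have "(\<lambda>n. measure R ((\<Union>k. a k) - (\<Union>k<n. a k))) \<longlonglongrightarrow> measure R (\<Inter>n. (\<Union>k. a k) - (\<Union>k<n. a k))"
          using as sR by (intro R.finite_Lim_measure_decseq) (auto simp: decseq_def)
        moreover have "(\<Inter>n. (\<Union>k. a k) - (\<Union>k<n. a k)) = {}" by auto
        ultimately show ?thesis by (simp only: measure_empty)
      qed
      have "\<forall>\<^sub>F n in sequentially. measure P ((\<Union>k. a k) - (\<Union>k<n. a k)) < e / 2 \<and> measure Q ((\<Union>k. a k) - (\<Union>k<n. a k)) < e / 2"
        using e by (intro eventually_conj order_tendstoD(2)[OF lim]) auto
      then obtain n where n: "measure P ((\<Union>k. a k) - (\<Union>k<n. a k)) < e / 2" "measure Q ((\<Union>k. a k) - (\<Union>k<n. a k)) < e / 2"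
        by (auto simp: eventually_sequentially)
      obtain C where C: "finite_cylinder C" "measure P (sym_diff (\<Union>k<n. a k) C) < e / 2" "measure Q (sym_diff (\<Union>k<n. a k) C) < e / 2"
        using aU[of n] e unfolding approximable_def by (meson half_gt_zero)
      have s: "sym_diff (\<Union>k<n. a k) C \<in> sets noise" "(\<Union>k. a k) - (\<Union>k<n. a k) \<in> sets noise"
        using as C cs aU[of n] by auto
      have "measure R (sym_diff (\<Union>k. a k) C) \<le> measure R ((\<Union>k. a k) - (\<Union>k<n. a k)) + measure R (sym_diff (\<Union>k<n. a k) C)" if "R = P \<or> R = Q" for R
        using that s by (intro order.trans[OF mono Un]) auto
      then show "\<exists>C. finite_cylinder C \<and> measure P (sym_diff (\<Union>k. a k) C) < e \<and> measure Q (sym_diff (\<Union>k. a k) C) < e"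
        using C n by (intro exI[of _ C]) (smt (verit) field_sum_of_halves)
    qed
    then show ?case using as by auto
  qed
  then show ?thesis by simp
qed

lemma shift_measurable[measurable]: "(\<lambda>\<xi> i. \<xi> i + m i) \<in> measurable noise noise"
  by (rule noise_measurableI) simp

text \<open>A cylinder sees finitely many shifted coordinates, and the finite-dimensional bound
  depends on \<open>m\<close> only through \<open>M\<close>; approximation extends it to all
  measurable sets. No density of the infinite product is constructed.\<close>

theorem noise_shift_le:
  assumes E[measurable]: "E \<in> sets noise" and M: "\<And>n. (\<Sum>i<n. (m i)\<^sup>2) \<le> M"
  shows "(measure noise ((\<lambda>\<xi> i. \<xi> i + m i) -` E))\<^sup>2 \<le> exp M * measure noise E"
proof -
  let ?T = "\<lambda>\<xi> i. \<xi> i + m i :: real"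
  define Q where "Q = distr noise noise ?T"
  interpret Q: prob_space Q unfolding Q_def by (rule noise.prob_space_distr) measurable
  have sQ: "sets Q = sets noise" by (simp add: Q_def)
  have Q: "measure Q A = measure noise (?T -` A)" if "A \<in> sets noise" for A
    unfolding Q_def using that by (subst measure_distr) (auto simp: shift_measurable)
  have cyl: "(measure Q C)\<^sup>2 \<le> exp M * measure noise C" if C: "finite_cylinder C" for C
  proof -
    obtain n where n: "\<And>\<xi> \<xi>'. (\<And>i. i < n \<Longrightarrow> \<xi> i = \<xi>' i) \<Longrightarrow> (\<xi> \<in> C \<longleftrightarrow> \<xi>' \<in> C)" and Cs: "C \<in> sets noise"
      using C unfolding finite_cylinder_def by blast
    have "?T -` C = shift_upto m n -` C"
      unfolding vimage_def by (intro Collect_cong n) (simp add: shift_upto_def)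
    then show ?thesis using noise_shift_upto_le[OF Cs M, of n] Q[OF Cs] by simp
  qed
  have ap: "approximable noise Q E"
    by (intro approximable_all noise.prob_space_axioms Q.prob_space_axioms sQ E refl)
  have "(measure Q E)\<^sup>2 \<le> exp M * measure noise E + e" if e: "e > 0" for e
  proof -
    \<comment> \<open>The error is 2 d from the difference of two squared probabilities and exp M
      times d from the bound, in total \<open>e\<close>.\<close>
    define d where "d = e / (2 + exp M)"
    have d: "d > 0" using e by (simp add: d_def add_pos_pos)
    obtain C where C: "finite_cylinder C" "measure noise (sym_diff E C) < d" "measure Q (sym_diff E C) < d"
      using ap d unfolding approximable_def by blast
    have Cs: "C \<in> sets noise" using C by (simp add: finite_cylinder_def)
    have QE: "measure Q E \<le> measure Q C + d"
    proof -
      have "measure Q E \<le> measure Q (C \<union> sym_diff E C)" using E Cs sQ by (intro Q.finite_measure_mono) auto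
      also have "\<dots> \<le> measure Q C + measure Q (sym_diff E C)" using E Cs sQ by (intro measure_Un_le) auto
      finally show ?thesis using C by simp
    qed
    have NC: "measure noise C \<le> measure noise E + d"
    proof -
      have "measure noise C \<le> measure noise (E \<union> sym_diff E C)" using E Cs by (intro noise.finite_measure_mono) auto
      also have "\<dots> \<le> measure noise E + measure noise (sym_diff E C)" using E Cs by (intro measure_Un_le) auto
      finally show ?thesis using C by simp
    qed
    have "(measure Q E)\<^sup>2 - (measure Q C)\<^sup>2 = (measure Q E - measure Q C) * (measure Q E + measure Q C)"
      by (simp add: power2_eq_square algebra_simps)
    also have "\<dots> \<le> d * 2"
    proof (cases "measure Q E \<ge> measure Q C")
      case True
      have "measure Q E + measure Q C \<le> 2" using Q.prob_le_1[of E] Q.prob_le_1[of C] by linarith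
      then show ?thesis using QE True d by (intro mult_mono) auto
    next
      case False
      then have "(measure Q E - measure Q C) * (measure Q E + measure Q C) \<le> 0" by (intro mult_nonpos_nonneg) auto
      then show ?thesis using d by linarith
    qed
    finally have "(measure Q E)\<^sup>2 \<le> (measure Q C)\<^sup>2 + d * 2" by simp
    also have "\<dots> \<le> exp M * (measure noise E + d) + d * 2"
      using order.trans[OF cyl[OF C(1)] mult_left_mono[OF NC, of "exp M"]] by simp
    also have "\<dots> = exp M * measure noise E + d * (2 + exp M)" by (simp add: algebra_simps)
    also have "d * (2 + exp M) = e" using add_pos_pos[of 2 "exp M"] by (simp add: d_def)
    finally show ?thesis .
  qed
  then have "(measure Q E)\<^sup>2 \<le> exp M * measure noise E" by (rule field_le_epsilon)
  then show ?thesis using Q[OF E] by simp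
qed

section \<open>Non-estimability\<close>

lemma prob_space_noise_pair: "prob_space (noise \<Otimes>\<^sub>M noise)"
proof -
  interpret pair_prob_space noise noise by standard
  show ?thesis by (rule prob_space_axioms)
qed

interpretation noise_pair: prob_space "noise \<Otimes>\<^sub>M noise"
  by (rule prob_space_noise_pair)

interpretation noise_pair_sf: pair_sigma_finite noise noise
  by standard

lemma centred_gaussian_pair:
  assumes f: "centred_gaussian noise f v" and g: "centred_gaussian noise g w"
  shows "centred_gaussian (noise \<Otimes>\<^sub>M noise) (\<lambda>p. f (fst p) + g (snd p)) (v + w)"
proof (rule centred_gaussianI_char[OF prob_space_noise_pair])
  have [measurable]: "f \<in> borel_measurable noise" "g \<in> borel_measurable noise"
    using f g by (auto simp: centred_gaussian_def)
  show "v + w \<ge> 0" using f g by (auto simp: centred_gaussian_def)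
  show "(\<lambda>p. f (fst p) + g (snd p)) \<in> borel_measurable (noise \<Otimes>\<^sub>M noise)" by measurable
  fix \<theta>
  have c: "char (distr noise borel h) \<theta> = (CLINT \<xi>|noise. iexp (\<theta> * h \<xi>))" if [measurable]: "h \<in> borel_measurable noise" for h
    unfolding char_def by (subst integral_distr) auto
  have "char (distr (noise \<Otimes>\<^sub>M noise) borel (\<lambda>p. f (fst p) + g (snd p))) \<theta>
      = (CLINT p|noise \<Otimes>\<^sub>M noise. iexp (\<theta> * (f (fst p) + g (snd p))))"
    unfolding char_def by (subst integral_distr) auto
  also have "\<dots> = (CLINT \<eta>|noise. CLINT \<xi>|noise. iexp (\<theta> * (f (fst (\<eta>, \<xi>)) + g (snd (\<eta>, \<xi>)))))"
    by (intro noise_pair_sf.integral_fst'[symmetric] noise_pair.integrable_const_bound[where B=1]) auto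
  also have "\<dots> = (CLINT \<eta>|noise. iexp (\<theta> * f \<eta>) * (CLINT \<xi>|noise. iexp (\<theta> * g \<xi>)))"
    by (simp add: distrib_left exp_add)
  also have "\<dots> = (CLINT \<eta>|noise. iexp (\<theta> * f \<eta>)) * (CLINT \<xi>|noise. iexp (\<theta> * g \<xi>))"
    by (rule integral_mult_left_zero)
  also have "\<dots> = complex_of_real (exp (- \<theta>\<^sup>2 * v / 2)) * complex_of_real (exp (- \<theta>\<^sup>2 * w / 2))"
    using c[of f] c[of g] char_centred_gaussian[OF f, of \<theta>] char_centred_gaussian[OF g, of \<theta>] by simp
  also have "\<dots> = complex_of_real (exp (- \<theta>\<^sup>2 * (v + w) / 2))"
    by (simp add: algebra_simps add_divide_distrib diff_divide_distrib flip: of_real_mult exp_add)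
  finally show "char (distr (noise \<Otimes>\<^sub>M noise) borel (\<lambda>p. f (fst p) + g (snd p))) \<theta> = complex_of_real (exp (- \<theta>\<^sup>2 * (v + w) / 2))" .
qed

section \<open>Gaussian fields from feature expansions\<close>

lemma square_summable_zero: "square_summable (\<lambda>_. 0)"
  by (simp add: square_summable_def)

lemma isonormal_zero: "AE \<xi> in noise. isonormal (\<lambda>_. 0) \<xi> = 0"
  using isonormal_linear[OF square_summable_zero square_summable_zero, of 0 0] by simp

lemma
  assumes "finite S" and v: "\<And>s. s \<in> S \<Longrightarrow> square_summable (v s)"
  shows square_summable_sum: "square_summable (\<lambda>i. \<Sum>s\<in>S. a s * v s i)"
    and isonormal_sum: "AE \<xi> in noise. isonormal (\<lambda>i. \<Sum>s\<in>S. a s * v s i) \<xi> = (\<Sum>s\<in>S. a s * isonormal (v s) \<xi>)"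
proof -
  have "square_summable (\<lambda>i. \<Sum>s\<in>S. a s * v s i) \<and>
     (AE \<xi> in noise. isonormal (\<lambda>i. \<Sum>s\<in>S. a s * v s i) \<xi> = (\<Sum>s\<in>S. a s * isonormal (v s) \<xi>))"
    using assms
  proof (induction S rule: finite_induct)
    case empty
    then show ?case using isonormal_zero square_summable_zero by simp
  next
    case (insert s S)
    then have IH: "square_summable (\<lambda>i. \<Sum>s\<in>S. a s * v s i)"
      "AE \<xi> in noise. isonormal (\<lambda>i. \<Sum>s\<in>S. a s * v s i) \<xi> = (\<Sum>s\<in>S. a s * isonormal (v s) \<xi>)"
      and s: "square_summable (v s)" by auto
    have "square_summable (\<lambda>i. a s * v s i + 1 * (\<Sum>s\<in>S. a s * v s i))" by (rule square_summable_add[OF s IH(1)])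
    moreover have "AE \<xi> in noise. isonormal (\<lambda>i. a s * v s i + 1 * (\<Sum>s\<in>S. a s * v s i)) \<xi> =
        a s * isonormal (v s) \<xi> + 1 * isonormal (\<lambda>i. \<Sum>s\<in>S. a s * v s i) \<xi>" by (rule isonormal_linear[OF s IH(1)])
    ultimately show ?case using IH(2) insert.hyps by (auto elim!: eventually_elim2)
  qed
  then show "square_summable (\<lambda>i. \<Sum>s\<in>S. a s * v s i)"
    "AE \<xi> in noise. isonormal (\<lambda>i. \<Sum>s\<in>S. a s * v s i) \<xi> = (\<Sum>s\<in>S. a s * isonormal (v s) \<xi>)" by auto
qed

lemma square_summable_feature: "psd_kernel K \<Longrightarrow> dense_for K q \<Longrightarrow> square_summable (feature K q t)"
  using feature_square_sums[of K q t] by (auto simp: square_summable_def sums_iff)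

text \<open>With the features of \<open>t\<close> as coefficients, the Gaussian series is a centred
  field with covariance \<open>K\<close>, because inner products of features reproduce the
  kernel.\<close>

lemma isonormal_feature_gaussian:
  assumes K: "psd_kernel K" "dense_for K q" and S: "finite S"
  shows "centred_gaussian noise (\<lambda>\<xi>. \<Sum>s\<in>S. a s * isonormal (feature K q s) \<xi>) (qform K S a)"
proof -
  have f: "square_summable (feature K q t)" for t by (rule square_summable_feature[OF K])
  have "(\<lambda>i. \<Sum>s\<in>S. \<Sum>t\<in>S. a s * a t * (feature K q s i * feature K q t i)) sums qform K S a"
    unfolding qform_def by (intro sums_sum sums_mult feature_sums K)
  moreover have "(\<Sum>s\<in>S. \<Sum>t\<in>S. a s * a t * (feature K q s i * feature K q t i)) = (\<Sum>s\<in>S. a s * feature K q s i)\<^sup>2" for i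
    by (simp add: power2_eq_square sum_product mult_ac)
  ultimately have "norm_sq (\<lambda>i. \<Sum>s\<in>S. a s * feature K q s i) = qform K S a"
    by (simp add: norm_sq_def sums_iff)
  then have "centred_gaussian noise (isonormal (\<lambda>i. \<Sum>s\<in>S. a s * feature K q s i)) (qform K S a)"
    using isonormal_gaussian[OF square_summable_sum[OF S f, of a "\<lambda>s. s"]] by simp
  then show ?thesis
    by (rule centred_gaussian_cong_AE[OF _ isonormal_sum[OF S f, of a "\<lambda>s. s"]]) measurable
qed

lemma field_measurable:
  "fieldX s \<in> borel_measurable (\<Pi>\<^sub>M s\<in>UNIV. borel)" "fieldW s \<in> borel_measurable (\<Pi>\<^sub>M s\<in>UNIV. borel)"
proof -
  have c: "(\<lambda>\<omega>. \<omega> s) \<in> measurable (\<Pi>\<^sub>M s\<in>UNIV. borel) (borel :: (real \<times> real) measure)"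
    by (rule measurable_component_singleton) simp
  show "fieldX s \<in> borel_measurable (\<Pi>\<^sub>M s\<in>UNIV. borel)" "fieldW s \<in> borel_measurable (\<Pi>\<^sub>M s\<in>UNIV. borel)"
    unfolding fieldX_def[abs_def] fieldW_def[abs_def] using borel_measurable_fst_snd[THEN measurable_compose[OF c]] .
qed

text \<open>The fields are driven by separate components of the product space and are therefore
  independent.\<close>

definition field_map :: "(real \<Rightarrow> nat \<Rightarrow> real) \<Rightarrow> (real \<Rightarrow> nat \<Rightarrow> real) \<Rightarrow> (nat \<Rightarrow> real) \<times> (nat \<Rightarrow> real) \<Rightarrow> real \<Rightarrow> real \<times> real" where
  "field_map e w p t = (isonormal (e t) (fst p), isonormal (w t) (snd p))"

definition field_law :: "(real \<Rightarrow> nat \<Rightarrow> real) \<Rightarrow> (real \<Rightarrow> nat \<Rightarrow> real) \<Rightarrow> (real \<Rightarrow> real \<times> real) measure" where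
  "field_law e w = distr (noise \<Otimes>\<^sub>M noise) (\<Pi>\<^sub>M s\<in>UNIV. borel) (field_map e w)"

lemma field_map_measurable[measurable]: "field_map e w \<in> measurable (noise \<Otimes>\<^sub>M noise) (\<Pi>\<^sub>M s\<in>UNIV. borel)"
proof -
  have "(\<lambda>p. \<lambda>t\<in>UNIV. field_map e w p t) \<in> measurable (noise \<Otimes>\<^sub>M noise) (\<Pi>\<^sub>M s\<in>UNIV. borel)"
    unfolding field_map_def by (intro measurable_restrict borel_measurable_Pair) measurable
  then show ?thesis by (simp add: restrict_def)
qed

lemma bivariate_law_field_law: "bivariate_law (field_law e w)"
  unfolding bivariate_law_def field_law_def
  by (auto intro: noise_pair.prob_space_distr)

lemma lin_comb_gaussian:
  assumes KX: "psd_kernel KX" "dense_for KX q" and KW: "psd_kernel KW" "dense_for KW q" and S: "finite S"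
  shows "centred_gaussian (field_law (feature KX q) (feature KW q)) (lin_comb S a b) (qform KX S a + qform KW S b)"
proof -
  let ?F = "field_map (feature KX q) (feature KW q)"
  have g: "centred_gaussian (noise \<Otimes>\<^sub>M noise) (\<lambda>p. (\<Sum>s\<in>S. a s * isonormal (feature KX q s) (fst p))
      + (\<Sum>s\<in>S. b s * isonormal (feature KW q s) (snd p))) (qform KX S a + qform KW S b)"
    by (intro centred_gaussian_pair isonormal_feature_gaussian KX KW S)
  have m[measurable]: "lin_comb S a b \<in> borel_measurable (\<Pi>\<^sub>M s\<in>UNIV. borel)"
    unfolding lin_comb_def[abs_def]
    by (intro borel_measurable_sum borel_measurable_add borel_measurable_times field_measurable borel_measurable_const)
  have e: "lin_comb S a b (?F p) = (\<Sum>s\<in>S. a s * isonormal (feature KX q s) (fst p))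
      + (\<Sum>s\<in>S. b s * isonormal (feature KW q s) (snd p))" for p
    by (simp add: lin_comb_def field_map_def fieldX_def fieldW_def sum.distrib)
  have "distr (field_law (feature KX q) (feature KW q)) borel (lin_comb S a b) = distr (noise \<Otimes>\<^sub>M noise) borel (\<lambda>p. lin_comb S a b (?F p))"
    unfolding field_law_def by (subst distr_distr) (auto simp: comp_def)
  then show ?thesis using g unfolding e centred_gaussian_def by (simp add: field_law_def)
qed

lemma qform_polarization:
  assumes K: "\<And>s t. K s t = K t s"
  shows "qform K S (\<lambda>s. a s + b s) - qform K S (\<lambda>s. a s - b s) = 4 * (\<Sum>s\<in>S. \<Sum>t\<in>S. a s * b t * K s t)"
proof -
  have "qform K S (\<lambda>s. a s + b s) - qform K S (\<lambda>s. a s - b s)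
     = 2 * (\<Sum>s\<in>S. \<Sum>t\<in>S. a s * b t * K s t) + 2 * (\<Sum>s\<in>S. \<Sum>t\<in>S. b s * a t * K s t)"
    unfolding qform_def by (simp add: sum_subtractf[symmetric] sum.distrib[symmetric] sum_distrib_left) (simp add: algebra_simps)
  also have "(\<Sum>s\<in>S. \<Sum>t\<in>S. b s * a t * K s t) = (\<Sum>s\<in>S. \<Sum>t\<in>S. a s * b t * K s t)"
    by (subst sum.swap) (simp add: K[of _ _] mult_ac cong: sum.cong)
  finally show ?thesis by simp
qed

lemma lin_comb_covar:
  assumes KX: "psd_kernel KX" "dense_for KX q" and KW: "psd_kernel KW" "dense_for KW q" and S: "finite S"
  defines "P \<equiv> field_law (feature KX q) (feature KW q)"
  shows "covar P (lin_comb S a b) (lin_comb S a' b') =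
     (\<Sum>s\<in>S. \<Sum>t\<in>S. a s * a' t * KX s t) + (\<Sum>s\<in>S. \<Sum>t\<in>S. b s * b' t * KW s t)"
    and "mean P (lin_comb S a b) = 0"
proof -
  note g = lin_comb_gaussian[OF KX KW S, folded P_def]
  have m: "mean P (lin_comb S a b) = 0" for a b unfolding mean_def by (rule centred_gaussian_mean[OF g])
  have p: "lin_comb S a b \<omega> * lin_comb S a' b' \<omega> =
      ((lin_comb S (\<lambda>s. a s + a' s) (\<lambda>s. b s + b' s) \<omega>)\<^sup>2 - (lin_comb S (\<lambda>s. a s - a' s) (\<lambda>s. b s - b' s) \<omega>)\<^sup>2) / 4" for \<omega>
  proof -
    have "lin_comb S (\<lambda>s. a s + a' s) (\<lambda>s. b s + b' s) \<omega> = lin_comb S a b \<omega> + lin_comb S a' b' \<omega>"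
      "lin_comb S (\<lambda>s. a s - a' s) (\<lambda>s. b s - b' s) \<omega> = lin_comb S a b \<omega> - lin_comb S a' b' \<omega>"
      by (simp_all add: lin_comb_def sum.distrib[symmetric] sum_subtractf[symmetric] algebra_simps)
    then show ?thesis by (simp only:) (simp add: power2_eq_square algebra_simps)
  qed
  have "covar P (lin_comb S a b) (lin_comb S a' b') = ((qform KX S (\<lambda>s. a s + a' s) + qform KW S (\<lambda>s. b s + b' s))
      - (qform KX S (\<lambda>s. a s - a' s) + qform KW S (\<lambda>s. b s - b' s))) / 4"
    unfolding covar_def m diff_0_right p
    using centred_gaussian_second[OF g] centred_gaussian_integrable_power[OF g, of _ _ 2] by simp
  also have "\<dots> = (\<Sum>s\<in>S. \<Sum>t\<in>S. a s * a' t * KX s t) + (\<Sum>s\<in>S. \<Sum>t\<in>S. b s * b' t * KW s t)"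
    using qform_polarization[of KX S a a'] qform_polarization[of KW S b b'] psd_kernel_sym[OF KX(1)] psd_kernel_sym[OF KW(1)] by simp
  finally show "covar P (lin_comb S a b) (lin_comb S a' b') =
     (\<Sum>s\<in>S. \<Sum>t\<in>S. a s * a' t * KX s t) + (\<Sum>s\<in>S. \<Sum>t\<in>S. b s * b' t * KW s t)" .
  show "mean P (lin_comb S a b) = 0" by (rule m)
qed

section \<open>The law with independent power exponential components\<close>

definition rational_seq :: "nat \<Rightarrow> real" where
  "rational_seq n = real_of_rat (from_nat n)"

abbreviation (input) pe_kernel :: "real \<Rightarrow> real \<Rightarrow> real \<Rightarrow> real" where
  "pe_kernel \<delta> \<equiv> \<lambda>s t. power_exponential 1 1 \<delta> (s - t)"

lemma pe_kernel_dist: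
  assumes "\<delta> > 0"
  shows "pe_kernel \<delta> t t - 2 * pe_kernel \<delta> t u + pe_kernel \<delta> u u \<le> 2 * \<bar>t - u\<bar> powr \<delta>"
  using one_minus_exp_le[of "\<bar>t - u\<bar> powr \<delta>"] assms by (simp add: power_exponential_def)

lemma pe_kernel_dense:
  assumes "\<delta> > 0"
  shows "dense_for (pe_kernel \<delta>) rational_seq"
  unfolding dense_for_def
proof (intro allI impI)
  fix t e :: real assume e: "e > 0"
  define d where "d = (e / 2) powr (1 / \<delta>)"
  have d: "d > 0" using e by (simp add: d_def)
  obtain r where r: "r \<in> \<rat>" "t < r" "r < t + d" using Rats_dense_in_real[of t "t + d"] d by auto
  then obtain x where x: "r = real_of_rat x" by (auto elim: Rats_cases)
  obtain i where i: "from_nat i = x" by (metis from_nat_to_nat)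
  have "\<bar>t - r\<bar> powr \<delta> < d powr \<delta>" using r assms by (intro powr_less_mono2) auto
  also have "d powr \<delta> = e / 2" using assms e by (simp add: d_def powr_powr)
  finally have "2 * \<bar>t - r\<bar> powr \<delta> < e" by simp
  then show "\<exists>i. pe_kernel \<delta> t t - 2 * pe_kernel \<delta> t (rational_seq i) + pe_kernel \<delta> (rational_seq i) (rational_seq i) < e"
    using pe_kernel_dist[OF assms, of t r] x i by (intro exI[of _ i]) (simp add: rational_seq_def)
qed

definition pe_feature :: "real \<Rightarrow> real \<Rightarrow> nat \<Rightarrow> real" where
  "pe_feature \<delta> = feature (pe_kernel \<delta>) rational_seq"

lemma psd_pe_kernel: "0 < \<delta> \<Longrightarrow> \<delta> < 2 \<Longrightarrow> psd_kernel (pe_kernel \<delta>)"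
  by (intro psd_power_exponential) auto

lemma square_summable_pe_feature: "0 < \<delta> \<Longrightarrow> \<delta> < 2 \<Longrightarrow> square_summable (pe_feature \<delta> t)"
  unfolding pe_feature_def by (intro square_summable_feature psd_pe_kernel pe_kernel_dense)

lemma qform_pe_kernel_pos:
  assumes "0 < \<delta>" "\<delta> < 2" "finite S" "s \<in> S" "c s \<noteq> 0"
  shows "qform (pe_kernel \<delta>) S c > 0"
  using assms by (intro power_exponential_strict psd_pe_kernel) auto

text \<open>Independence of X and W must fit the hypothesis on the cross-covariance: with c = 0 the
  exponent is free, and 3 is not an even integer and exceeds every \<delta>X < 2.\<close>

lemma condition_A_zero: "condition_A (\<lambda>_. 0) 1 0 3"
proof -
  have "real_analytic (\<lambda>_. 0)"
    unfolding real_analytic_def by (intro allI exI[of _ 1] conjI exI[of _ "\<lambda>_. 0"]) auto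
  moreover have "(3::real) \<noteq> 2 * real m" for m
  proof
    assume "(3::real) = 2 * real m"
    then have "real 3 = real (2 * m)" by simp
    then have "3 = 2 * m" by (simp only: of_nat_eq_iff)
    then show False by presburger
  qed
  ultimately show ?thesis
    unfolding condition_A_def
    by (intro conjI exI[of _ "\<lambda>_. 0"] exI[of _ "\<lambda>_ _. 0"]) auto
qed

text \<open>By independence the variance of a linear combination is the sum of two forms. Both are
  nonnegative, and strict positive definiteness makes one positive as soon as its coefficients do
  not all vanish.\<close>

theorem field_law_in_model:
  assumes \<delta>: "0 < \<delta>X" "\<delta>X < 2" "0 < \<delta>W" "\<delta>W < 2"
  shows "field_law (pe_feature \<delta>X) (pe_feature \<delta>W) \<in> model_laws \<delta>X \<delta>W"
proof -
  define P where "P = field_law (pe_feature \<delta>X) (pe_feature \<delta>W)"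
  note KX = psd_pe_kernel[OF \<delta>(1,2)] pe_kernel_dense[OF \<delta>(1)]
  note KW = psd_pe_kernel[OF \<delta>(3,4)] pe_kernel_dense[OF \<delta>(3)]
  note g = lin_comb_gaussian[OF KX KW, folded pe_feature_def P_def]
  note cov = lin_comb_covar(1)[OF KX KW, folded pe_feature_def P_def]
  note mn = lin_comb_covar(2)[OF KX KW, folded pe_feature_def P_def]
  \<comment> \<open>A single value is a linear combination over {s, t} with indicator coefficients;
    the two sites may coincide.\<close>
  define i where "i x y = (if y = x then 1 else 0::real)" for x y :: real
  have X: "fieldX x = lin_comb {s, t} (i x) (\<lambda>_. 0)" and W: "fieldW x = lin_comb {s, t} (\<lambda>_. 0) (i x)"
    if "x \<in> {s, t}" for x s t
    using that by (cases "s = t"; auto simp: lin_comb_def i_def fun_eq_iff)+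
  have d: "(\<Sum>x\<in>{s, t}. \<Sum>y\<in>{s, t}. i s x * i t y * K x y) = K s t" for s t K
    by (cases "s = t") (auto simp: i_def)
  have XX: "covar P (fieldX s) (fieldX t) = pe_kernel \<delta>X s t" for s t
    using X[of s s t] X[of t s t] cov[of "{s, t}" "i s" "\<lambda>_. 0" "i t" "\<lambda>_. 0"] d[of s t] by simp
  have WW: "covar P (fieldW s) (fieldW t) = pe_kernel \<delta>W s t" for s t
    using W[of s s t] W[of t s t] cov[of "{s, t}" "\<lambda>_. 0" "i s" "\<lambda>_. 0" "i t"] d[of s t] by simp
  have XW: "covar P (fieldX s) (fieldW t) = 0" for s t
    using X[of s s t] W[of t s t] cov[of "{s, t}" "i s" "\<lambda>_. 0" "\<lambda>_. 0" "i t"] by simp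
  have "mean P (fieldX s) = 0" "mean P (fieldW s) = 0" for s
    using X[of s s s] W[of s s s] mn[of "{s}"] by simp_all
  then have "stationary_field P" unfolding stationary_field_def by (simp add: XX WW XW)
  moreover have "gaussian_field P"
    unfolding gaussian_field_def gaussian_rv_def
  proof (intro allI impI conjI)
    fix S :: "real set" and a b assume S: "finite S"
    show "lin_comb S a b \<in> borel_measurable P" using g[OF S] by (auto simp: centred_gaussian_def)
    show "\<exists>\<mu> \<sigma>. \<sigma> \<ge> 0 \<and> distr P borel (lin_comb S a b) = distr std_normal_distribution borel (\<lambda>x. \<mu> + \<sigma> * x)"
      using g[OF S, of a b] unfolding centred_gaussian_def
      by (intro exI[of _ 0] exI[of _ "sqrt (qform (pe_kernel \<delta>X) S a + qform (pe_kernel \<delta>W) S b)"]) simp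
  qed
  moreover have "nondegenerate_field P"
    unfolding nondegenerate_field_def
  proof (intro allI impI)
    fix S :: "real set" and a b assume "finite S \<and> (\<exists>s\<in>S. a s \<noteq> (0::real) \<or> b s \<noteq> (0::real))"
    then obtain s where S: "finite S" "s \<in> S" "a s \<noteq> 0 \<or> b s \<noteq> 0" by blast
    have "qform (pe_kernel \<delta>X) S a \<ge> 0" "qform (pe_kernel \<delta>W) S b \<ge> 0"
      using psd_kernel_qform[OF KX(1) S(1)] psd_kernel_qform[OF KW(1) S(1)] by auto
    moreover have "qform (pe_kernel \<delta>X) S a > 0 \<or> qform (pe_kernel \<delta>W) S b > 0"
      using S qform_pe_kernel_pos[OF \<delta>(1,2) S(1,2)] qform_pe_kernel_pos[OF \<delta>(3,4) S(1,2)] by blast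
    ultimately show "covar P (lin_comb S a b) (lin_comb S a b) > 0"
      using cov[OF S(1), of a b a b] by (auto simp: qform_def)
  qed
  moreover have "bivariate_law P" unfolding P_def by (rule bivariate_law_field_law)
  moreover have "\<exists>K L c \<alpha>. (\<forall>s t. covar P (fieldX s) (fieldW t) = K (s - t)) \<and> condition_A K L c \<alpha> \<and> \<alpha> > \<delta>X"
    using XW condition_A_zero \<delta> by (intro exI[of _ "\<lambda>_. 0"] exI[of _ 1] exI[of _ 0] exI[of _ 3]) auto
  moreover have "\<exists>\<sigma>2>0. \<exists>\<phi>>0. \<forall>s t. covar P (fieldX s) (fieldX t) = power_exponential \<sigma>2 \<phi> \<delta>X (s - t)"
    using XX by (intro exI[of _ 1] conjI) auto
  moreover have "\<exists>\<sigma>2>0. \<exists>\<phi>>0. \<forall>s t. covar P (fieldW s) (fieldW t) = power_exponential \<sigma>2 \<phi> \<delta>W (s - t)"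
    using WW by (intro exI[of _ 1] conjI) auto
  ultimately show ?thesis unfolding model_laws_def P_def by blast
qed

section \<open>Localized features and their expected Sobolev norm\<close>

definition cutoff :: "real \<Rightarrow> real \<Rightarrow> real" where
  "cutoff R y = max 0 (min 1 (R + 1 - \<bar>y\<bar>))"

text \<open>Unchanged on [-R, R] and supported in [-R - 1, R + 1]: localization makes the squared
  features integrable over the line, and the Lipschitz cut-off does not spoil the modulus
  r^\<delta>.\<close>

definition cut_feature :: "real \<Rightarrow> real \<Rightarrow> nat \<Rightarrow> real \<Rightarrow> real" where
  "cut_feature \<delta> R k y = cutoff R y * pe_feature \<delta> y k"

lemma cutoff_bounds: "0 \<le> cutoff R y" "cutoff R y \<le> 1" "\<bar>cutoff R y - cutoff R z\<bar> \<le> \<bar>y - z\<bar>"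
  by (auto simp: cutoff_def max_def min_def abs_if)

lemma pe_feature_sums:
  assumes "0 < \<delta>" "\<delta> < 2"
  shows "(\<lambda>k. pe_feature \<delta> s k * pe_feature \<delta> t k) sums pe_kernel \<delta> s t"
  unfolding pe_feature_def using assms by (intro feature_sums psd_pe_kernel pe_kernel_dense)

text \<open>The infinite sum is the mean squared increment of the cut-off field. With
  \<open>a\<close> and \<open>b\<close> the values of the cut-off it equals (a - b)^2 plus 2 a b
  times 1 - exp (- |y - z|^\<delta>).\<close>

lemma cut_feature_diff:
  assumes \<delta>: "0 < \<delta>" "\<delta> < 2"
  shows "(\<Sum>k<n. (cut_feature \<delta> R k y - cut_feature \<delta> R k z)\<^sup>2) \<le> (y - z)\<^sup>2 + 2 * \<bar>y - z\<bar> powr \<delta>"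
proof -
  define a where "a = cutoff R y"
  define b where "b = cutoff R z"
  have ab: "0 \<le> a" "a \<le> 1" "0 \<le> b" "b \<le> 1" "\<bar>a - b\<bar> \<le> \<bar>y - z\<bar>" unfolding a_def b_def using cutoff_bounds by auto
  let ?e = "pe_feature \<delta>"
  have "(\<lambda>k. a\<^sup>2 * (?e y k * ?e y k) - 2 * a * b * (?e y k * ?e z k) + b\<^sup>2 * (?e z k * ?e z k)) sums
      (a\<^sup>2 * pe_kernel \<delta> y y - 2 * a * b * pe_kernel \<delta> y z + b\<^sup>2 * pe_kernel \<delta> z z)"
    by (intro sums_add sums_diff sums_mult pe_feature_sums \<delta>)
  moreover have "a\<^sup>2 * (?e y k * ?e y k) - 2 * a * b * (?e y k * ?e z k) + b\<^sup>2 * (?e z k * ?e z k) = (cut_feature \<delta> R k y - cut_feature \<delta> R k z)\<^sup>2" for k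
    by (simp add: cut_feature_def a_def b_def power2_eq_square algebra_simps)
  ultimately have s: "(\<lambda>k. (cut_feature \<delta> R k y - cut_feature \<delta> R k z)\<^sup>2) sums
      (a\<^sup>2 * pe_kernel \<delta> y y - 2 * a * b * pe_kernel \<delta> y z + b\<^sup>2 * pe_kernel \<delta> z z)" by simp
  then have "(\<Sum>k<n. (cut_feature \<delta> R k y - cut_feature \<delta> R k z)\<^sup>2) \<le>
      (a\<^sup>2 * pe_kernel \<delta> y y - 2 * a * b * pe_kernel \<delta> y z + b\<^sup>2 * pe_kernel \<delta> z z)"
    using sum_le_suminf[of "\<lambda>k. (cut_feature \<delta> R k y - cut_feature \<delta> R k z)\<^sup>2" "{..<n}"] by (simp add: sums_iff)
  also have "\<dots> = (a - b)\<^sup>2 + 2 * (a * b) * (1 - exp (- (\<bar>y - z\<bar> powr \<delta>)))"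
    using \<delta> by (simp add: power_exponential_def power2_eq_square algebra_simps)
  also have "\<dots> \<le> (y - z)\<^sup>2 + 2 * 1 * (\<bar>y - z\<bar> powr \<delta>)"
  proof (intro add_mono mult_mono one_minus_exp_le)
    show "(a - b)\<^sup>2 \<le> (y - z)\<^sup>2" using ab(5) by (simp add: abs_le_square_iff)
    show "a * b \<le> 1" using ab by (simp add: mult_le_one)
  qed (use ab in auto)
  finally show ?thesis by simp
qed

lemma cut_feature_square:
  assumes \<delta>: "0 < \<delta>" "\<delta> < 2"
  shows "(\<Sum>k<n. (cut_feature \<delta> R k y)\<^sup>2) \<le> 1"
proof -
  have "(\<Sum>k<n. (pe_feature \<delta> y k)\<^sup>2) \<le> 1"
    using pe_feature_sums[OF \<delta>, of y y] sum_le_suminf[of "\<lambda>k. (pe_feature \<delta> y k)\<^sup>2" "{..<n}"] \<delta>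
    by (simp add: sums_iff power2_eq_square power_exponential_def)
  moreover have "(\<Sum>k<n. (cut_feature \<delta> R k y)\<^sup>2) \<le> (\<Sum>k<n. (pe_feature \<delta> y k)\<^sup>2)"
    unfolding cut_feature_def power_mult_distrib
    by (intro sum_mono mult_left_le_one_le) (auto simp: cutoff_bounds power_le_one)
  ultimately show ?thesis by linarith
qed

lemma cut_feature_support: "\<bar>y\<bar> > R + 1 \<Longrightarrow> cut_feature \<delta> R k y = 0"
  by (simp add: cut_feature_def cutoff_def)

lemma cut_feature_continuous:
  assumes \<delta>: "0 < \<delta>" "\<delta> < 2"
  shows "continuous_on UNIV (cut_feature \<delta> R k)"
  unfolding continuous_on_eq_continuous_at[OF open_UNIV]
proof (intro ballI)
  fix y
  have le: "\<bar>cut_feature \<delta> R k z - cut_feature \<delta> R k y\<bar> \<le> sqrt ((z - y)\<^sup>2 + 2 * \<bar>z - y\<bar> powr \<delta>)" for z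
  proof -
    have "(cut_feature \<delta> R k z - cut_feature \<delta> R k y)\<^sup>2 \<le> (\<Sum>j<Suc k. (cut_feature \<delta> R j z - cut_feature \<delta> R j y)\<^sup>2)"
      by (intro member_le_sum) auto
    also have "\<dots> \<le> (z - y)\<^sup>2 + 2 * \<bar>z - y\<bar> powr \<delta>" by (rule cut_feature_diff[OF \<delta>])
    finally show ?thesis by (metis real_sqrt_abs real_sqrt_le_mono)
  qed
  have "((\<lambda>z. sqrt ((z - y)\<^sup>2 + 2 * \<bar>z - y\<bar> powr \<delta>)) \<longlongrightarrow> sqrt ((y - y)\<^sup>2 + 2 * \<bar>y - y\<bar> powr \<delta>)) (at y)"
    using \<delta> by (intro tendsto_intros tendsto_powr2) auto
  then have "((\<lambda>z. sqrt ((z - y)\<^sup>2 + 2 * \<bar>z - y\<bar> powr \<delta>)) \<longlongrightarrow> 0) (at y)" using \<delta> by simp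
  then have "((\<lambda>z. cut_feature \<delta> R k z - cut_feature \<delta> R k y) \<longlongrightarrow> 0) (at y)"
    by (rule Lim_null_comparison[rotated]) (use le in auto)
  then show "isCont (cut_feature \<delta> R k) y" by (simp add: isCont_def LIM_zero_iff)
qed

text \<open>The sum over \<open>k\<close> is taken inside the integral, where it is at most r^2 + 2
  r^\<delta>X <= 3 r^\<delta>X uniformly in \<open>n\<close>. For r <= 1 the integrand lives on an
  interval of length 2 R + 4, whence 6 R + 12.\<close>

lemma
  assumes \<delta>: "0 < \<delta>X" "\<delta>X < 2" and R: "R \<ge> 0"
  shows cut_feature_energy: "0 < r \<Longrightarrow> r \<le> 1 \<Longrightarrow> (\<Sum>k<n. shift_energy (cut_feature \<delta>X R k) r) \<le> (6 * R + 12) * r powr \<delta>X"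
    and cut_feature_L2: "(\<Sum>k<n. \<integral>y. (cut_feature \<delta>X R k y)\<^sup>2 \<partial>lborel) \<le> 2 * R + 2"
proof -
  note c = cut_feature_continuous[OF \<delta>]
  have i: "integrable lborel (\<lambda>y. (cut_feature \<delta>X R k y - cut_feature \<delta>X R k (y - r))\<^sup>2)" for k r
    by (intro integrable_compact_support[of _ "R + 1 + \<bar>r\<bar>"] continuous_intros
      continuous_on_compose2[OF c] c) (auto simp: cut_feature_support)
  have i2: "integrable lborel (\<lambda>y. (cut_feature \<delta>X R k y)\<^sup>2)" for k
    by (intro integrable_compact_support[of _ "R + 1"] continuous_intros c) (auto simp: cut_feature_support)
  {
    assume r: "0 < r" "r \<le> 1"
    have "(\<Sum>k<n. shift_energy (cut_feature \<delta>X R k) r) = (\<integral>y. (\<Sum>k<n. (cut_feature \<delta>X R k y - cut_feature \<delta>X R k (y - r))\<^sup>2) \<partial>lborel)"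
      unfolding shift_energy_def using i by simp
    also have "\<dots> \<le> (\<integral>y. indicator {- R - 2..R + 2} y * (3 * r powr \<delta>X) \<partial>lborel)"
    proof (rule integral_mono)
      show "integrable lborel (\<lambda>y. indicator {- R - 2..R + 2} y * (3 * r powr \<delta>X))" using R by (intro integrable_Icc) auto
      fix y
      show "(\<Sum>k<n. (cut_feature \<delta>X R k y - cut_feature \<delta>X R k (y - r))\<^sup>2) \<le> indicator {- R - 2..R + 2} y * (3 * r powr \<delta>X)"
      proof (cases "y \<in> {- R - 2..R + 2}")
        case True
        have "(\<Sum>k<n. (cut_feature \<delta>X R k y - cut_feature \<delta>X R k (y - r))\<^sup>2) \<le> r\<^sup>2 + 2 * r powr \<delta>X"
          using cut_feature_diff[OF \<delta>, where y=y and z="y - r" and n=n and R=R] r by simp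
        also have "r\<^sup>2 = r powr 2" using r by simp
        also have "r powr 2 \<le> r powr \<delta>X" using r \<delta> by (intro powr_mono') auto
        finally show ?thesis using True by simp
      next
        case False
        then have "\<bar>y\<bar> > R + 1" "\<bar>y - r\<bar> > R + 1" using r by auto
        then show ?thesis using False by (simp add: cut_feature_support)
      qed
    qed (use i in auto)
    also have "\<dots> = (6 * R + 12) * r powr \<delta>X" using R by (simp add: algebra_simps)
    finally show "(\<Sum>k<n. shift_energy (cut_feature \<delta>X R k) r) \<le> (6 * R + 12) * r powr \<delta>X" .
  }
  have "(\<Sum>k<n. \<integral>y. (cut_feature \<delta>X R k y)\<^sup>2 \<partial>lborel) = (\<integral>y. (\<Sum>k<n. (cut_feature \<delta>X R k y)\<^sup>2) \<partial>lborel)"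
    using i2 by simp
  also have "\<dots> \<le> (\<integral>y. indicator {- R - 1..R + 1} y * 1 \<partial>lborel)"
  proof (rule integral_mono)
    show "integrable lborel (\<lambda>y. indicator {- R - 1..R + 1} y * (1::real))" using R by (intro integrable_Icc) auto
    fix y
    show "(\<Sum>k<n. (cut_feature \<delta>X R k y)\<^sup>2) \<le> indicator {- R - 1..R + 1} y * 1"
    proof (cases "y \<in> {- R - 1..R + 1}")
      case True then show ?thesis using cut_feature_square[OF \<delta>, where y=y and n=n and R=R] by simp
    next
      case False
      then have "\<bar>y\<bar> > R + 1" by auto
      then show ?thesis by (simp add: cut_feature_support)
    qed
  qed (use i2 in auto)
  also have "\<dots> = 2 * R + 2" using R by simp
  finally show "(\<Sum>k<n. \<integral>y. (cut_feature \<delta>X R k y)\<^sup>2 \<partial>lborel) \<le> 2 * R + 2" .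
qed

lemma shift_energy_cut_feature_le:
  assumes \<delta>: "0 < \<delta>X" "\<delta>X < 2" and R: "R \<ge> 0" and r: "0 < r" "r \<le> 1"
  shows "shift_energy (cut_feature \<delta>X R k) r \<le> (6 * R + 12) * r powr \<delta>X"
proof -
  have "shift_energy (cut_feature \<delta>X R k) r \<le> (\<Sum>j<Suc k. shift_energy (cut_feature \<delta>X R j) r)"
    by (intro member_le_sum) (auto simp: shift_energy_nonneg)
  also have "\<dots> \<le> (6 * R + 12) * r powr \<delta>X" by (rule cut_feature_energy[OF \<delta> R r])
  finally show ?thesis .
qed

text \<open>The sum is the expected squared norm of the cut-off field \<open>X\<close> in the reproducing kernel space
  of \<open>W\<close>; this is where \<open>\<delta>X > \<delta>W + 1\<close> enters.\<close>

lemma sobolev_norm_cut_feature_bounded: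
  assumes \<delta>: "0 < \<delta>W" "\<delta>X < 2" "\<delta>X > \<delta>W + 1" and R: "R \<ge> 0"
  obtains C where "\<And>n. (\<Sum>k<n. sobolev_norm \<delta>W (cut_feature \<delta>X R k)) \<le> C"
proof
  fix n
  have dX: "0 < \<delta>X" "\<delta>X < 2" and dW: "\<delta>W < 1" using \<delta> by auto
  define \<kappa> where "\<kappa> = polya_const \<delta>W * (ln 2)\<^sup>2"
  have \<kappa>: "\<kappa> > 0" using \<delta> dW by (simp add: \<kappa>_def polya_const_def)
  define B where "B = (\<integral>r. (6 * R + 12) * (indicator {0..1} r * r powr (\<delta>X - 2 - \<delta>W)) \<partial>lborel)"
  note c = cut_feature_continuous[OF dX]
  have i: "integrable lborel (\<lambda>r. indicator {0<..1} r * (r powr (- 2 - \<delta>W) * shift_energy (cut_feature \<delta>X R k) r))" for k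
    using \<delta>(3) by (intro integrable_weighted_shift_energy[OF c _ shift_energy_cut_feature_le[OF dX R]]) auto
  have "(\<Sum>k<n. \<integral>r. indicator {0<..1} r * (r powr (- 2 - \<delta>W) * shift_energy (cut_feature \<delta>X R k) r) \<partial>lborel)
     = (\<integral>r. (\<Sum>k<n. indicator {0<..1} r * (r powr (- 2 - \<delta>W) * shift_energy (cut_feature \<delta>X R k) r)) \<partial>lborel)"
    by (rule Bochner_Integration.integral_sum[symmetric]) (rule i)
  also have "\<dots> \<le> B"
    unfolding B_def
  proof (rule integral_mono)
    show "integrable lborel (\<lambda>r. (6 * R + 12) * (indicator {0..1} r * r powr (\<delta>X - 2 - \<delta>W)))"
      using \<delta> by (intro integrable_mult_right integrable_powr_from_0) auto
    fix r :: real
    show "(\<Sum>k<n. indicator {0<..1} r * (r powr (- 2 - \<delta>W) * shift_energy (cut_feature \<delta>X R k) r))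
       \<le> (6 * R + 12) * (indicator {0..1} r * r powr (\<delta>X - 2 - \<delta>W))"
    proof (cases "0 < r \<and> r \<le> 1")
      case True
      have "(\<Sum>k<n. r powr (- 2 - \<delta>W) * shift_energy (cut_feature \<delta>X R k) r) \<le> r powr (- 2 - \<delta>W) * ((6 * R + 12) * r powr \<delta>X)"
        unfolding sum_distrib_left[symmetric] using True by (intro mult_left_mono cut_feature_energy[OF dX R]) auto
      also have "r powr (- 2 - \<delta>W) * ((6 * R + 12) * r powr \<delta>X) = (6 * R + 12) * (r powr \<delta>X * r powr (- 2 - \<delta>W))"
        by (simp only: mult_ac)
      also have "r powr \<delta>X * r powr (- 2 - \<delta>W) = r powr (\<delta>X - 2 - \<delta>W)"
        unfolding powr_add[symmetric] by (simp add: algebra_simps)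
      finally show ?thesis using True by simp
    next
      case False
      then have "indicator {0<..1} r = (0::real)" by auto
      then show ?thesis using R by simp
    qed
  qed (intro Bochner_Integration.integrable_sum i)
  finally have 1: "(\<Sum>k<n. \<integral>r. indicator {0<..1} r * (r powr (- 2 - \<delta>W) * shift_energy (cut_feature \<delta>X R k) r) \<partial>lborel) \<le> B" .
  have "(\<Sum>k<n. sobolev_norm \<delta>W (cut_feature \<delta>X R k)) =
     ((\<Sum>k<n. \<integral>r. indicator {0<..1} r * (r powr (- 2 - \<delta>W) * shift_energy (cut_feature \<delta>X R k) r) \<partial>lborel)
      + (\<Sum>k<n. \<integral>y. (cut_feature \<delta>X R k y)\<^sup>2 \<partial>lborel)) / \<kappa>"
    unfolding sobolev_norm_def \<kappa>_def[symmetric] by (simp add: sum_divide_distrib[symmetric] sum.distrib)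
  also have "\<dots> \<le> (B + (2 * R + 2)) / \<kappa>"
    using 1 cut_feature_L2[OF dX R, of n] \<kappa> by (intro divide_right_mono add_mono) auto
  finally show "(\<Sum>k<n. sobolev_norm \<delta>W (cut_feature \<delta>X R k)) \<le> (B + (2 * R + 2)) / \<kappa>" .
qed

lemma AE_fst_noise: "AE \<eta> in noise. Q \<eta> \<Longrightarrow> AE p in noise \<Otimes>\<^sub>M noise. Q (fst p)"
  and AE_snd_noise: "AE \<xi> in noise. Q \<xi> \<Longrightarrow> AE p in noise \<Otimes>\<^sub>M noise. Q (snd p)"
proof -
  assume "AE \<eta> in noise. Q \<eta>"
  then obtain N where N: "{x \<in> space noise. \<not> Q x} \<subseteq> N" "emeasure noise N = 0" "N \<in> sets noise" by (rule AE_E)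
  have "emeasure (noise \<Otimes>\<^sub>M noise) (N \<times> UNIV) = 0"
    using noise.emeasure_pair_measure_Times[of N noise UNIV] N sets.top[of noise] by simp
  then show "AE p in noise \<Otimes>\<^sub>M noise. Q (fst p)"
    using N sets.top[of noise] by (intro AE_I[of _ _ "N \<times> UNIV"]) auto
next
  assume "AE \<xi> in noise. Q \<xi>"
  then obtain N where N: "{x \<in> space noise. \<not> Q x} \<subseteq> N" "emeasure noise N = 0" "N \<in> sets noise" by (rule AE_E)
  have "emeasure (noise \<Otimes>\<^sub>M noise) (UNIV \<times> N) = 0"
    using noise.emeasure_pair_measure_Times[of UNIV noise N] N sets.top[of noise] by simp
  then show "AE p in noise \<Otimes>\<^sub>M noise. Q (snd p)"
    using N sets.top[of noise] by (intro AE_I[of _ _ "UNIV \<times> N"]) auto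
qed

text \<open>The index set may be uncountable, so the exceptional sets cannot be united; but a law on
  the product sigma-algebra is determined by finitely many coordinates at a time.\<close>

lemma distr_modification_eq:
  assumes M: "prob_space M" and f: "f \<in> measurable M (\<Pi>\<^sub>M i\<in>I. N i)" and g: "g \<in> measurable M (\<Pi>\<^sub>M i\<in>I. N i)"
    and eq: "\<And>i. i \<in> I \<Longrightarrow> AE x in M. f x i = g x i"
  shows "distr M (\<Pi>\<^sub>M i\<in>I. N i) f = distr M (\<Pi>\<^sub>M i\<in>I. N i) g"
proof (rule measure_eqI_PiM_infinite)
  interpret prob_space M by fact
  interpret d: prob_space "distr M (\<Pi>\<^sub>M i\<in>I. N i) f" by (rule prob_space_distr[OF f])
  show "finite_measure (distr M (\<Pi>\<^sub>M i\<in>I. N i) f)" by (rule d.finite_measure_axioms)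
  fix A J assume J: "finite J" "J \<subseteq> I" and A: "\<And>i. i \<in> J \<Longrightarrow> A i \<in> sets (N i)"
  let ?E = "prod_emb I N J (Pi\<^sub>E J A)"
  have E: "?E \<in> sets (\<Pi>\<^sub>M i\<in>I. N i)" using J A by (intro sets_PiM_I) auto
  have "AE x in M. \<forall>i\<in>J. f x i = g x i" using J eq by (intro AE_finite_allI) auto
  then have "AE x in M. x \<in> f -` ?E \<inter> space M \<longleftrightarrow> x \<in> g -` ?E \<inter> space M"
  proof eventually_elim
    case (elim x)
    show ?case
    proof (cases "x \<in> space M")
      case True
      then have "f x \<in> space (\<Pi>\<^sub>M i\<in>I. N i)" "g x \<in> space (\<Pi>\<^sub>M i\<in>I. N i)"
        using measurable_space[OF f] measurable_space[OF g] by auto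
      then show ?thesis using elim by (auto simp: prod_emb_def space_PiM PiE_iff)
    qed simp
  qed
  then have "emeasure M (f -` ?E \<inter> space M) = emeasure M (g -` ?E \<inter> space M)"
    using measurable_sets[OF f E] measurable_sets[OF g E] by (intro emeasure_eq_AE) auto
  then show "emeasure (distr M (\<Pi>\<^sub>M i\<in>I. N i) f) ?E = emeasure (distr M (\<Pi>\<^sub>M i\<in>I. N i) g) ?E"
    using E f g by (simp add: emeasure_distr)
qed auto

text \<open>Fatou's lemma: the mean square of Z - X is at most the lower limit of the bounds
  \<open>c n\<close>, which is 0.\<close>

lemma AE_eq_of_L2_limit:
  fixes Y :: "nat \<Rightarrow> 'a \<Rightarrow> real"
  assumes [measurable]: "\<And>n. Y n \<in> borel_measurable M" "X \<in> borel_measurable M" "Z \<in> borel_measurable M"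
    and Y: "AE x in M. (\<lambda>n. Y n x) \<longlonglongrightarrow> Z x" and i: "\<And>n. integrable M (\<lambda>x. (Y n x - X x)\<^sup>2)"
    and b: "\<And>n. (\<integral>x. (Y n x - X x)\<^sup>2 \<partial>M) \<le> c n" and c: "c \<longlonglongrightarrow> 0"
  shows "AE x in M. Z x = X x"
proof -
  have "(\<integral>\<^sup>+x. ennreal ((Z x - X x)\<^sup>2) \<partial>M) = (\<integral>\<^sup>+x. liminf (\<lambda>n. ennreal ((Y n x - X x)\<^sup>2)) \<partial>M)"
  proof (rule nn_integral_cong_AE)
    show "AE x in M. ennreal ((Z x - X x)\<^sup>2) = liminf (\<lambda>n. ennreal ((Y n x - X x)\<^sup>2))"
      using Y
    proof eventually_elim
      case (elim x)
      then have "(\<lambda>n. ennreal ((Y n x - X x)\<^sup>2)) \<longlonglongrightarrow> ennreal ((Z x - X x)\<^sup>2)"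
        by (intro tendsto_ennrealI tendsto_intros)
      then show ?case by (intro lim_imp_Liminf[symmetric]) auto
    qed
  qed
  also have "\<dots> \<le> liminf (\<lambda>n. \<integral>\<^sup>+x. ennreal ((Y n x - X x)\<^sup>2) \<partial>M)"
    by (intro nn_integral_liminf) measurable
  also have "\<dots> \<le> liminf (\<lambda>n. ennreal (c n))"
  proof (intro Liminf_mono always_eventually allI)
    fix n
    have "(\<integral>\<^sup>+x. ennreal ((Y n x - X x)\<^sup>2) \<partial>M) = ennreal (\<integral>x. (Y n x - X x)\<^sup>2 \<partial>M)"
      using i by (intro nn_integral_eq_integral) auto
    then show "(\<integral>\<^sup>+x. ennreal ((Y n x - X x)\<^sup>2) \<partial>M) \<le> ennreal (c n)" using b[of n] by (simp add: ennreal_leI)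
  qed
  also have "liminf (\<lambda>n. ennreal (c n)) = ennreal 0"
    using c by (intro lim_imp_Liminf tendsto_ennrealI) auto
  finally have "(\<integral>\<^sup>+x. ennreal ((Z x - X x)\<^sup>2) \<partial>M) = 0" by simp
  then have "AE x in M. ennreal ((Z x - X x)\<^sup>2) = 0"
    by (subst (asm) nn_integral_0_iff_AE) auto
  then show ?thesis by eventually_elim (simp add: ennreal_eq_0_iff)
qed

lemma square_summable_of_bounded:
  assumes "\<And>n. (\<Sum>i<n. (v i)\<^sup>2) \<le> C"
  shows "square_summable v" "norm_sq v \<le> C"
proof -
  show *: "square_summable v"
    unfolding square_summable_def using assms by (intro summableI_nonneg_bounded) auto
  show "norm_sq v \<le> C"
    unfolding norm_sq_def using * assms unfolding square_summable_def by (intro suminf_le_const) auto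
qed

lemma AE_square_summable:
  assumes [measurable]: "\<And>i. (\<lambda>\<eta>. m \<eta> i) \<in> borel_measurable M"
    and "(\<integral>\<^sup>+\<eta>. (\<Sum>i. ennreal ((m \<eta> i)\<^sup>2)) \<partial>M) \<le> ennreal C"
  shows "AE \<eta> in M. square_summable (m \<eta>)"
proof -
  have "AE \<eta> in M. (\<Sum>i. ennreal ((m \<eta> i)\<^sup>2)) \<noteq> \<infinity>"
    using assms(2) by (intro nn_integral_PInf_AE) (auto simp: top_unique)
  then show ?thesis
    unfolding square_summable_def by eventually_elim (intro summable_suminf_not_top; auto)
qed

text \<open>The random element \<open>m \<eta>\<close> of \<open>\<ell>\<^sup>2\<close> that represents the path of \<open>X\<close> on \<open>[-R, R]\<close> in the
  coordinates of \<open>W\<close>.\<close>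

lemma path_coordinates:
  assumes \<delta>: "0 < \<delta>W" "\<delta>X < 2" "\<delta>X > \<delta>W + 1" and R: "R \<ge> 0"
  obtains m C where "\<And>i. (\<lambda>\<eta>. m \<eta> i) \<in> borel_measurable noise"
    "(\<integral>\<^sup>+\<eta>. (\<Sum>i. ennreal ((m \<eta> i)\<^sup>2)) \<partial>noise) \<le> ennreal C"
    "\<And>t. \<bar>t\<bar> \<le> R \<Longrightarrow> AE \<eta> in noise. (\<Sum>i. pe_feature \<delta>W t i * m \<eta> i) = isonormal (pe_feature \<delta>X t) \<eta>"
proof -
  have dX: "0 < \<delta>X" "\<delta>X < 2" and dW: "\<delta>W < 1" "\<delta>W < 2" using \<delta> by auto
  let ?x = "cut_feature \<delta>X R" and ?w = "pe_feature \<delta>W" and ?e = "pe_feature \<delta>X"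
  define N where "N k = sobolev_norm \<delta>W (?x k)" for k
  obtain C where C: "\<And>n. (\<Sum>k<n. N k) \<le> C"
    using sobolev_norm_cut_feature_bounded[OF \<delta> R] unfolding N_def by blast
  let ?r = "residual (pe_kernel \<delta>W) rational_seq"
  \<comment> \<open>Row \<open>k\<close> of the matrix chosen here holds the coordinates of the
    \<open>k\<close>-th localized feature of X in the features of W. The errors are proportional to
    \<open>N k\<close>, so they can be summed over \<open>k\<close>.\<close>
  have "\<forall>k. \<exists>m. (\<forall>n. (\<Sum>i<n. (m i)\<^sup>2) \<le> N k) \<and> (\<forall>n t. (?x k t - (\<Sum>i<n. ?w t i * m i))\<^sup>2 \<le> N k * ?r n t t)"
  proof
    fix k
    have "2 * (\<Sum>s\<in>S. c s * ?x k s) \<le> qform (pe_kernel \<delta>W) S c + N k" if S: "finite S" for S c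
      unfolding N_def
      by (rule rkhs_norm_bound[OF \<delta>(1) dW(1) cut_feature_continuous[OF dX] cut_feature_support _ shift_energy_cut_feature_le[OF dX R] S])
        (use \<delta> in auto)
    then show "\<exists>m. (\<forall>n. (\<Sum>i<n. (m i)\<^sup>2) \<le> N k) \<and> (\<forall>n t. (?x k t - (\<Sum>i<n. ?w t i * m i))\<^sup>2 \<le> N k * ?r n t t)"
    proof (rule rkhs_coefficients[OF psd_pe_kernel[OF \<delta>(1) dW(2)], where q=rational_seq])
      fix m
      assume "\<And>n. (\<Sum>i<n. (m i)\<^sup>2) \<le> N k"
        "\<And>n t. (?x k t - (\<Sum>i<n. feature (pe_kernel \<delta>W) rational_seq t i * m i))\<^sup>2 \<le> N k * ?r n t t"
      then show ?thesis unfolding pe_feature_def by (intro exI[of _ m] conjI allI)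
    qed
  qed
  from choice[OF this] obtain M where M: "\<And>k n. (\<Sum>i<n. (M k i)\<^sup>2) \<le> N k"
    "\<And>k n t. (?x k t - (\<Sum>i<n. ?w t i * M k i))\<^sup>2 \<le> N k * residual (pe_kernel \<delta>W) rational_seq n t t"
    by blast
  have M2: "(\<Sum>i<n. \<Sum>k<K. (M k i)\<^sup>2) \<le> C" for n K
  proof -
    have "(\<Sum>i<n. \<Sum>k<K. (M k i)\<^sup>2) = (\<Sum>k<K. \<Sum>i<n. (M k i)\<^sup>2)" by (rule sum.swap)
    also have "\<dots> \<le> (\<Sum>k<K. N k)" by (intro sum_mono M)
    also have "\<dots> \<le> C" by (rule C)
    finally show ?thesis .
  qed
  have sM: "square_summable (\<lambda>k. M k i)" for i
  proof (rule square_summable_of_bounded)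
    fix K
    have "(\<Sum>k<K. (M k i)\<^sup>2) \<le> (\<Sum>i<Suc i. \<Sum>k<K. (M k i)\<^sup>2)" by (rule member_le_sum) (auto intro: sum_nonneg)
    then show "(\<Sum>k<K. (M k i)\<^sup>2) \<le> C" using M2[where n="Suc i" and K=K] by linarith
  qed
  have nM: "(\<Sum>i<n. norm_sq (\<lambda>k. M k i)) \<le> C" for n
  proof -
    have "(\<lambda>K. \<Sum>i<n. \<Sum>k<K. (M k i)\<^sup>2) \<longlonglongrightarrow> (\<Sum>i<n. norm_sq (\<lambda>k. M k i))"
      unfolding norm_sq_def using sM unfolding square_summable_def by (intro tendsto_sum summable_LIMSEQ)
    then show ?thesis by (rule LIMSEQ_le_const2) (use M2 in auto)
  qed
  \<comment> \<open>The Gaussian series over \<open>k\<close> with coefficients from column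
    \<open>i\<close>. Its variance is the squared norm of that column, and these variances sum to at
    most \<open>C\<close>.\<close>
  define m where "m \<eta> i = isonormal (\<lambda>k. M k i) \<eta>" for \<eta> i
  have mm[measurable]: "(\<lambda>\<eta>. m \<eta> i) \<in> borel_measurable noise" for i unfolding m_def by measurable
  have mg: "centred_gaussian noise (\<lambda>\<eta>. m \<eta> i) (norm_sq (\<lambda>k. M k i))" for i
    unfolding m_def by (rule isonormal_gaussian[OF sM])
  have C0: "C \<ge> 0" using C[of 0] by simp
  have int: "(\<integral>\<^sup>+\<eta>. (\<Sum>i. ennreal ((m \<eta> i)\<^sup>2)) \<partial>noise) \<le> ennreal C"
  proof -
    have "(\<integral>\<^sup>+\<eta>. (\<Sum>i. ennreal ((m \<eta> i)\<^sup>2)) \<partial>noise) = (\<Sum>i. \<integral>\<^sup>+\<eta>. ennreal ((m \<eta> i)\<^sup>2) \<partial>noise)"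
      by (intro nn_integral_suminf) measurable
    also have "\<dots> = (\<Sum>i. ennreal (norm_sq (\<lambda>k. M k i)))"
      using centred_gaussian_second[OF mg] centred_gaussian_integrable_power[OF mg, of _ 2]
      by (intro suminf_cong) (subst nn_integral_eq_integral, auto)
    also have "\<dots> \<le> ennreal C"
    proof (rule suminf_le_const)
      fix n
      have "norm_sq (\<lambda>k. M k i) \<ge> 0" for i using mg[of i] by (simp add: centred_gaussian_def)
      then have "(\<Sum>i<n. ennreal (norm_sq (\<lambda>k. M k i))) = ennreal (\<Sum>i<n. norm_sq (\<lambda>k. M k i))" by (intro sum_ennreal) auto
      then show "(\<Sum>i<n. ennreal (norm_sq (\<lambda>k. M k i))) \<le> ennreal C" using nM[of n] by (simp add: ennreal_leI)
    qed simp
    finally show ?thesis .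
  qed
  have AEm: "AE \<eta> in noise. square_summable (m \<eta>)"
    by (rule AE_square_summable[OF mm int])
  have sw: "square_summable (?w t)" for t
    by (rule square_summable_pe_feature[OF \<delta>(1) dW(2)])
  have se: "square_summable (?e t)" for t
    by (rule square_summable_pe_feature[OF dX])
  have rep: "AE \<eta> in noise. (\<Sum>i. ?w t i * m \<eta> i) = isonormal (?e t) \<eta>" if t: "\<bar>t\<bar> \<le> R" for t
  proof (rule AE_eq_of_L2_limit[where Y="\<lambda>n \<eta>. \<Sum>i<n. ?w t i * m \<eta> i" and c="\<lambda>n. C * residual (pe_kernel \<delta>W) rational_seq n t t"])
    show "AE \<eta> in noise. (\<lambda>n. \<Sum>i<n. ?w t i * m \<eta> i) \<longlonglongrightarrow> (\<Sum>i. ?w t i * m \<eta> i)"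
      using AEm by eventually_elim (intro summable_LIMSEQ square_summable_mult sw)
    \<comment> \<open>On [-R, R] the cut-off equals 1, so localization has not altered X.\<close>
    have xe: "?x k t = ?e t k" for k using t by (simp add: cut_feature_def cutoff_def)
    \<comment> \<open>The error of the \<open>n\<close>-th partial sum is itself a Gaussian series,
      whose \<open>k\<close>-th coefficient is up to sign the expansion error of the
      \<open>k\<close>-th feature at \<open>t\<close>.\<close>
    have G: "centred_gaussian noise (\<lambda>\<eta>. (\<Sum>i<n. ?w t i * m \<eta> i) - isonormal (?e t) \<eta>)
        (norm_sq (\<lambda>k. 1 * (\<Sum>i<n. ?w t i * M k i) + -1 * ?e t k))" for n
    proof -
      have s: "square_summable (\<lambda>k. \<Sum>i<n. ?w t i * M k i)" using sM by (intro square_summable_sum) auto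
      have "AE \<eta> in noise. isonormal (\<lambda>k. \<Sum>i<n. ?w t i * M k i) \<eta> = (\<Sum>i<n. ?w t i * m \<eta> i)"
        unfolding m_def using sM by (intro isonormal_sum[where v="\<lambda>i k. M k i"]) auto
      with isonormal_linear[OF s se, of 1 "-1" t]
      have "AE \<eta> in noise. isonormal (\<lambda>k. 1 * (\<Sum>i<n. ?w t i * M k i) + -1 * ?e t k) \<eta> = (\<Sum>i<n. ?w t i * m \<eta> i) - isonormal (?e t) \<eta>"
        by eventually_elim simp
      then show ?thesis
        by (rule centred_gaussian_cong_AE[OF isonormal_gaussian[OF square_summable_add[OF s se]]]) measurable
    qed
    show "integrable noise (\<lambda>\<eta>. ((\<Sum>i<n. ?w t i * m \<eta> i) - isonormal (?e t) \<eta>)\<^sup>2)" for n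
      by (rule centred_gaussian_integrable_power[OF G])
    fix n
    have r0: "residual (pe_kernel \<delta>W) rational_seq n t t \<ge> 0"
      by (intro psd_kernel_diag psd_residual psd_pe_kernel \<delta> dW)
    have "norm_sq (\<lambda>k. 1 * (\<Sum>i<n. ?w t i * M k i) + -1 * ?e t k) \<le> C * residual (pe_kernel \<delta>W) rational_seq n t t"
    proof (rule square_summable_of_bounded)
      fix K
      have "(\<Sum>k<K. (1 * (\<Sum>i<n. ?w t i * M k i) + -1 * ?e t k)\<^sup>2) = (\<Sum>k<K. (?x k t - (\<Sum>i<n. ?w t i * M k i))\<^sup>2)"
        by (simp add: xe power2_commute)
      also have "\<dots> \<le> (\<Sum>k<K. N k * residual (pe_kernel \<delta>W) rational_seq n t t)" by (intro sum_mono M)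
      also have "\<dots> \<le> C * residual (pe_kernel \<delta>W) rational_seq n t t"
        unfolding sum_distrib_right[symmetric] by (intro mult_right_mono C r0)
      finally show "(\<Sum>k<K. (1 * (\<Sum>i<n. ?w t i * M k i) + -1 * ?e t k)\<^sup>2) \<le> C * residual (pe_kernel \<delta>W) rational_seq n t t" .
    qed
    then show "(\<integral>\<eta>. ((\<Sum>i<n. ?w t i * m \<eta> i) - isonormal (?e t) \<eta>)\<^sup>2 \<partial>noise) \<le> C * residual (pe_kernel \<delta>W) rational_seq n t t"
      using centred_gaussian_second[OF G] by simp
  next
    have "(\<lambda>n. C * residual (pe_kernel \<delta>W) rational_seq n t t) \<longlonglongrightarrow> C * 0"
      by (intro tendsto_mult tendsto_const residual_diag_tendsto psd_pe_kernel pe_kernel_dense \<delta> dW)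
    then show "(\<lambda>n. C * residual (pe_kernel \<delta>W) rational_seq n t t) \<longlonglongrightarrow> 0" by simp
  qed measurable
  show ?thesis by (rule that[OF mm int rep])
qed

definition path_shift :: "((nat \<Rightarrow> real) \<Rightarrow> nat \<Rightarrow> real) \<Rightarrow> (nat \<Rightarrow> real) \<times> (nat \<Rightarrow> real) \<Rightarrow> (nat \<Rightarrow> real) \<times> (nat \<Rightarrow> real)" where
  "path_shift m p = (fst p, \<lambda>i. snd p i + m (fst p) i)"

lemma path_shift_measurable[measurable]:
  assumes [measurable]: "\<And>i. (\<lambda>\<eta>. m \<eta> i) \<in> borel_measurable noise"
  shows "path_shift m \<in> measurable (noise \<Otimes>\<^sub>M noise) (noise \<Otimes>\<^sub>M noise)"
  unfolding path_shift_def
  by (intro measurable_Pair noise_measurableI) measurable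

text \<open>Given \<open>\<eta>\<close> the shift is deterministic, and the Cameron-Martin bound
  applies with a constant depending on the norm of \<open>m \<eta>\<close>. Large norms cost
  probability 1 / 4, and passing from the squared to a linear bound costs another 1 / 4. The total 1
  / 2 only has to be below 1.\<close>

lemma path_shift_measure_le:
  assumes m[measurable]: "\<And>i. (\<lambda>\<eta>. m \<eta> i) \<in> borel_measurable noise"
    and C: "(\<integral>\<^sup>+\<eta>. (\<Sum>i. ennreal ((m \<eta> i)\<^sup>2)) \<partial>noise) \<le> ennreal C" "C \<ge> 0"
    and E[measurable]: "E \<in> sets (noise \<Otimes>\<^sub>M noise)"
  shows "measure (noise \<Otimes>\<^sub>M noise) (path_shift m -` E) \<le> exp (4 * C + 4) * measure (noise \<Otimes>\<^sub>M noise) E + 1 / 2"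
proof -
  define G where "G \<eta> = (\<Sum>i. ennreal ((m \<eta> i)\<^sup>2))" for \<eta>
  have [measurable]: "G \<in> borel_measurable noise" unfolding G_def by measurable
  \<comment> \<open>The factor 4 gives probability at most C / H <= 1 / 4 by Markov's inequality;
    the added 4 keeps \<open>H\<close> positive when C = 0.\<close>
  define H where "H = 4 * C + 4"
  define B where "B = {\<eta> \<in> space noise. G \<eta> \<ge> ennreal H}"
  have B[measurable]: "B \<in> sets noise" unfolding B_def by measurable
  have H: "H > 0" using C by (simp add: H_def)
  have PB: "emeasure noise B \<le> ennreal (1 / 4)"
  proof -
    have "ennreal H * emeasure noise B = (\<integral>\<^sup>+\<eta>. ennreal H * indicator B \<eta> \<partial>noise)"
      by (simp add: nn_integral_cmult_indicator)
    also have "\<dots> \<le> (\<integral>\<^sup>+\<eta>. G \<eta> \<partial>noise)"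
      by (intro nn_integral_mono) (auto simp: B_def indicator_def)
    also have "\<dots> \<le> ennreal C" unfolding G_def by (rule C)
    finally have "ennreal (H * measure noise B) \<le> ennreal C"
      using H by (simp add: noise.emeasure_eq_measure ennreal_mult)
    then have "H * measure noise B \<le> C" using C by (simp add: ennreal_le_iff)
    also have "C \<le> H * (1 / 4)" by (simp add: H_def)
    finally have "measure noise B \<le> 1 / 4" by (rule mult_left_le_imp_le[OF _ H])
    then show ?thesis by (simp add: noise.emeasure_eq_measure ennreal_leI)
  qed
  let ?E = "\<lambda>\<eta>. Pair \<eta> -` E"
  have Es: "?E \<eta> \<in> sets noise" for \<eta> by (rule sets_Pair1[OF E])
  have section_le: "emeasure noise (Pair \<eta> -` (path_shift m -` E)) \<le>
      ennreal (exp H) * emeasure noise (?E \<eta>) + ennreal (1 / 4) + indicator B \<eta>" for \<eta>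
  proof (cases "\<eta> \<in> B")
    case True
    have "emeasure noise (Pair \<eta> -` (path_shift m -` E)) \<le> 1" by (rule noise.subprob_emeasure_le_1)
    also have "1 \<le> ennreal (exp H) * emeasure noise (?E \<eta>) + ennreal (1 / 4) + indicator B \<eta>"
      using True by simp
    finally show ?thesis .
  next
    case False
    then have GH: "G \<eta> \<le> ennreal H" by (auto simp: B_def not_le)
    have b: "(\<Sum>i<n. (m \<eta> i)\<^sup>2) \<le> H" for n
    proof -
      have "ennreal (\<Sum>i<n. (m \<eta> i)\<^sup>2) = (\<Sum>i<n. ennreal ((m \<eta> i)\<^sup>2))" by (subst sum_ennreal) auto
      also have "\<dots> \<le> G \<eta>" unfolding G_def by (intro sum_le_suminf) auto
      finally have "ennreal (\<Sum>i<n. (m \<eta> i)\<^sup>2) \<le> ennreal H" using GH by (rule order.trans)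
      then show ?thesis using H by (simp add: ennreal_le_iff)
    qed
    have e: "Pair \<eta> -` (path_shift m -` E) = (\<lambda>\<xi> i. \<xi> i + m \<eta> i) -` (?E \<eta>)"
      by (auto simp: path_shift_def)
    define a where "a = measure noise ((\<lambda>\<xi> i. \<xi> i + m \<eta> i) -` (?E \<eta>))"
    have a: "a\<^sup>2 \<le> exp H * measure noise (?E \<eta>)" unfolding a_def by (rule noise_shift_le[OF Es b])
    \<comment> \<open>Linearizes the squared bound through a <= a^2 + 1 / 4, so that it can be
      integrated over \<open>\<eta>\<close>.\<close>
    have "0 \<le> (a - 1 / 2)\<^sup>2" by simp
    then have "a \<le> a\<^sup>2 + 1 / 4" by (simp add: power2_eq_square algebra_simps)
    then have "a \<le> exp H * measure noise (?E \<eta>) + 1 / 4" using a by linarith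
    then have "ennreal a \<le> ennreal (exp H * measure noise (?E \<eta>) + 1 / 4)" by (rule ennreal_leI)
    then show ?thesis
      using False unfolding e by (simp add: noise.emeasure_eq_measure a_def ennreal_mult ennreal_plus)
  qed
  have PE: "path_shift m -` E \<in> sets (noise \<Otimes>\<^sub>M noise)"
    using measurable_sets[OF path_shift_measurable[OF m] E] by (simp add: space_pair_measure)
  have "emeasure (noise \<Otimes>\<^sub>M noise) (path_shift m -` E) = (\<integral>\<^sup>+\<eta>. emeasure noise (Pair \<eta> -` (path_shift m -` E)) \<partial>noise)"
    by (rule noise.emeasure_pair_measure_alt[OF PE])
  also have "\<dots> \<le> (\<integral>\<^sup>+\<eta>. ennreal (exp H) * emeasure noise (?E \<eta>) + ennreal (1 / 4) + indicator B \<eta> \<partial>noise)"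
    by (intro nn_integral_mono section_le)
  also have "\<dots> = ennreal (exp H) * (\<integral>\<^sup>+\<eta>. emeasure noise (?E \<eta>) \<partial>noise) + ennreal (1 / 4) + emeasure noise B"
    using noise.measurable_emeasure_Pair[OF E]
    by (simp add: nn_integral_add nn_integral_cmult noise.emeasure_space_1[unfolded space_noise])
  also have "(\<integral>\<^sup>+\<eta>. emeasure noise (?E \<eta>) \<partial>noise) = emeasure (noise \<Otimes>\<^sub>M noise) E"
    by (rule noise.emeasure_pair_measure_alt[OF E, symmetric])
  also have "ennreal (exp H) * emeasure (noise \<Otimes>\<^sub>M noise) E + ennreal (1 / 4) + emeasure noise B
      \<le> ennreal (exp H) * emeasure (noise \<Otimes>\<^sub>M noise) E + ennreal (1 / 4) + ennreal (1 / 4)"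
    by (intro add_left_mono PB)
  also have "\<dots> = ennreal (exp H * measure (noise \<Otimes>\<^sub>M noise) E + 1 / 2)"
    by (simp add: noise_pair.emeasure_eq_measure ennreal_mult[symmetric] ennreal_plus[symmetric] del: ennreal_plus)
  finally have "ennreal (measure (noise \<Otimes>\<^sub>M noise) (path_shift m -` E)) \<le> ennreal (exp H * measure (noise \<Otimes>\<^sub>M noise) E + 1 / 2)"
    by (simp only: noise_pair.emeasure_eq_measure)
  then show ?thesis by (subst (asm) ennreal_le_iff) (auto simp: H_def)
qed

lemma observed_measurable[measurable]:
  "observed D \<beta> \<in> measurable (\<Pi>\<^sub>M s\<in>UNIV. borel) (\<Pi>\<^sub>M s\<in>D. borel)"
  unfolding observed_def[abs_def]
  by (intro measurable_restrict borel_measurable_Pair borel_measurable_add borel_measurable_times borel_measurable_const field_measurable)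

theorem not_consistently_estimable:
  assumes D: "bounded D" and \<delta>: "0 < \<delta>W" "\<delta>X < 2" "\<delta>X > \<delta>W + 1"
  shows "\<not> consistently_estimable D \<delta>X \<delta>W"
proof
  assume "consistently_estimable D \<delta>X \<delta>W"
  then obtain T where T: "consistent_estimator D \<delta>X \<delta>W T" by (auto simp: consistently_estimable_def)
  have dX: "0 < \<delta>X" "\<delta>X < 2" and dW: "\<delta>W < 1" "\<delta>W < 2" using \<delta> by auto
  let ?w = "pe_feature \<delta>W" and ?e = "pe_feature \<delta>X"
  obtain R0 where "\<forall>t\<in>D. norm t \<le> R0" using D by (auto simp: bounded_iff)
  \<comment> \<open>The maximum with 0 covers an empty \<open>D\<close>, for which \<open>R0\<close>
    may be negative.\<close>
  define R where "R = max 0 R0"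
  have R: "R \<ge> 0" "\<And>t. t \<in> D \<Longrightarrow> \<bar>t\<bar> \<le> R" using \<open>\<forall>t\<in>D. norm t \<le> R0\<close> by (auto simp: R_def le_max_iff_disj)
  obtain m C0 where m[measurable]: "\<And>i. (\<lambda>\<eta>. m \<eta> i) \<in> borel_measurable noise"
    and int: "(\<integral>\<^sup>+\<eta>. (\<Sum>i. ennreal ((m \<eta> i)\<^sup>2)) \<partial>noise) \<le> ennreal C0"
    and rep: "\<And>t. \<bar>t\<bar> \<le> R \<Longrightarrow> AE \<eta> in noise. (\<Sum>i. ?w t i * m \<eta> i) = isonormal (?e t) \<eta>"
    using path_coordinates[OF \<delta> R(1)] by blast
  define C where "C = max 0 C0"
  have int': "(\<integral>\<^sup>+\<eta>. (\<Sum>i. ennreal ((m \<eta> i)\<^sup>2)) \<partial>noise) \<le> ennreal C" and C: "C \<ge> 0"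
    by (rule order.trans[OF int]) (auto simp: C_def intro!: ennreal_leI)
  define \<Omega> where "\<Omega> = noise \<Otimes>\<^sub>M noise"
  have sp: "space \<Omega> = UNIV" by (simp add: \<Omega>_def space_pair_measure)
  define P where "P = field_law ?e ?w"
  define obs where "obs \<beta> p = observed D \<beta> (field_map ?e ?w p)" for \<beta> p
  have obs[measurable]: "obs \<beta> \<in> measurable \<Omega> (\<Pi>\<^sub>M s\<in>D. borel)" for \<beta>
    unfolding obs_def \<Omega>_def by measurable
  have AEm: "AE \<eta> in noise. square_summable (m \<eta>)"
    by (rule AE_square_summable[OF m int])
  have sw: "square_summable (?w t)" for t
    by (rule square_summable_pe_feature[OF \<delta>(1) dW(2)])
  \<comment> \<open>At a site of \<open>D\<close> the shift adds the value of X to that of W and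
    leaves X alone, so the data (X, W) of \<beta> = 0 become the data (X, X + W) of \<beta> = 1,
    almost surely for each site.\<close>
  have law: "distr \<Omega> (\<Pi>\<^sub>M s\<in>D. borel) (\<lambda>p. obs 0 (path_shift m p)) = distr \<Omega> (\<Pi>\<^sub>M s\<in>D. borel) (obs 1)"
  proof (rule distr_modification_eq)
    show "prob_space \<Omega>" unfolding \<Omega>_def by (rule prob_space_noise_pair)
    show "(\<lambda>p. obs 0 (path_shift m p)) \<in> measurable \<Omega> (\<Pi>\<^sub>M s\<in>D. borel)"
      using measurable_compose[OF path_shift_measurable[OF m] obs[unfolded \<Omega>_def]] by (simp add: \<Omega>_def)
    fix t assume t: "t \<in> D"
    show "AE p in \<Omega>. obs 0 (path_shift m p) t = obs 1 p t"
      unfolding \<Omega>_def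
      using AE_fst_noise[OF AEm] AE_fst_noise[OF rep[OF R(2)[OF t]]] AE_snd_noise[OF AE_partial_level_convergent[OF sw[of t]]]
    proof eventually_elim
      case (elim p)
      have "isonormal (?w t) (\<lambda>i. snd p i + m (fst p) i) = isonormal (?w t) (snd p) + isonormal (?e t) (fst p)"
        using isonormal_shift[OF sw elim(1) elim(3)] elim(2) by simp
      then show ?case
        using t by (simp add: obs_def observed_def field_map_def fieldX_def fieldW_def path_shift_def)
    qed
  qed (rule obs)
  \<comment> \<open>The threshold 1 / 2 separates the values 0 and 1: consistency with tolerance 1 /
    4 sends the probability of this event to 0 for \<beta> = 0 and to 1 for \<beta> = 1.\<close>
  define B where "B n = {z \<in> space (\<Pi>\<^sub>M s\<in>D. (borel :: (real \<times> real) measure)). T n z > 1 / 2}" for n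
  have [measurable]: "T n \<in> borel_measurable (\<Pi>\<^sub>M s\<in>D. borel)" for n
    using T by (simp add: consistent_estimator_def)
  have B: "B n \<in> sets (\<Pi>\<^sub>M s\<in>D. borel)" for n unfolding B_def by measurable
  have PB: "measure P {\<omega> \<in> space P. observed D \<beta> \<omega> \<in> A} = measure \<Omega> (obs \<beta> -` A)" if A: "A \<in> sets (\<Pi>\<^sub>M s\<in>D. borel)" for A \<beta>
  proof -
    have "{\<omega> \<in> space (\<Pi>\<^sub>M s\<in>UNIV. borel). observed D \<beta> \<omega> \<in> A} \<in> sets (\<Pi>\<^sub>M s\<in>UNIV. borel)"
      using measurable_sets[OF observed_measurable A] by (simp add: vimage_def Int_def conj_commute)
    then show ?thesis
      unfolding P_def field_law_def \<Omega>_def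
      by (subst measure_distr) (auto simp: obs_def vimage_def space_PiM space_pair_measure intro!: arg_cong2[where f=measure])
  qed
  have cons: "(\<lambda>n. measure P {\<omega> \<in> space P. \<bar>T n (observed D \<beta> \<omega>) - \<beta>\<bar> > 1 / 4}) \<longlonglongrightarrow> 0" for \<beta>
  proof -
    have "\<forall>\<beta>. \<forall>P\<in>model_laws \<delta>X \<delta>W. \<forall>\<epsilon>>0. (\<lambda>n. measure P {\<omega> \<in> space P. \<bar>T n (observed D \<beta> \<omega>) - \<beta>\<bar> > \<epsilon>}) \<longlonglongrightarrow> 0"
      by (rule conjunct2[OF T[unfolded consistent_estimator_def]])
    moreover have "P \<in> model_laws \<delta>X \<delta>W" unfolding P_def by (rule field_law_in_model[OF dX \<delta>(1) dW(2)])
    ultimately show ?thesis using zero_less_divide_1_iff[of "4::real"] zero_less_numeral by blast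
  qed
  have prP: "prob_space P" using bivariate_law_field_law[of ?e ?w] by (simp add: P_def bivariate_law_def)
  interpret P: prob_space P by (rule prP)
  have sP: "sets P = sets (\<Pi>\<^sub>M s\<in>UNIV. borel)" by (simp add: P_def field_law_def)
  have om: "observed D \<beta> \<in> measurable P (\<Pi>\<^sub>M s\<in>D. borel)" for \<beta>
    by (subst measurable_cong_sets[OF sP refl]) measurable
  have Tm: "{\<omega> \<in> space P. Q (T n (observed D \<beta> \<omega>))} \<in> sets P" if Q: "Measurable.pred borel Q" for Q n \<beta>
    using measurable_compose[OF measurable_compose[OF om, of "T n" borel] Q] by (simp add: pred_def)
  have m4: "{\<omega> \<in> space P. \<bar>T n (observed D \<beta> \<omega>) - \<beta>\<bar> > 1 / 4} \<in> sets P" for n \<beta>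
    by (rule Tm[of "\<lambda>x. \<bar>x - \<beta>\<bar> > 1 / 4"]) measurable
  have p0: "(\<lambda>n. measure \<Omega> (obs 0 -` B n)) \<longlonglongrightarrow> 0"
  proof (rule tendsto_sandwich[OF _ _ tendsto_const cons[of 0]])
    show "\<forall>\<^sub>F n in sequentially. measure \<Omega> (obs 0 -` B n) \<le> measure P {\<omega> \<in> space P. \<bar>T n (observed D 0 \<omega>) - 0\<bar> > 1 / 4}"
    proof (intro always_eventually allI)
      fix n
      have "measure P {\<omega> \<in> space P. observed D 0 \<omega> \<in> B n} \<le> measure P {\<omega> \<in> space P. \<bar>T n (observed D 0 \<omega>) - 0\<bar> > 1 / 4}"
        by (intro P.finite_measure_mono m4) (auto simp: B_def)
      then show "measure \<Omega> (obs 0 -` B n) \<le> measure P {\<omega> \<in> space P. \<bar>T n (observed D 0 \<omega>) - 0\<bar> > 1 / 4}" by (simp add: PB[OF B])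
    qed
  qed auto
  have p1: "measure \<Omega> (obs 1 -` B n) \<ge> 1 - measure P {\<omega> \<in> space P. \<bar>T n (observed D 1 \<omega>) - 1\<bar> > 1 / 4}" for n
  proof -
    have "1 - measure P {\<omega> \<in> space P. \<bar>T n (observed D 1 \<omega>) - 1\<bar> > 1 / 4} = measure P (space P - {\<omega> \<in> space P. \<bar>T n (observed D 1 \<omega>) - 1\<bar> > 1 / 4})"
      by (rule P.prob_compl[OF m4, symmetric])
    also have "\<dots> \<le> measure P {\<omega> \<in> space P. observed D 1 \<omega> \<in> B n}"
    proof (rule P.finite_measure_mono)
      show "{\<omega> \<in> space P. observed D 1 \<omega> \<in> B n} \<in> sets P"
        using measurable_sets[OF om B] by (simp add: vimage_def Int_def conj_commute)
      show "space P - {\<omega> \<in> space P. \<bar>T n (observed D 1 \<omega>) - 1\<bar> > 1 / 4} \<subseteq> {\<omega> \<in> space P. observed D 1 \<omega> \<in> B n}"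
        using measurable_space[OF om] by (auto simp: B_def abs_if split: if_splits)
    qed
    also have "\<dots> = measure \<Omega> (obs 1 -` B n)" by (rule PB[OF B])
    finally show ?thesis .
  qed
  have le: "measure \<Omega> (obs 1 -` B n) \<le> exp (4 * C + 4) * measure \<Omega> (obs 0 -` B n) + 1 / 2" for n
  proof -
    have "measure \<Omega> (obs 1 -` B n) = measure (distr \<Omega> (\<Pi>\<^sub>M s\<in>D. borel) (obs 1)) (B n)"
      using B by (subst measure_distr[OF obs]) (auto simp: sp)
    also have "\<dots> = measure (distr \<Omega> (\<Pi>\<^sub>M s\<in>D. borel) (\<lambda>p. obs 0 (path_shift m p))) (B n)" by (simp only: law)
    also have "\<dots> = measure \<Omega> (path_shift m -` (obs 0 -` B n))"
      using B measurable_compose[OF path_shift_measurable[OF m] obs[unfolded \<Omega>_def]]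
      by (subst measure_distr) (auto simp: sp \<Omega>_def vimage_def space_pair_measure)
    also have "\<dots> \<le> exp (4 * C + 4) * measure \<Omega> (obs 0 -` B n) + 1 / 2"
      unfolding \<Omega>_def
    proof (rule path_shift_measure_le[OF m int' C])
      show "obs 0 -` B n \<in> sets (noise \<Otimes>\<^sub>M noise)"
        using measurable_sets[OF obs B, of 0 n] by (simp add: sp) (simp add: \<Omega>_def)
    qed
    finally show ?thesis .
  qed
  \<comment> \<open>In the limit the shift inequality would bound 1 by 1 / 2.\<close>
  have "(\<lambda>n. exp (4 * C + 4) * measure \<Omega> (obs 0 -` B n) + 1 / 2 + measure P {\<omega> \<in> space P. \<bar>T n (observed D 1 \<omega>) - 1\<bar> > 1 / 4})
     \<longlonglongrightarrow> exp (4 * C + 4) * 0 + 1 / 2 + 0"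
    by (intro tendsto_intros p0 cons)
  then have "1 \<le> exp (4 * C + 4) * 0 + 1 / 2 + (0 :: real)"
  proof (rule LIMSEQ_le_const, intro exI allI impI)
    fix n
    show "1 \<le> exp (4 * C + 4) * measure \<Omega> (obs 0 -` B n) + 1 / 2 + measure P {\<omega> \<in> space P. \<bar>T n (observed D 1 \<omega>) - 1\<bar> > 1 / 4}"
      using p1[of n] le[of n] by linarith
  qed
  then show False by simp
qed

theorem corollary3:
  fixes D :: "real set" and \<delta>X \<delta>W :: real
  assumes "bounded D"
    and "\<exists>a b. a < b \<and> {a<..<b} \<subseteq> D"
    and "0 < \<delta>X" "\<delta>X < 2" "0 < \<delta>W" "\<delta>W < 2"
  shows "(\<delta>X < \<delta>W + 1 \<longrightarrow>
            consistently_estimable D \<delta>X \<delta>W \<and>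
            (\<forall>a b h. a < b \<and> {a..b} \<subseteq> D \<and> (\<forall>m. h m > 0) \<and> h \<longlonglongrightarrow> 0 \<longrightarrow>
               consistent_estimator D \<delta>X \<delta>W
                 (\<lambda>m. ols_diff a (h m) (nat \<lfloor>(b - a) / h m\<rfloor>))))
       \<and> (\<delta>X > \<delta>W + 1 \<longrightarrow> \<not> consistently_estimable D \<delta>X \<delta>W)"
proof (intro conjI impI)
  assume "\<delta>X > \<delta>W + 1"
  with assms show "\<not> consistently_estimable D \<delta>X \<delta>W" by (intro not_consistently_estimable)
next
  assume less: "\<delta>X < \<delta>W + 1"
  have ols: "consistent_estimator D \<delta>X \<delta>W (\<lambda>m. ols_diff a (h m) (nat \<lfloor>(b - a) / h m\<rfloor>))"
    if ab: "a < b" "{a..b} \<subseteq> D" and h: "\<And>m. h m > 0" "h \<longlonglongrightarrow> 0" for a b h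
    unfolding consistent_estimator_def
  proof (intro conjI allI ballI impI)
    fix m
    show "ols_diff a (h m) (nat \<lfloor>(b - a) / h m\<rfloor>) \<in> borel_measurable (\<Pi>\<^sub>M s\<in>D. borel)"
    proof (rule ols_diff_measurable)
      fix j assume "j \<le> nat \<lfloor>(b - a) / h m\<rfloor>"
      then have "real j \<le> (b - a) / h m" using ab(1) h(1)[of m] by (simp add: le_nat_iff le_floor_iff)
      then have "real j * h m \<le> b - a" using h(1)[of m] by (simp add: field_simps)
      moreover have "0 \<le> real j * h m" using h(1)[of m] by simp
      ultimately have "a + real j * h m \<in> {a..b}" by simp
      with ab(2) show "a + real j * h m \<in> D" by blast
    qed
  qed (use assms less ab h in \<open>auto intro: ols_consistent\<close>)
  then show "\<forall>a b h. a < b \<and> {a..b} \<subseteq> D \<and> (\<forall>m. h m > 0) \<and> h \<longlonglongrightarrow> 0 \<longrightarrow>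
      consistent_estimator D \<delta>X \<delta>W (\<lambda>m. ols_diff a (h m) (nat \<lfloor>(b - a) / h m\<rfloor>))"
    by blast
  obtain a b where ab: "a < b" "{a<..<b} \<subseteq> D" using assms(2) by blast
  \<comment> \<open>The lattice needs a closed interval inside \<open>D\<close>; the middle third of
    the given open interval provides one.\<close>
  have "consistent_estimator D \<delta>X \<delta>W
      (\<lambda>m. ols_diff ((2 * a + b) / 3) (1 / real (Suc m)) (nat \<lfloor>((a + 2 * b) / 3 - (2 * a + b) / 3) / (1 / real (Suc m))\<rfloor>))"
  proof (rule ols)
    show "(\<lambda>m. 1 / real (Suc m)) \<longlonglongrightarrow> 0" using LIMSEQ_inverse_real_of_nat by (simp add: inverse_eq_divide)
    show "{(2 * a + b) / 3..(a + 2 * b) / 3} \<subseteq> D"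
    proof
      fix x assume "x \<in> {(2 * a + b) / 3..(a + 2 * b) / 3}"
      with ab(1) have "x \<in> {a<..<b}" by simp
      with ab(2) show "x \<in> D" by blast
    qed
  qed (use ab in auto)
  then show "consistently_estimable D \<delta>X \<delta>W" unfolding consistently_estimable_def by blast
qed

end
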